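(* Let $r\ge 2$ and $n\ge 1$, let $\phi_0,\ldots,\phi_n$ be the Foulkes characters of $G_n=G(r,1,n)$, and let $0\le i,j,k\le n$. For any fixed $z\in G_n$ with exactly $k$ descents, $$[\phi_i\phi_j,\phi_k]=\bigl|\{(x,y)\in G_n\times G_n\mid \mathrm{des}(x)=i,\ \mathrm{des}(y)=j,\ xy=z\}\bigr|.$$
   Context: Fix an integer $r>1$, a primitive $r$-th root of unity $\zeta$, and $Z=\langle\zeta\rangle$. $G_n=G(r,1,n)$ is the group of $n\times n$ complex matrices with exactly one nonzero entry in each row and column, all nonzero entries lying in $Z$. Each $x\in G_n$ is $x=D A_\pi$ with $D$ diagonal and $A_\pi=(\delta_{i\pi(j)})$, $\pi\in S_n$. Descents (Steingr\'imsson): write $x e_i=\zeta^{z_i}e_{\pi(i)}$ for $1\le i\le n$, where $e_1,\ldots,e_n$ is the standard basis of $\mathbb{C}^n$ and $0\le z_i\le r-1$, and put $\pi(n+1)=n+1$, $z_{n+1}=0$. An index $i\in\{1,\ldots,n\}$ is a descent of $x$ if $z_i>z_{i+1}$, or $z_i=z_{i+1}$ and $\pi(i)>\pi(i+1)$. $\mathrm{des}(x)$ is the number of descents of $x$. The type of $x$ is the $r$-tuple of partitions $\lambda=(\lambda^0,\ldots,\lambda^{r-1})$, where the parts of $\lambda^j$ are the lengths of the cycles $(i_1\,i_2\,\ldots\,i_k)$ of $\pi$ with $x_{i_1i_2}x_{i_2i_3}\cdots x_{i_ki_1}=\zeta^j$; conjugacy classes correspond to types, and $K_\lambda$ is the class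 of elements of type $\lambda$. $\ell(x)$ is the number of parts of $\lambda^0$ (equivalently $\ell(x)=\dim\ker(x-1)$), and $C_i=\{x\in G_n\mid\ell(x)=i\}$, $0\le i\le n$. $\mathrm{CF}_\ell(G_n)$ is the complex vector space of functions $G_n\to\mathbb{C}$ depending only on $\ell$; $\vartheta(C_i)$ is the common value of such a $\vartheta$ on $C_i$. Products of characters are pointwise. The Foulkes characters $\phi_0,\ldots,\phi_n$ of $G_n$ are given by $\phi_i(x)=\sum_{j=0}^{n}(-1)^{i-j}\binom{n+1}{i-j}(rj+1)^{\ell(x)}$, with $\binom{a}{b}=0$ for $b<0$. The inner product on $\mathrm{CF}_\ell(G_n)$ is $[\vartheta,\psi]=\frac{1}{|G_n|}\sum_{i,j=0}^{n}\vartheta(C_i)\overline{\psi(C_j)}\mu(C_i,C_j)$, with $\mu$ as follows. For a sequence $\mathfrak a=(K_1,\ldots,K_m)$ of conjugacy classes of $G_n$, let $\mu_{\mathfrak a}(C_i,C_j)=\mathbf{E}\,|k_1k_2\cdots k_m C_i\cap C_j|$, where $k_1,\ldots,k_m$ are independent and $k_u$ is uniformly random in $K_u$. Let $\mathfrak a_1=(K_{((n),\emptyset,\ldots,\emptyset)},K_{((n),\emptyset,\ldots,\emptyset)})$, $\mathfrak a_2=(K_{((n),\emptyset,\ldots,\emptyset)},K_{(\emptyset,(n),\emptyset,\ldots,\emptyset)})$, $\mathfrak a_3=(K_{((n),\emptyset,\ldots,\emptyset)},K_{((n-1),(1),\emptyset,\ldots,\emptyset)})$, $\mathfrak a_4=(K_{((n),\emptyset,\ldots,\emptyset)},K_{((n),\emptyset,\ldots,\emptyset)},K_{((n-1,1),\emptyset,\ldots,\emptyset)},K_{((n-1,1),\emptyset,\ldots,\emptyset)})$,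 $\mathfrak a_5=(K_{((n),\emptyset,\ldots,\emptyset)},K_{((n),\emptyset,\ldots,\emptyset)},K_{((n-1),(1),\emptyset,\ldots,\emptyset)},K_{((n-1,1),\emptyset,\ldots,\emptyset)})$, and $\mu_i=\mu_{\mathfrak a_i}$. If $n=1$, $\mu=\frac{2}{r}\mu_1+\frac{r-2}{r}\mu_2$. If $n\ge 2$, $\mu=\frac1r\mu_1+\frac{r-2}{2r}\mu_2+\frac14\mu_3+\frac1{2r}\mu_4+\frac{r-2}{4r}\mu_5$. *)

theory Defs
  imports
    "HOL-Probability.Product_PMF"
    "HOL-Combinatorics.Orbits"
    "Jordan_Normal_Form.Matrix"
begin

text \<open>
  Matrix rows and columns are indexed by \<open>{0..<n}\<close>, so the index set \<open>{1, \<dots>, n}\<close> and the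
  additional index \<open>n + 1\<close> of the mathematical text are shifted down by one throughout.
\<close>

definition primitive_root_of_unity :: "nat \<Rightarrow> complex \<Rightarrow> bool" where
  "primitive_root_of_unity r \<zeta> \<longleftrightarrow> r > 0 \<and> \<zeta> ^ r = 1 \<and> (\<forall>k. 0 < k \<and> k < r \<longrightarrow> \<zeta> ^ k \<noteq> 1)"

text \<open>\<open>Grn \<zeta> n\<close> is \<open>G(r,1,n)\<close>; the group operation is matrix multiplication.\<close>

definition Grn :: "complex \<Rightarrow> nat \<Rightarrow> complex mat set" where
  "Grn \<zeta> n = {x \<in> carrier_mat n n.
     (\<forall>i<n. \<exists>!j. j < n \<and> x $$ (i, j) \<noteq> 0) \<and>
     (\<forall>j<n. \<exists>!i. i < n \<and> x $$ (i, j) \<noteq> 0) \<and>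
     (\<forall>i<n. \<forall>j<n. x $$ (i, j) \<noteq> 0 \<longrightarrow> x $$ (i, j) \<in> range (\<lambda>k::nat. \<zeta> ^ k))}"

definition sends_to :: "complex \<Rightarrow> nat \<Rightarrow> complex mat \<Rightarrow> nat \<Rightarrow> nat \<Rightarrow> nat \<Rightarrow> bool" where
  "sends_to \<zeta> n x i e p \<longleftrightarrow> x *\<^sub>v unit_vec n i = (\<zeta> ^ e) \<cdot>\<^sub>v unit_vec n p"

text \<open>The data \<open>\<pi>(i)\<close> and \<open>z\<^sub>i\<close> with \<open>x e\<^sub>i = \<zeta>\<^bsup>z\<^sub>i\<^esup> e\<^bsub>\<pi>(i)\<^esub>\<close>, extended by
  \<open>\<pi>(i) = i\<close> and \<open>z\<^sub>i = 0\<close> beyond the matrix.\<close>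

definition mperm :: "nat \<Rightarrow> complex \<Rightarrow> nat \<Rightarrow> complex mat \<Rightarrow> nat \<Rightarrow> nat" where
  "mperm r \<zeta> n x i = (if i < n then (THE p. p < n \<and> (\<exists>e<r. sends_to \<zeta> n x i e p)) else i)"

definition mexp :: "nat \<Rightarrow> complex \<Rightarrow> nat \<Rightarrow> complex mat \<Rightarrow> nat \<Rightarrow> nat" where
  "mexp r \<zeta> n x i = (if i < n then (THE e. e < r \<and> (\<exists>p<n. sends_to \<zeta> n x i e p)) else 0)"

definition des :: "nat \<Rightarrow> complex \<Rightarrow> nat \<Rightarrow> complex mat \<Rightarrow> nat" where
  "des r \<zeta> n x = card {i. i < n \<and>
     (mexp r \<zeta> n x i > mexp r \<zeta> n x (Suc i) \<or>
      mexp r \<zeta> n x i = mexp r \<zeta> n x (Suc i) \<and> mperm r \<zeta> n x i > mperm r \<zeta> n x (Suc i))}"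

text \<open>A cycle of \<open>\<pi>\<close> is represented by its support (fixed points are cycles of length 1).
  Since the entry of \<open>x\<close> at \<open>(a, b)\<close> is nonzero only if \<open>a = \<pi>(b)\<close>, the product of the
  entries of \<open>x\<close> around the cycle is the product of the entries at \<open>(\<pi>(i), i)\<close>.\<close>

definition mcycles :: "nat \<Rightarrow> complex \<Rightarrow> nat \<Rightarrow> complex mat \<Rightarrow> nat set set" where
  "mcycles r \<zeta> n x = orbit (mperm r \<zeta> n x) ` {..<n}"

definition cycle_prod :: "nat \<Rightarrow> complex \<Rightarrow> nat \<Rightarrow> complex mat \<Rightarrow> nat set \<Rightarrow> complex" where
  "cycle_prod r \<zeta> n x c = (\<Prod>i\<in>c. x $$ (mperm r \<zeta> n x i, i))"

text \<open>Types are lists of length \<open>r\<close>, a partition being the multiset of its parts.\<close>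

definition mtype :: "nat \<Rightarrow> complex \<Rightarrow> nat \<Rightarrow> complex mat \<Rightarrow> nat multiset list" where
  "mtype r \<zeta> n x =
     map (\<lambda>j. image_mset card (mset_set {c \<in> mcycles r \<zeta> n x. cycle_prod r \<zeta> n x c = \<zeta> ^ j})) [0..<r]"

definition Kclass :: "nat \<Rightarrow> complex \<Rightarrow> nat \<Rightarrow> nat multiset list \<Rightarrow> complex mat set" where
  "Kclass r \<zeta> n lam = {x \<in> Grn \<zeta> n. mtype r \<zeta> n x = lam}"

definition ell :: "nat \<Rightarrow> complex \<Rightarrow> nat \<Rightarrow> complex mat \<Rightarrow> nat" where
  "ell r \<zeta> n x = size (mtype r \<zeta> n x ! 0)"

definition Cset :: "nat \<Rightarrow> complex \<Rightarrow> nat \<Rightarrow> nat \<Rightarrow> complex mat set" where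
  "Cset r \<zeta> n i = {x \<in> Grn \<zeta> n. ell r \<zeta> n x = i}"

text \<open>The guard \<open>j \<le> i\<close> implements the convention that a binomial coefficient with negative
  lower index vanishes.\<close>

definition foulkes :: "nat \<Rightarrow> complex \<Rightarrow> nat \<Rightarrow> nat \<Rightarrow> complex mat \<Rightarrow> complex" where
  "foulkes r \<zeta> n i x =
     (\<Sum>j\<le>n. if j \<le> i
             then (-1) ^ (i - j) * of_nat (Suc n choose (i - j)) * of_nat (r * j + 1) ^ ell r \<zeta> n x
             else 0)"

text \<open>\<open>mu_seq\<close> is the expected value of the cardinality of \<open>k\<^sub>1 \<cdots> k\<^sub>m C\<^sub>i \<inter> C\<^sub>j\<close> for independent
  uniformly distributed \<open>k\<^sub>u \<in> K\<^sub>u\<close>; the default value \<open>1\<^sub>m n\<close> of \<open>Pi_pmf\<close> is irrelevant.\<close>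

definition mu_seq ::
    "nat \<Rightarrow> complex \<Rightarrow> nat \<Rightarrow> nat multiset list list \<Rightarrow> nat \<Rightarrow> nat \<Rightarrow> real" where
  "mu_seq r \<zeta> n lams i j =
     measure_pmf.expectation
       (Pi_pmf {..<length lams} (1\<^sub>m n) (\<lambda>u. pmf_of_set (Kclass r \<zeta> n (lams ! u))))
       (\<lambda>k. real (card (
          (\<lambda>x. foldr (*) (map k [0..<length lams]) (1\<^sub>m n) * x) ` Cset r \<zeta> n i \<inter> Cset r \<zeta> n j)))"

text \<open>For \<open>r \<ge> 2\<close>, the types with \<open>\<lambda>\<^sup>0 = a\<close> and \<open>\<lambda>\<^sup>1 = b\<close> and all other components empty.\<close>

definition type01 :: "nat \<Rightarrow> nat multiset \<Rightarrow> nat multiset \<Rightarrow> nat multiset list" where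
  "type01 r a b = a # b # replicate (r - 2) {#}"

definition mu :: "nat \<Rightarrow> complex \<Rightarrow> nat \<Rightarrow> nat \<Rightarrow> nat \<Rightarrow> real" where
  "mu r \<zeta> n i j =
    (let A = type01 r {#n#} {#};
         B = type01 r {#} {#n#};
         D = type01 r {#n - 1#} {#1#};
         E = type01 r {#n - 1, 1#} {#};
         m1 = mu_seq r \<zeta> n [A, A] i j;
         m2 = mu_seq r \<zeta> n [A, B] i j;
         m3 = mu_seq r \<zeta> n [A, D] i j;
         m4 = mu_seq r \<zeta> n [A, A, E, E] i j;
         m5 = mu_seq r \<zeta> n [A, A, D, E] i j;
         q = real r
     in if n = 1 then 2 / q * m1 + (q - 2) / q * m2
        else 1 / q * m1 + (q - 2) / (2 * q) * m2 + 1 / 4 * m3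
             + 1 / (2 * q) * m4 + (q - 2) / (4 * q) * m5)"

text \<open>\<open>CF_ell\<close> is the space of functions depending only on \<open>ell\<close>. For such a function,
  \<open>class_val\<close> is its common value on \<open>C\<^sub>i\<close>, which is nonempty for \<open>i \<le> n\<close> and \<open>r \<ge> 2\<close>.\<close>

definition CF_ell :: "nat \<Rightarrow> complex \<Rightarrow> nat \<Rightarrow> (complex mat \<Rightarrow> complex) set" where
  "CF_ell r \<zeta> n =
     {f. \<forall>x\<in>Grn \<zeta> n. \<forall>y\<in>Grn \<zeta> n. ell r \<zeta> n x = ell r \<zeta> n y \<longrightarrow> f x = f y}"

definition class_val ::
    "nat \<Rightarrow> complex \<Rightarrow> nat \<Rightarrow> (complex mat \<Rightarrow> complex) \<Rightarrow> nat \<Rightarrow> complex" where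
  "class_val r \<zeta> n f i = the_elem (f ` Cset r \<zeta> n i)"

definition CF_inner ::
    "nat \<Rightarrow> complex \<Rightarrow> nat \<Rightarrow> (complex mat \<Rightarrow> complex) \<Rightarrow> (complex mat \<Rightarrow> complex) \<Rightarrow> complex" where
  "CF_inner r \<zeta> n f g =
     1 / of_nat (card (Grn \<zeta> n)) *
     (\<Sum>i\<le>n. \<Sum>j\<le>n. class_val r \<zeta> n f i * cnj (class_val r \<zeta> n g j) * of_real (mu r \<zeta> n i j))"

lemma foulkes_in_CF_ell: "foulkes r \<zeta> n i \<in> CF_ell r \<zeta> n"
  unfolding CF_ell_def mem_Collect_eq
proof (intro ballI impI)
  fix x y :: "complex mat"
  assume "ell r \<zeta> n x = ell r \<zeta> n y"
  then show "foulkes r \<zeta> n i x = foulkes r \<zeta> n i y"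
    by (simp only: foulkes_def)
qed

lemma CF_ell_mult: "f \<in> CF_ell r \<zeta> n \<Longrightarrow> g \<in> CF_ell r \<zeta> n \<Longrightarrow> (\<lambda>x. f x * g x) \<in> CF_ell r \<zeta> n"
  unfolding CF_ell_def mem_Collect_eq by metis

end

theory Submission
  imports Defs
begin

text \<open>Let \<open>e m x = (r m + 1) ^ \<ell>(x)\<close>. Then \<open>\<phi>\<^sub>i\<close> is an alternating binomial sum of the \<open>e m\<close>, and
  \<open>e m * e m' = e M\<close> with \<open>M = r m m' + m + m'\<close>. In the group algebra, the elements
  \<open>\<Sum>x. ((n + m - des x) choose n) x\<close> multiply by the same rule (merge two sequences compatible with
  the factors into one compatible with the product), and the same alternating sum extracts the
  elements with a given number of descents.

  It remains to see that \<open>[e M, e m] = \<Sum>p\<le>n. ((M + n - p) choose n) ((m + n - p) choose n)\<close>, for then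
  \<open>[e M, \<phi>\<^sub>k] = (M + n - k) choose n\<close>. Every sequence of classes entering \<open>\<mu>\<close> starts with a class
  of \<open>n\<close>-cycles. Its indicator is an alternating sum of the characters
  \<open>\<delta>\<^sup>c \<Lambda>\<^sup>p\<close>, where \<open>\<delta>\<close> is the product of the nonzero entries and \<open>\<Lambda>\<^sup>p\<close> is the \<open>p\<close>-th exterior power
  of the reflection representation of the symmetric group. By Schur's lemma these are eigenvectors of
  averaging over the remaining classes, and their scalar products with \<open>e m\<close> are binomial
  coefficients. The coefficients of \<open>\<mu>\<close> are such that the eigenvalues add up to the sum above.\<close>

section \<open>Hook characters of symmetric groups\<close>

text \<open>Schur's lemma is used without representations. For \<open>i \<in> S\<close>,
  \<open>hook S i\<close> is the coefficient function of the Young symmetrizer of a hook with column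
  \<open>S\<close> and row \<open>V - (S - {i})\<close>: it picks up the sign under the column group
  from the left and is invariant under the row group from the right. These two properties determine
  it up to a scalar, and averaging against a class function preserves both. The sum over all pointed
  sets \<open>(S, i)\<close> is a character up to scaling, which is why its value
  \<open>p * (n choose p)\<close> at the identity replaces the degree throughout.

  The odd shape of \<open>\<mu>\<close> comes from the ends of a range. For every twist
  \<open>c < r\<close> the hooks contribute for \<open>p = 1, ..., n\<close>. The trivial twist is
  shifted by one, since its colours sum to \<open>r (m + 1)\<close> instead of \<open>r m\<close>;
  it covers \<open>0, ..., n - 1\<close> and misses \<open>n\<close>, while all other twists miss
  \<open>0\<close>. Products of classes of n-cycles alone thus give the wanted sum with wrong end
  terms. On elements with cycle lengths \<open>n - 1\<close> and \<open>1\<close> all hook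
  characters except the first and the last vanish, so these classes act on the ends only and can
  repair them.\<close>

abbreviation perm_inv :: "('a \<Rightarrow> 'a) \<Rightarrow> 'a \<Rightarrow> 'a" where
  "perm_inv \<equiv> inv_into UNIV"

text \<open>\<open>perm_restrict\<close> extends by the identity, so this is the sign of a
  permutation of \<open>S\<close> only if \<open>\<sigma>\<close> maps \<open>S\<close> onto itself.
  The sums below carry this condition, or first redefine \<open>\<sigma>\<close> at one point to
  satisfy it.\<close>

definition rsign :: "'a set \<Rightarrow> ('a \<Rightarrow> 'a) \<Rightarrow> complex" where
  "rsign S \<sigma> = of_int (sign (perm_restrict \<sigma> S))"

definition lam :: "'a set \<Rightarrow> nat \<Rightarrow> ('a \<Rightarrow> 'a) \<Rightarrow> complex" where
  "lam V p \<sigma> = (\<Sum>S | S \<subseteq> V \<and> card S = p \<and> \<sigma> ` S = S. rsign S \<sigma>)"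

text \<open>\<open>lam V p\<close> is the character of the \<open>p\<close>-th exterior power of the permutation representation.
  Up to the factor \<open>card V\<close>, \<open>xi V p\<close> is the one of the \<open>(p - 1)\<close>-st exterior power of the reflection
  representation; hence \<open>xi V p + xi V (Suc p) = card V * lam V p\<close>.\<close>

definition hook :: "'a set \<Rightarrow> 'a \<Rightarrow> ('a \<Rightarrow> 'a) \<Rightarrow> complex" where
  "hook S i \<sigma> = (\<Sum>j\<in>S. if \<sigma> ` (S - {i}) = S - {j} then rsign S (\<sigma>(i := j)) else 0)"

definition xi :: "'a set \<Rightarrow> nat \<Rightarrow> ('a \<Rightarrow> 'a) \<Rightarrow> complex" where
  "xi V p \<sigma> = (\<Sum>S | S \<subseteq> V \<and> card S = p. \<Sum>i\<in>S. hook S i \<sigma>)"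

lemma perm_restrict_permutes:
  assumes "finite S" "inj_on \<sigma> S" "\<sigma> ` S = S"
  shows "perm_restrict \<sigma> S permutes S"
proof (rule bij_imp_permutes)
  show "bij_betw (perm_restrict \<sigma> S) S S"
    using assms by (auto simp: bij_betw_def perm_restrict_def inj_on_def image_def)
qed (simp add: perm_restrict_def)

lemma rsign_comp:
  assumes "finite S" "inj_on \<sigma> S" "\<sigma> ` S = S" "inj_on \<tau> S" "\<tau> ` S = S"
  shows "rsign S (\<sigma> \<circ> \<tau>) = rsign S \<sigma> * rsign S \<tau>"
proof -
  have "perm_restrict (\<sigma> \<circ> \<tau>) S = perm_restrict \<sigma> S \<circ> perm_restrict \<tau> S"
    using assms(5) by (auto simp: fun_eq_iff perm_restrict_def)
  moreover have "permutation (perm_restrict \<sigma> S)" "permutation (perm_restrict \<tau> S)"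
    using perm_restrict_permutes assms permutes_imp_permutation by metis+
  ultimately show ?thesis by (simp add: rsign_def sign_compose)
qed

lemma rsign_permutes: "g permutes S \<Longrightarrow> rsign S g = of_int (sign g)"
  by (simp add: rsign_def)

lemma rsign_cong: "(\<And>s. s \<in> S \<Longrightarrow> \<sigma> s = \<tau> s) \<Longrightarrow> rsign S \<sigma> = rsign S \<tau>"
proof -
  assume "\<And>s. s \<in> S \<Longrightarrow> \<sigma> s = \<tau> s"
  then have "perm_restrict \<sigma> S = perm_restrict \<tau> S"
    by (auto simp: perm_restrict_def fun_eq_iff)
  then show ?thesis by (simp add: rsign_def)
qed

lemma rsign_square [simp]: "rsign S \<sigma> * rsign S \<sigma> = 1"
  by (simp add: rsign_def flip: of_int_mult)

lemma finite_subset_card: "finite V \<Longrightarrow> finite {S. S \<subseteq> V \<and> P S}"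
  by (rule finite_subset[of _ "Pow V"]) auto

text \<open>The partial injection from \<open>S - {i}\<close> to \<open>S - {j}\<close> closes up to
  a permutation of \<open>S\<close>; its sign is what \<open>hook\<close> records.\<close>

lemma completion:
  assumes "finite S" "inj \<sigma>" "i \<in> S" "j \<in> S" "\<sigma> ` (S - {i}) = S - {j}"
  shows "inj_on (\<sigma>(i := j)) S" "(\<sigma>(i := j)) ` S = S"
proof -
  have "(\<sigma>(i := j)) ` S = insert j (\<sigma> ` (S - {i}))"
    using \<open>i \<in> S\<close> by (auto simp: image_def)
  also have "\<dots> = S" using assms by auto
  finally show *: "(\<sigma>(i := j)) ` S = S" .
  show "inj_on (\<sigma>(i := j)) S"
    using * \<open>finite S\<close> by (metis eq_card_imp_inj_on)
qed

lemma hook_eq: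
  assumes "j \<in> S" "\<sigma> ` (S - {i}) = S - {j}" "finite S"
  shows "hook S i \<sigma> = rsign S (\<sigma>(i := j))"
proof -
  have "hook S i \<sigma> = (\<Sum>k\<in>S. if k = j then rsign S (\<sigma>(i := j)) else 0)"
    unfolding hook_def
  proof (rule sum.cong, goal_cases)
    case (2 k)
    have "S - {j} = S - {k} \<longleftrightarrow> k = j" using 2 assms(1) by auto
    then show ?case using assms(2) by auto
  qed simp
  then show ?thesis using assms by simp
qed

lemma hook_id: "i \<in> S \<Longrightarrow> finite S \<Longrightarrow> hook S i id = 1"
proof -
  assume "i \<in> S" "finite S"
  moreover have "perm_restrict (id(i := i)) S = id"
    by (auto simp: perm_restrict_def fun_eq_iff)
  ultimately show ?thesis by (subst hook_eq[of i]) (simp_all add: rsign_def)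
qed

text \<open>Column group: composing with \<open>g\<close> carries the completion at \<open>j\<close>
  to the completion at \<open>g j\<close> and multiplies its sign by the sign of
  \<open>g\<close>.\<close>

lemma hook_comp_left:
  assumes "finite S" "g permutes S" "inj \<sigma>" "i \<in> S"
  shows "hook S i (g \<circ> \<sigma>) = of_int (sign g) * hook S i \<sigma>"
proof -
  have "hook S i (g \<circ> \<sigma>) =
      (\<Sum>j\<in>S. if (g \<circ> \<sigma>) ` (S - {i}) = S - {g j} then rsign S ((g \<circ> \<sigma>)(i := g j)) else 0)"
    unfolding hook_def by (subst sum.permute[OF assms(2)]) (simp add: comp_def)
  also have "\<dots> = (\<Sum>j\<in>S. of_int (sign g) *
      (if \<sigma> ` (S - {i}) = S - {j} then rsign S (\<sigma>(i := j)) else 0))"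
  proof (rule sum.cong, goal_cases)
    case (2 j)
    have "S - {g j} = g ` (S - {j})"
      using permutes_image[OF assms(2)] permutes_inj[OF assms(2)] by (auto simp: image_set_diff)
    then have iff: "(g \<circ> \<sigma>) ` (S - {i}) = S - {g j} \<longleftrightarrow> \<sigma> ` (S - {i}) = S - {j}"
      using permutes_inj[OF assms(2)] by (metis image_comp inj_image_eq_iff)
    show ?case
    proof (cases "\<sigma> ` (S - {i}) = S - {j}")
      case True
      have "rsign S ((g \<circ> \<sigma>)(i := g j)) = rsign S (g \<circ> \<sigma>(i := j))"
        by (rule rsign_cong) auto
      also have "\<dots> = of_int (sign g) * rsign S (\<sigma>(i := j))"
        using completion[OF assms(1,3,4) 2 True] assms
        by (subst rsign_comp) (auto simp: rsign_permutes permutes_inj_on permutes_image)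
      finally show ?thesis using True iff by simp
    qed (use iff in simp)
  qed simp
  finally show ?thesis by (simp add: hook_def sum_distrib_left)
qed

text \<open>Row group: \<open>h\<close> fixes \<open>S - {i}\<close> pointwise, and
  \<open>hook S i\<close> only looks at the values there.\<close>

lemma hook_comp_right:
  assumes "h permutes V - (S - {i})"
  shows "hook S i (\<sigma> \<circ> h) = hook S i \<sigma>"
proof -
  have *: "h s = s" if "s \<in> S - {i}" for s
    using assms that by (auto simp: permutes_def)
  then have "(\<sigma> \<circ> h) ` (S - {i}) = \<sigma> ` (S - {i})" by (auto simp: image_def)
  moreover have "rsign S ((\<sigma> \<circ> h)(i := j)) = rsign S (\<sigma>(i := j))" for j
    by (rule rsign_cong) (use * in auto)
  ultimately show ?thesis unfolding hook_def by (simp only:)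
qed

lemma hook_support:
  assumes "finite V" "S \<subseteq> V" and S_i: "i \<in> S" and "y permutes V" "\<And>j. j \<in> S \<Longrightarrow> y ` (S - {i}) \<noteq> S - {j}"
  obtains a b where "a \<noteq> b" "a \<in> V - (S - {i})" "b \<in> V - (S - {i})" "y a \<in> S" "y b \<in> S"
proof -
  define R where "R = S - {i}"
  have fin: "finite S" "finite R" using assms finite_subset by (auto simp: R_def)
  have cR: "card (y ` R) = card R" "card S = Suc (card R)"
    using card_Suc_Diff1[OF fin(1) S_i] card_image[OF permutes_inj_on[OF assms(4)], of R]
    by (simp_all add: R_def)
  have "card (S - y ` R) > 1"
  proof (rule ccontr)
    assume c: "\<not> 1 < card (S - y ` R)"
    have "card S \<le> card (S - y ` R) + card (S \<inter> y ` R)"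
      using fin card_Diff_subset_Int[of S "y ` R"] by (simp)
    then have "card (S \<inter> y ` R) \<ge> card (y ` R)" using c cR by linarith
    then have sub: "y ` R \<subseteq> S"
      using card_seteq[of "y ` R" "S \<inter> y ` R"] fin by auto
    have "card (S - y ` R) = 1"
      using sub cR fin by (simp add: card_Diff_subset)
    then obtain j where "S - y ` R = {j}" by (auto simp: card_1_singleton_iff)
    then have "j \<in> S" "y ` R = S - {j}" using sub by auto
    then show False using assms(5)[of j] by (simp add: R_def)
  qed
  then obtain a' b' where ab: "a' \<in> S - y ` R" "b' \<in> S - y ` R" "a' \<noteq> b'"
    using card_le_Suc0_iff_eq[of "S - y ` R"] fin by auto
  obtain a b where "y a = a'" "y b = b'" using surjD[OF permutes_surj[OF assms(4)]] by metis
  moreover have "a \<in> V" "b \<in> V" using ab calculation assms(2,4) by (auto simp: permutes_in_image)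
  ultimately show ?thesis using that[of a b] ab by (auto simp: R_def)
qed

text \<open>As a function of \<open>y\<close>, the left-hand side inherits the sign behaviour under
  the column group and the invariance under the row group. Any such function is its value at the
  identity times \<open>hook S i\<close>: it is determined where \<open>y\<close> factors through
  the two groups and vanishes elsewhere.\<close>

lemma hook_schur:
  fixes f :: "('a \<Rightarrow> 'a) \<Rightarrow> complex"
  assumes V: "finite V" and S: "S \<subseteq> V" "i \<in> S" and y: "y permutes V"
    and cls: "\<And>g \<sigma>. g permutes V \<Longrightarrow> \<sigma> permutes V \<Longrightarrow> f (g \<circ> \<sigma> \<circ> perm_inv g) = f \<sigma>"
  shows "(\<Sum>x | x permutes V. f x * hook S i (x \<circ> y)) =
         (\<Sum>x | x permutes V. f x * hook S i x) * hook S i y"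
proof -
  define F where "F y = (\<Sum>x | x permutes V. f x * hook S i (x \<circ> y))" for y
  have fin: "finite S" using V S(1) finite_subset by blast
  have left: "F (g \<circ> y) = of_int (sign g) * F y" if g: "g permutes S" and y: "y permutes V" for g y
  proof -
    have gV: "g permutes V" using g S permutes_subset by blast
    have conj_perm: "(\<lambda>a. g (x (perm_inv g a))) permutes V"
      and conj_perm': "(\<lambda>a. perm_inv g (x (g a))) permutes V" if "x permutes V" for x
      using permutes_compose[OF permutes_compose[OF permutes_inv[OF gV] that] gV]
        permutes_compose[OF permutes_compose[OF gV that] permutes_inv[OF gV]] by (simp_all add: comp_def)
    \<comment> \<open>Substituting the conjugate of \<open>x\<close> by \<open>g\<close> moves
      \<open>g\<close> from the right of \<open>x\<close> to its left; \<open>f\<close> does not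
      notice since it is a class function.\<close>
    have "F (g \<circ> y) = (\<Sum>x | x permutes V. f (g \<circ> x \<circ> perm_inv g) * hook S i (g \<circ> x \<circ> perm_inv g \<circ> (g \<circ> y)))"
      unfolding F_def
      by (rule sum.reindex_bij_witness[of _ "\<lambda>x. g \<circ> x \<circ> perm_inv g" "\<lambda>x. perm_inv g \<circ> x \<circ> g"])
         (simp_all add: conj_perm conj_perm' comp_def permutes_inverses[OF gV])
    also have "\<dots> = (\<Sum>x | x permutes V. f x * (of_int (sign g) * hook S i (x \<circ> y)))"
    proof (rule sum.cong, goal_cases)
      case (2 x)
      have "g \<circ> x \<circ> perm_inv g \<circ> (g \<circ> y) = g \<circ> (x \<circ> y)"
        by (auto simp: fun_eq_iff permutes_inverses[OF gV])
      then show ?case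
        using 2 hook_comp_left[OF fin g permutes_inj[OF permutes_compose[OF y]] S(2), of x] cls[of g x] gV
        by simp
    qed simp
    finally show ?thesis by (simp add: F_def sum_distrib_left mult.left_commute)
  qed
  have right: "F (y \<circ> h) = F y" if "h permutes V - (S - {i})" for h y
    unfolding F_def by (simp only: o_assoc hook_comp_right[OF that])
  show ?thesis
  proof (cases "\<exists>j\<in>S. y ` (S - {i}) = S - {j}")
    case True
    then obtain j where j: "j \<in> S" "y ` (S - {i}) = S - {j}" by auto
    \<comment> \<open>The factorization of \<open>y\<close> into a column permutation, the
      completion of \<open>y\<close> on \<open>S\<close>, and a rest that fixes
      \<open>S - {i}\<close>.\<close>
    define g where "g = perm_restrict (y(i := j)) S"
    have g: "g permutes S" unfolding g_def
      using completion[OF fin permutes_inj[OF y] S(2) j] perm_restrict_permutes fin by blast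
    have gV: "g permutes V" using g S permutes_subset by blast
    define h where "h = perm_inv g \<circ> y"
    have yh: "y = g \<circ> h" by (auto simp: h_def fun_eq_iff permutes_inverses[OF gV])
    have hV: "h permutes V" unfolding h_def by (intro permutes_compose permutes_inv gV y)
    have "h s = s" if "s \<in> S - {i}" for s
    proof -
      have "y s = g s" using that by (auto simp: g_def perm_restrict_def)
      then show ?thesis by (simp add: h_def permutes_inverses[OF gV])
    qed
    then have h: "h permutes V - (S - {i})"
      by (intro permutes_superset[OF hV]) auto
    have "F y = of_int (sign g) * F (id \<circ> h)"
      using left[OF g hV] by (simp add: yh)
    also have "\<dots> = of_int (sign g) * F id" by (simp only: right[OF h])
    also have "of_int (sign g) = hook S i y"
      by (simp add: hook_eq[OF j fin] g_def rsign_def)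
    finally show ?thesis by (simp add: F_def comp_def)
  next
    case False
    then have ne: "\<And>j. j \<in> S \<Longrightarrow> y ` (S - {i}) \<noteq> S - {j}" by blast
    from hook_support[OF V S y ne] obtain a b where ab: "a \<noteq> b" "a \<in> V - (S - {i})" "b \<in> V - (S - {i})" "y a \<in> S" "y b \<in> S" .
    \<comment> \<open>Read from the right this transposition changes nothing, read from the left it
      changes the sign; hence \<open>F y = - F y\<close>.\<close>
    have eq: "y \<circ> Transposition.transpose a b = Transposition.transpose (y a) (y b) \<circ> y"
    proof
      fix c show "(y \<circ> Transposition.transpose a b) c = (Transposition.transpose (y a) (y b) \<circ> y) c"
        using permutes_inj[OF y]
        by (cases "c = a"; cases "c = b") (simp_all add: inj_eq transpose_apply_other)
    qed
    have "F y = F (y \<circ> Transposition.transpose a b)"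
      by (rule right[symmetric], rule permutes_swap_id) (use ab in auto)
    also have "\<dots> = - F y"
    proof -
      have "y a \<noteq> y b" using ab(1) permutes_inj[OF y] by (simp add: inj_eq)
      then show ?thesis
        unfolding eq left[OF permutes_swap_id[OF ab(4,5)] y] by (simp add: sign_swap_id)
    qed
    finally have "F y = 0" by simp
    moreover have "hook S i y = 0" unfolding hook_def by (rule sum.neutral) (simp add: ne)
    ultimately show ?thesis by (simp add: F_def)
  qed
qed

lemma hook_conj:
  assumes "g permutes V" "finite V" "S \<subseteq> V" "inj x" "i \<in> S"
  shows "hook (g ` S) (g i) (g \<circ> x \<circ> perm_inv g) = hook S i x"
proof -
  note g = permutes_inverses[OF assms(1)] permutes_inj[OF assms(1)]
  have "hook (g ` S) (g i) (g \<circ> x \<circ> perm_inv g) = (\<Sum>j\<in>S. if (g \<circ> x \<circ> perm_inv g) ` (g ` S - {g i}) = g ` S - {g j}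
      then rsign (g ` S) ((g \<circ> x \<circ> perm_inv g)(g i := g j)) else 0)"
    unfolding hook_def
    by (subst sum.reindex[OF inj_on_subset[OF g(3)]]) (simp_all add: comp_def)
  also have "\<dots> = hook S i x" unfolding hook_def
  proof (rule sum.cong, goal_cases)
    case (2 j)
    have im: "g ` S - {g k} = g ` (S - {k})" for k using g(3) by (auto simp: inj_eq)
    have "(g \<circ> x \<circ> perm_inv g) ` (g ` S - {g i}) = g ` (x ` (S - {i}))"
      unfolding im by (simp add: image_comp comp_def g)
    then have iff: "(g \<circ> x \<circ> perm_inv g) ` (g ` S - {g i}) = g ` S - {g j} \<longleftrightarrow> x ` (S - {i}) = S - {j}"
      unfolding im by (simp add: inj_image_eq_iff[OF g(3)])
    have "perm_restrict ((g \<circ> x \<circ> perm_inv g)(g i := g j)) (g ` S) =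
        g \<circ> perm_restrict (x(i := j)) S \<circ> perm_inv g"
    proof
      fix a
      obtain b where a: "a = g b" using g(1) by metis
      show "perm_restrict ((g \<circ> x \<circ> perm_inv g)(g i := g j)) (g ` S) a =
          (g \<circ> perm_restrict (x(i := j)) S \<circ> perm_inv g) a"
        by (auto simp: a perm_restrict_def g inj_eq[OF g(3)])
    qed
    moreover have "sign (g \<circ> perm_restrict (x(i := j)) S \<circ> perm_inv g) = sign (perm_restrict (x(i := j)) S)"
      if "x ` (S - {i}) = S - {j}"
    proof -
      have "finite S" using assms finite_subset by blast
      then have "permutation (perm_restrict (x(i := j)) S)"
        using completion[OF _ assms(4,5) 2 that] perm_restrict_permutes permutes_imp_permutation by metis
      moreover have "permutation g" using assms(1,2) permutes_imp_permutation by blast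
      ultimately show ?thesis
        by (simp add: sign_compose permutation_compose permutation_inverse sign_inverse)
    qed
    ultimately show ?case unfolding iff rsign_def by simp
  qed simp
  finally show ?thesis .
qed

section \<open>Consecutive hook sums and exterior powers of the permutation representation\<close>

definition hook_triples :: "'a set \<Rightarrow> nat \<Rightarrow> ('a \<Rightarrow> 'a) \<Rightarrow> ('a set \<times> 'a \<times> 'a) set" where
  "hook_triples V p \<sigma> = {(S, i, j). S \<subseteq> V \<and> card S = p \<and> i \<in> S \<and> j \<in> S \<and> \<sigma> ` (S - {i}) = S - {j}}"

lemma finite_hook_triples: "finite V \<Longrightarrow> finite (hook_triples V p \<sigma>)"
  unfolding hook_triples_def
  by (rule finite_subset[of _ "Pow V \<times> V \<times> V"]) auto

lemma xi_triples:
  assumes "finite V"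
  shows "xi V p \<sigma> = (\<Sum>(S, i, j) \<in> hook_triples V p \<sigma>. rsign S (\<sigma>(i := j)))"
proof -
  let ?A = "{S. S \<subseteq> V \<and> card S = p}"
  have fA: "finite ?A" using finite_subset_card[OF assms] .
  have fB: "\<forall>S\<in>?A. finite (S \<times> S)" using assms by (auto intro: finite_subset)
  have "xi V p \<sigma> = (\<Sum>S\<in>?A. \<Sum>i\<in>S. \<Sum>j\<in>S. if \<sigma> ` (S - {i}) = S - {j} then rsign S (\<sigma>(i := j)) else 0)"
    unfolding xi_def hook_def ..
  also have "\<dots> = (\<Sum>S\<in>?A. \<Sum>(i, j)\<in>S \<times> S. if \<sigma> ` (S - {i}) = S - {j} then rsign S (\<sigma>(i := j)) else 0)"
    by (simp add: sum.cartesian_product)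
  also have "\<dots> = (\<Sum>(S, i, j)\<in>Sigma ?A (\<lambda>S. S \<times> S). if \<sigma> ` (S - {i}) = S - {j} then rsign S (\<sigma>(i := j)) else 0)"
    using sum.Sigma[OF fA fB, of "\<lambda>S (i, j). if \<sigma> ` (S - {i}) = S - {j} then rsign S (\<sigma>(i := j)) else 0"]
    by simp
  also have "\<dots> = (\<Sum>(S, i, j) \<in> hook_triples V p \<sigma>. rsign S (\<sigma>(i := j)))"
  proof (rule sum.mono_neutral_cong_right)
    show "finite (Sigma ?A (\<lambda>S. S \<times> S))" using fA fB by blast
    show "hook_triples V p \<sigma> \<subseteq> Sigma ?A (\<lambda>S. S \<times> S)" by (auto simp: hook_triples_def)
    show "\<forall>t\<in>Sigma ?A (\<lambda>S. S \<times> S) - hook_triples V p \<sigma>.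
        (case t of (S, i, j) \<Rightarrow> if \<sigma> ` (S - {i}) = S - {j} then rsign S (\<sigma>(i := j)) else 0) = 0"
      by (clarsimp simp: hook_triples_def split: if_splits)
  qed (simp add: hook_triples_def split: prod.splits)
  finally show ?thesis .
qed

text \<open>If \<open>j = \<sigma> i\<close>, the completion is \<open>\<sigma>\<close> itself on
  \<open>S\<close>, so \<open>S\<close> is invariant. Each invariant \<open>S\<close> arises once
  for every \<open>i\<close> in it.\<close>

lemma xi_eq_fixing:
  assumes "finite V" "inj \<sigma>"
  shows "(\<Sum>(S, i, j) \<in> {(S, i, j) \<in> hook_triples V p \<sigma>. j = \<sigma> i}. rsign S (\<sigma>(i := j))) = of_nat p * lam V p \<sigma>"
proof -
  let ?A = "{S. S \<subseteq> V \<and> card S = p \<and> \<sigma> ` S = S}"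
  have fin: "finite S" if "S \<in> ?A" for S using that assms finite_subset by auto
  have "(\<Sum>(S, i, j) \<in> {(S, i, j) \<in> hook_triples V p \<sigma>. j = \<sigma> i}. rsign S (\<sigma>(i := j))) =
      (\<Sum>(S, i) \<in> Sigma ?A (\<lambda>S. S). rsign S \<sigma>)"
  proof (rule sum.reindex_bij_witness[of _ "\<lambda>(S, i). (S, i, \<sigma> i)" "\<lambda>(S, i, j). (S, i)"], goal_cases)
    case (2 a)
    then obtain S i where a: "a = (S, i, \<sigma> i)" and S: "S \<subseteq> V" "card S = p" "i \<in> S" "\<sigma> i \<in> S" "\<sigma> ` (S - {i}) = S - {\<sigma> i}"
      by (auto simp: hook_triples_def)
    have "\<sigma> ` S = insert (\<sigma> i) (\<sigma> ` (S - {i}))" using S(3) by auto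
    then have "\<sigma> ` S = S" using S by auto
    then show ?case using S a by auto
  next
    case (4 b)
    then obtain S i where b: "b = (S, i)" and S: "S \<subseteq> V" "card S = p" "i \<in> S" "\<sigma> ` S = S" by auto
    have "\<sigma> ` (S - {i}) = S - {\<sigma> i}" using S assms(2) by (simp add: image_set_diff)
    then show ?case using S b by (auto simp: hook_triples_def)
  qed auto
  also have "\<dots> = (\<Sum>S\<in>?A. \<Sum>i\<in>S. rsign S \<sigma>)"
  proof -
    have fB: "\<forall>S\<in>?A. finite S" using fin by blast
    show ?thesis
      using sum.Sigma[OF finite_subset_card[OF assms(1)] fB, of "\<lambda>S i. rsign S \<sigma>"] by (rule sym)
  qed
  also have "\<dots> = of_nat p * lam V p \<sigma>"
    by (simp add: lam_def sum_distrib_left)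
  finally show ?thesis .
qed

text \<open>If \<open>j = i\<close>, the completion fixes \<open>i\<close>, so its sign is that of
  \<open>\<sigma>\<close> on the invariant set \<open>S - {i}\<close>. Conversely an invariant set
  of size \<open>p\<close> can be enlarged by any of the remaining \<open>card V - p\<close>
  points.\<close>

lemma xi_Suc_diagonal:
  assumes "finite V" "inj \<sigma>"
  shows "(\<Sum>(S, i, j) \<in> {(S, i, j) \<in> hook_triples V (Suc p) \<sigma>. j = i}. rsign S (\<sigma>(i := j))) =
    (of_nat (card V) - of_nat p) * lam V p \<sigma>"
proof -
  let ?A = "{S. S \<subseteq> V \<and> card S = p \<and> \<sigma> ` S = S}"
  have fin: "finite S" if "S \<in> ?A" for S using that assms finite_subset by auto
  have "(\<Sum>(S, i, j) \<in> {(S, i, j) \<in> hook_triples V (Suc p) \<sigma>. j = i}. rsign S (\<sigma>(i := j))) =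
      (\<Sum>(S, i) \<in> Sigma ?A (\<lambda>S. V - S). rsign S \<sigma>)"
  proof (rule sum.reindex_bij_witness[of _ "\<lambda>(S, i). (insert i S, i, i)" "\<lambda>(S, i, j). (S - {i}, i)"], goal_cases)
    case (1 a)
    then show ?case by (auto simp: hook_triples_def)
  next
    case (2 a)
    then show ?case using assms(1) by (auto simp: hook_triples_def card_Diff_singleton)
  next
    case (3 b)
    then show ?case by auto
  next
    case (4 b)
    then obtain S i where b: "b = (S, i)" and S: "S \<in> ?A" "i \<in> V - S" by blast
    then show ?case using fin[OF S(1)] by (simp add: hook_triples_def)
  next
    case (5 a)
    then obtain S i where a: "a = (S, i, i)" and S: "S \<subseteq> V" "i \<in> S" by (auto simp: hook_triples_def)
    have "perm_restrict (\<sigma>(i := i)) S = perm_restrict \<sigma> (S - {i})"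
      by (auto simp: perm_restrict_def)
    then show ?case by (simp add: a rsign_def)
  qed
  also have "\<dots> = (\<Sum>S\<in>?A. \<Sum>i\<in>V - S. rsign S \<sigma>)"
    by (subst sum.Sigma) (auto simp: finite_subset_card[OF assms(1)] assms(1))
  also have "\<dots> = (\<Sum>S\<in>?A. (of_nat (card V) - of_nat p) * rsign S \<sigma>)"
  proof (rule sum.cong, goal_cases)
    case (2 S)
    then show ?case
      using fin[OF 2] card_mono[OF assms(1), of S] by (simp add: card_Diff_subset of_nat_diff)
  qed simp
  also have "\<dots> = (of_nat (card V) - of_nat p) * lam V p \<sigma>"
    by (simp add: lam_def sum_distrib_left)
  finally show ?thesis .
qed

text \<open>Inserting \<open>\<sigma> i\<close> into the cycle \<open>i \<mapsto> j\<close> of the completed permutation flips its sign.\<close>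

lemma xi_Suc_off_diagonal:
  assumes "finite V" "\<sigma> permutes V"
  shows "(\<Sum>(S, i, j) \<in> {(S, i, j) \<in> hook_triples V (Suc p) \<sigma>. j \<noteq> i}. rsign S (\<sigma>(i := j))) =
    - (\<Sum>(S, i, j) \<in> {(S, i, j) \<in> hook_triples V p \<sigma>. j \<noteq> \<sigma> i}. rsign S (\<sigma>(i := j)))"
proof -
  note \<sigma> = permutes_inverses[OF assms(2)] permutes_inj[OF assms(2)] permutes_in_image[OF assms(2)]
  have "(\<Sum>(S, i, j) \<in> {(S, i, j) \<in> hook_triples V p \<sigma>. j \<noteq> \<sigma> i}. - rsign S (\<sigma>(i := j))) =
    (\<Sum>(S, i, j) \<in> {(S, i, j) \<in> hook_triples V (Suc p) \<sigma>. j \<noteq> i}. rsign S (\<sigma>(i := j)))"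
  proof (rule sum.reindex_bij_witness[of _ "\<lambda>(S, k, j). (S - {k}, perm_inv \<sigma> k, j)"
        "\<lambda>(S, i, j). (insert (\<sigma> i) S, \<sigma> i, j)"], goal_cases)
    case (1 a)
    then obtain S i j where a: "a = (S, i, j)" and S: "S \<subseteq> V" "card S = p" "i \<in> S" "j \<in> S"
      "\<sigma> ` (S - {i}) = S - {j}" "j \<noteq> \<sigma> i"
      by (auto simp: hook_triples_def)
    have "\<sigma> i \<notin> \<sigma> ` (S - {i})" using \<sigma>(3) by (auto simp: inj_eq)
    then have "\<sigma> i \<notin> S" using S by auto
    then show ?case by (simp add: a \<sigma>)
  next
    case (2 a)
    then obtain S i j where a: "a = (S, i, j)" and S: "S \<subseteq> V" "card S = p" "i \<in> S" "j \<in> S"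
      "\<sigma> ` (S - {i}) = S - {j}" "j \<noteq> \<sigma> i"
      by (auto simp: hook_triples_def)
    have "\<sigma> i \<notin> \<sigma> ` (S - {i})" using \<sigma>(3) by (auto simp: inj_eq)
    then have ni: "\<sigma> i \<notin> S" using S by auto
    have "\<sigma> ` S = insert (\<sigma> i) (\<sigma> ` (S - {i}))" using S(3) by auto
    then have "\<sigma> ` (insert (\<sigma> i) S - {\<sigma> i}) = insert (\<sigma> i) S - {j}" using S ni by auto
    then show ?case
      using S ni finite_subset[OF S(1) assms(1)] \<sigma>(4)[of i] by (auto simp: a hook_triples_def)
  next
    case (3 a)
    then obtain S k j where a: "a = (S, k, j)" and S: "k \<in> S" by (auto simp: hook_triples_def)
    then show ?case by (auto simp: a \<sigma>)
  next
    case (4 a)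
    then obtain S k j where a: "a = (S, k, j)" and S: "S \<subseteq> V" "card S = Suc p" "k \<in> S" "j \<in> S"
      "\<sigma> ` (S - {k}) = S - {j}" "j \<noteq> k"
      by (auto simp: hook_triples_def)
    have "k \<in> \<sigma> ` (S - {k})" using S by auto
    then have ik: "perm_inv \<sigma> k \<in> S - {k}" using \<sigma>(2) by auto
    have "\<sigma> ` (S - {k} - {perm_inv \<sigma> k}) = \<sigma> ` (S - {k}) - {k}"
      using \<sigma>(1,3) by (simp add: image_set_diff)
    then show ?case using S ik \<sigma>(1) by (auto simp: a hook_triples_def)
  next
    case (5 a)
    then obtain S i j where a: "a = (S, i, j)" and S: "S \<subseteq> V" "card S = p" "i \<in> S" "j \<in> S"
      "\<sigma> ` (S - {i}) = S - {j}" "j \<noteq> \<sigma> i"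
      by (auto simp: hook_triples_def)
    have fS: "finite S" using finite_subset[OF S(1) assms(1)] .
    have "\<sigma> i \<notin> \<sigma> ` (S - {i})" using \<sigma>(3) by (auto simp: inj_eq)
    then have ni: "\<sigma> i \<notin> S" using S by auto
    have eq: "perm_restrict (\<sigma>(\<sigma> i := j)) (insert (\<sigma> i) S) =
        Transposition.transpose j (\<sigma> i) \<circ> perm_restrict (\<sigma>(i := j)) S"
    proof
      fix s
      consider "s = i" | "s = \<sigma> i" | "s \<in> S" "s \<noteq> i" | "s \<notin> S" "s \<noteq> \<sigma> i" by blast
      then show "perm_restrict (\<sigma>(\<sigma> i := j)) (insert (\<sigma> i) S) s =
          (Transposition.transpose j (\<sigma> i) \<circ> perm_restrict (\<sigma>(i := j)) S) s"
      proof cases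
        case 1 then show ?thesis using ni S by (auto simp: perm_restrict_def)
      next
        case 2 then show ?thesis using ni S by (auto simp: perm_restrict_def)
      next
        case 3
        then have "\<sigma> s \<in> S - {j}" using S(5) by blast
        then have "\<sigma> s \<noteq> j" "\<sigma> s \<noteq> \<sigma> i" using ni by auto
        then show ?thesis using 3 ni by (auto simp: perm_restrict_def transpose_apply_other)
      next
        case 4
        then have "s \<noteq> j" using S by auto
        then show ?thesis using 4 ni by (auto simp: perm_restrict_def transpose_apply_other)
      qed
    qed
    have "permutation (perm_restrict (\<sigma>(i := j)) S)"
      using completion[OF fS \<sigma>(3) S(3,4,5)] perm_restrict_permutes fS permutes_imp_permutation by metis
    then have "rsign (insert (\<sigma> i) S) (\<sigma>(\<sigma> i := j)) = - rsign S (\<sigma>(i := j))"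
      using S(6) by (simp add: rsign_def eq sign_compose permutation_swap_id sign_swap_id)
    then show ?case by (simp add: a)
  qed
  then show ?thesis by (simp add: sum_negf case_prod_unfold)
qed

text \<open>The off-diagonal triples of the two levels cancel in a sign-reversing way, and the
  multiplicities \<open>p\<close> and \<open>card V - p\<close> of the others add up to
  \<open>card V\<close>. This is the decomposition of an exterior power of the permutation
  representation, which is the reflection representation plus a trivial summand.\<close>

lemma xi_add:
  assumes "finite V" "\<sigma> permutes V"
  shows "xi V p \<sigma> + xi V (Suc p) \<sigma> = of_nat (card V) * lam V p \<sigma>"
proof -
  have split: "sum f (hook_triples V q \<sigma>) = sum f {t \<in> hook_triples V q \<sigma>. P t} + sum f {t \<in> hook_triples V q \<sigma>. \<not> P t}"
    for f :: "_ \<Rightarrow> complex" and P q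
    using finite_hook_triples[OF assms(1)] by (subst sum.union_disjoint[symmetric]) (auto intro!: sum.cong)
  have 1: "xi V p \<sigma> = of_nat p * lam V p \<sigma> +
      (\<Sum>(S, i, j) \<in> {(S, i, j) \<in> hook_triples V p \<sigma>. j \<noteq> \<sigma> i}. rsign S (\<sigma>(i := j)))"
    unfolding xi_triples[OF assms(1)] xi_eq_fixing[OF assms(1) permutes_inj[OF assms(2)], symmetric]
    by (subst split[of _ _ "\<lambda>(S, i, j). j = \<sigma> i"]) (simp add: case_prod_unfold)
  have 2: "xi V (Suc p) \<sigma> = (of_nat (card V) - of_nat p) * lam V p \<sigma> +
      (\<Sum>(S, i, j) \<in> {(S, i, j) \<in> hook_triples V (Suc p) \<sigma>. j \<noteq> i}. rsign S (\<sigma>(i := j)))"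
    unfolding xi_triples[OF assms(1)] xi_Suc_diagonal[OF assms(1) permutes_inj[OF assms(2)], symmetric]
    by (subst split[of _ _ "\<lambda>(S, i, j). j = i"]) (simp add: case_prod_unfold)
  show ?thesis unfolding 1 2 xi_Suc_off_diagonal[OF assms] by (simp add: algebra_simps)
qed

lemma xi_0:
  assumes "finite V"
  shows "xi V 0 \<sigma> = 0"
  unfolding xi_def
proof (rule sum.neutral, rule ballI)
  fix S assume "S \<in> {S. S \<subseteq> V \<and> card S = 0}"
  then have "S = {}" using finite_subset[OF _ assms] by fastforce
  then show "(\<Sum>i\<in>S. hook S i \<sigma>) = 0" by simp
qed

lemma xi_gt:
  assumes "finite V" "card V < p"
  shows "xi V p \<sigma> = 0"
  unfolding xi_def
proof (rule sum.neutral, rule ballI)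
  fix S assume "S \<in> {S. S \<subseteq> V \<and> card S = p}"
  then have False using card_mono[OF assms(1), of S] assms(2) by simp
  then show "(\<Sum>i\<in>S. hook S i \<sigma>) = 0" ..
qed

lemma xi_expansion:
  assumes "finite V" "\<sigma> permutes V"
  shows "xi V q \<sigma> = of_nat (card V) * (\<Sum>p<q. (-1) ^ (q - 1 - p) * lam V p \<sigma>)"
proof (induction q)
  case 0
  then show ?case by (simp add: xi_0 assms)
next
  case (Suc q)
  have "(\<Sum>p<q. (-1) ^ (q - p) * lam V p \<sigma>) = - (\<Sum>p<q. (-1) ^ (q - 1 - p) * lam V p \<sigma>)"
    unfolding sum_negf[symmetric]
  proof (rule sum.cong, goal_cases)
    case (2 p)
    then have "q - p = Suc (q - 1 - p)" by auto
    then show ?case by simp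
  qed simp
  then show ?case using xi_add[OF assms, of q] Suc by (simp add: algebra_simps)
qed

text \<open>The sum is the determinant of \<open>1 - \<sigma>\<close> on the permutation
  representation, which vanishes because \<open>\<sigma>\<close> fixes the all-ones vector. Here it
  follows from the vanishing of \<open>xi\<close> beyond \<open>card V\<close>.\<close>

lemma lam_alternating_sum:
  assumes "finite V" "V \<noteq> {}" "\<sigma> permutes V"
  shows "(\<Sum>S | S \<subseteq> V \<and> \<sigma> ` S = S. (-1) ^ card S * rsign S \<sigma>) = 0"
proof -
  let ?n = "card V"
  have "(\<Sum>p<Suc ?n. (-1) ^ (?n - p) * lam V p \<sigma>) = 0"
    using xi_expansion[OF assms(1,3), of "Suc ?n"] xi_gt[OF assms(1), of "Suc ?n"] assms by simp
  also have "(\<Sum>p<Suc ?n. (-1) ^ (?n - p) * lam V p \<sigma>) = (-1) ^ ?n * (\<Sum>p\<le>?n. (-1) ^ p * lam V p \<sigma>)"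
    unfolding sum_distrib_left lessThan_Suc_atMost
  proof (rule sum.cong, goal_cases)
    case (2 p)
    then have "even (?n - p) \<longleftrightarrow> even (?n + p)" by auto
    then show ?case by (simp add: minus_one_power_iff)
  qed simp
  also have "(\<Sum>p\<le>?n. (-1) ^ p * lam V p \<sigma>) =
      (\<Sum>p\<le>?n. \<Sum>S\<in>{S \<in> {S. S \<subseteq> V \<and> \<sigma> ` S = S}. card S = p}. (-1) ^ card S * rsign S \<sigma>)"
    unfolding lam_def sum_distrib_left
    by (intro sum.cong refl) auto
  also have "\<dots> = (\<Sum>S | S \<subseteq> V \<and> \<sigma> ` S = S. (-1) ^ card S * rsign S \<sigma>)"
    by (rule sum.group) (auto simp: finite_subset_card assms card_mono)
  finally show ?thesis by simp
qed

lemma lam_inverse: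
  assumes "finite V" "\<sigma> permutes V"
  shows "lam V p (perm_inv \<sigma>) = lam V p \<sigma>"
  unfolding lam_def
proof (rule sum.cong, goal_cases)
  case 1
  have "perm_inv \<sigma> ` S = S \<longleftrightarrow> \<sigma> ` S = S" for S
    by (metis assms(2) image_inv_f_f permutes_inj permutes_inv permutes_inv_inv)
  then show ?case by simp
next
  case (2 S)
  have inv: "perm_inv \<sigma> ` S = S \<longleftrightarrow> \<sigma> ` S = S"
    by (metis assms(2) image_inv_f_f permutes_inj permutes_inv permutes_inv_inv)
  have S: "finite S" "\<sigma> ` S = S" "perm_inv \<sigma> ` S = S"
    using 2 finite_subset[OF _ assms(1), of S] by (auto simp: inv)
  have "rsign S (perm_inv \<sigma>) * rsign S \<sigma> = rsign S (perm_inv \<sigma> \<circ> \<sigma>)"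
    using S assms(2) by (subst rsign_comp) (auto intro: permutes_inj_on permutes_inv)
  also have "\<dots> = 1" by (simp add: permutes_inv_o[OF assms(2)] rsign_permutes)
  finally have "rsign S (perm_inv \<sigma>) * (rsign S \<sigma> * rsign S \<sigma>) = rsign S \<sigma>"
    by (simp only: mult.assoc[symmetric]) simp
  then show ?case by simp
qed

text \<open>Hook characters are real. Consequently inversion in the wreath product affects only the
  twist of a twisted hook character.\<close>

lemma xi_inverse:
  assumes "finite V" "\<sigma> permutes V"
  shows "xi V p (perm_inv \<sigma>) = xi V p \<sigma>"
  using xi_expansion[OF assms(1) permutes_inv[OF assms(2)]] xi_expansion[OF assms] lam_inverse[OF assms]
  by simp

lemma xi_id:
  assumes "finite V"
  shows "xi V p id = of_nat (p * (card V choose p))"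
proof -
  have "xi V p id = (\<Sum>S | S \<subseteq> V \<and> card S = p. of_nat p)"
    unfolding xi_def
  proof (rule sum.cong, goal_cases)
    case (2 S)
    then have "finite S" using assms finite_subset by blast
    then show ?case using 2 by (simp add: hook_id)
  qed simp
  also have "\<dots> = of_nat (p * (card V choose p))"
    using n_subsets[OF assms, of p] by simp
  finally show ?thesis .
qed

section \<open>Schur's lemma for the hook sums\<close>

lemma permutes_transitive_on_pointed_sets:
  assumes "finite V" "S \<subseteq> V" "S' \<subseteq> V" "card S = card S'" "i \<in> S" "i' \<in> S'"
  obtains g where "g permutes V" "g ` S = S'" "g i = i'"
proof -
  have fin: "finite S" "finite S'" using assms finite_subset by blast+
  obtain h where h: "bij_betw h (S - {i}) (S' - {i'})"
    using assms fin by (metis card_Diff_singleton finite_Diff finite_same_card_bij)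
  obtain k where k: "bij_betw k (V - S) (V - S')"
    using assms fin by (metis card_Diff_subset finite_Diff finite_same_card_bij)
  define g where "g x = (if x = i then i' else if x \<in> S then h x else if x \<in> V then k x else x)" for x
  have 1: "bij_betw g (S - {i}) (S' - {i'})"
    using h by (rule bij_betw_cong[THEN iffD1, rotated]) (auto simp: g_def)
  have 2: "bij_betw g (V - S) (V - S')"
    using k by (rule bij_betw_cong[THEN iffD1, rotated]) (use assms in \<open>auto simp: g_def\<close>)
  have 3: "bij_betw g {i} {i'}" by (simp add: bij_betw_def g_def)
  have 4: "bij_betw g ((S - {i}) \<union> {i}) ((S' - {i'}) \<union> {i'})"
    by (rule bij_betw_combine[OF 1 3]) auto
  then have 5: "bij_betw g S S'" using assms by (simp add: insert_absorb)
  have "bij_betw g (S \<union> (V - S)) (S' \<union> (V - S'))"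
    by (rule bij_betw_combine[OF 5 2]) auto
  then have "bij_betw g V V" using assms by (simp add: Un_absorb1)
  then have "g permutes V" by (rule bij_imp_permutes) (use assms in \<open>auto simp: g_def\<close>)
  then show ?thesis using that[of g] 5 by (auto simp: bij_betw_def g_def)
qed

text \<open>Every \<open>hook S i\<close> is an eigenfunction by \<open>hook_schur\<close>, and
  conjugation moves any pointed set to any other, so the eigenvalue \<open>s\<close> is common to
  all of them. Setting \<open>y = id\<close> expresses \<open>s\<close> through
  \<open>xi V p id\<close>.\<close>

lemma xi_schur:
  fixes f :: "('a \<Rightarrow> 'a) \<Rightarrow> complex"
  assumes V: "finite V" and p: "p > 0" and y: "y permutes V"
    and cls: "\<And>g \<sigma>. g permutes V \<Longrightarrow> \<sigma> permutes V \<Longrightarrow> f (g \<circ> \<sigma> \<circ> perm_inv g) = f \<sigma>"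
  shows "(\<Sum>x | x permutes V. f x * xi V p (x \<circ> y)) * of_nat (p * (card V choose p)) =
         (\<Sum>x | x permutes V. f x * xi V p x) * xi V p y"
proof (cases "p \<le> card V")
  case False
  then show ?thesis using V by (simp add: xi_gt)
next
  case True
  define P where "P = {x. x permutes V}"
  define A where "A = {S. S \<subseteq> V \<and> card S = p}"
  obtain S0 where S0: "S0 \<subseteq> V" "card S0 = p" using obtain_subset_with_card_n[OF True] by blast
  then obtain i0 where i0: "i0 \<in> S0" using p by fastforce
  define s where "s = (\<Sum>x\<in>P. f x * hook S0 i0 x)"
  have s: "(\<Sum>x\<in>P. f x * hook S i x) = s" if S: "S \<in> A" "i \<in> S" for S i
  proof -
    obtain g where g: "g permutes V" "g ` S0 = S" "g i0 = i"
      using permutes_transitive_on_pointed_sets[OF V S0(1), of S i0 i] S S0 i0 by (auto simp: A_def)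
    have conj_perm: "g \<circ> x \<circ> perm_inv g permutes V"
      and conj_perm': "perm_inv g \<circ> x \<circ> g permutes V" if "x permutes V" for x
      using g(1) that by (auto intro!: permutes_compose permutes_inv)
    have conj_cancel: "g \<circ> (perm_inv g \<circ> x \<circ> g) \<circ> perm_inv g = x"
      "perm_inv g \<circ> (g \<circ> x \<circ> perm_inv g) \<circ> g = x" for x
      by (simp_all add: fun_eq_iff permutes_inverses[OF g(1)])
    have "(\<Sum>x\<in>P. f x * hook S i x) = (\<Sum>x\<in>P. f (g \<circ> x \<circ> perm_inv g) * hook S i (g \<circ> x \<circ> perm_inv g))"
      by (rule sum.reindex_bij_witness[of _ "\<lambda>x. g \<circ> x \<circ> perm_inv g" "\<lambda>x. perm_inv g \<circ> x \<circ> g"])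
         (simp_all only: P_def mem_Collect_eq conj_perm conj_perm' conj_cancel)
    also have "\<dots> = s" unfolding s_def
    proof (rule sum.cong, goal_cases)
      case (2 x)
      then have "hook S i (g \<circ> x \<circ> perm_inv g) = hook S0 i0 x"
        using hook_conj[OF g(1) V S0(1) _ i0, of x] g by (simp add: P_def permutes_inj)
      then show ?case using cls[OF g(1), of x] 2 by (simp add: P_def)
    qed simp
    finally show ?thesis .
  qed
  have key: "(\<Sum>x\<in>P. f x * xi V p (x \<circ> y)) = s * xi V p y" if y: "y permutes V" for y
  proof -
    have "(\<Sum>x\<in>P. f x * xi V p (x \<circ> y)) = (\<Sum>x\<in>P. \<Sum>S\<in>A. \<Sum>i\<in>S. f x * hook S i (x \<circ> y))"
      unfolding xi_def A_def sum_distrib_left ..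
    also have "\<dots> = (\<Sum>S\<in>A. \<Sum>x\<in>P. \<Sum>i\<in>S. f x * hook S i (x \<circ> y))" by (rule sum.swap)
    also have "\<dots> = (\<Sum>S\<in>A. \<Sum>i\<in>S. \<Sum>x\<in>P. f x * hook S i (x \<circ> y))"
      by (intro sum.cong refl sum.swap)
    also have "\<dots> = (\<Sum>S\<in>A. \<Sum>i\<in>S. s * hook S i y)"
    proof (intro sum.cong refl)
      fix S i assume S: "S \<in> A" "i \<in> S"
      then have "S \<subseteq> V" by (simp add: A_def)
      from hook_schur[OF V this S(2) y, of f, OF cls]
      show "(\<Sum>x\<in>P. f x * hook S i (x \<circ> y)) = s * hook S i y"
        using s[OF S] by (simp only: P_def)
    qed
    finally show ?thesis unfolding xi_def A_def sum_distrib_left .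
  qed
  have "(\<Sum>x\<in>P. f x * xi V p x) = s * of_nat (p * (card V choose p))"
    using key[OF permutes_id] by (simp only: comp_id xi_id[OF V])
  then show ?thesis using key[OF y] by (simp add: P_def)
qed

section \<open>Values of the hook sums on full and nearly full cycles\<close>

lemma rsign_empty [simp]: "rsign {} \<sigma> = 1"
proof -
  have "perm_restrict \<sigma> {} = id" by (auto simp: perm_restrict_def)
  then show ?thesis by (simp add: rsign_def)
qed

lemma lam_0:
  assumes "finite V"
  shows "lam V 0 \<sigma> = 1"
proof -
  have "{S. S \<subseteq> V \<and> card S = 0 \<and> \<sigma> ` S = S} = {{}}"
    using finite_subset[OF _ assms] by fastforce
  then show ?thesis by (simp add: lam_def)
qed

lemma lam_eq_0:
  assumes "\<And>S. S \<subseteq> V \<Longrightarrow> card S = p \<Longrightarrow> \<sigma> ` S = S \<Longrightarrow> False"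
  shows "lam V p \<sigma> = 0"
  unfolding lam_def by (rule sum.neutral) (use assms in blast)

lemma lam_eq_single:
  assumes "T \<subseteq> V" "card T = p" "\<sigma> ` T = T"
    and "\<And>S. S \<subseteq> V \<Longrightarrow> card S = p \<Longrightarrow> \<sigma> ` S = S \<Longrightarrow> S = T"
  shows "lam V p \<sigma> = rsign T \<sigma>"
proof -
  have "{S. S \<subseteq> V \<and> card S = p \<and> \<sigma> ` S = S} = {T}" using assms by blast
  then show ?thesis unfolding lam_def by simp
qed

lemma orbit_subset_invariant:
  assumes "\<sigma> ` S = S" "x \<in> S"
  shows "orbit \<sigma> x \<subseteq> S"
proof
  fix y assume "y \<in> orbit \<sigma> x"
  then show "y \<in> S" by induction (use assms in blast)+
qed

lemma permutes_self_in_orbit: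
  assumes "finite V" "\<sigma> permutes V"
  shows "x \<in> orbit \<sigma> x"
  using permutation_self_in_orbit permutes_imp_permutation[OF assms] by metis

lemma image_orbit:
  assumes "finite V" "\<sigma> permutes V"
  shows "\<sigma> ` orbit \<sigma> x = orbit \<sigma> x"
proof
  show "\<sigma> ` orbit \<sigma> x \<subseteq> orbit \<sigma> x" by (auto intro: orbit.step)
  show "orbit \<sigma> x \<subseteq> \<sigma> ` orbit \<sigma> x"
  proof
    fix y assume "y \<in> orbit \<sigma> x"
    then show "y \<in> \<sigma> ` orbit \<sigma> x"
      by cases (use permutes_self_in_orbit[OF assms] in auto)
  qed
qed

text \<open>Only the empty set and \<open>V\<close> are invariant, so \<open>lam V p\<close>
  vanishes strictly between and \<open>xi_add\<close> merely alternates the initial value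
  \<open>xi V 1 \<sigma> = card V\<close>.\<close>

lemma xi_full_cycle:
  assumes "finite V" "\<sigma> permutes V" "orbit \<sigma> ` V = {V}" "1 \<le> p" "p \<le> card V"
  shows "xi V p \<sigma> = (-1) ^ (p - 1) * of_nat (card V)"
  using assms(4,5)
proof (induction p rule: dec_induct)
  have inv: "S = {} \<or> S = V" if "S \<subseteq> V" "\<sigma> ` S = S" for S
  proof (cases "S = {}")
    case False
    then obtain x where "x \<in> S" by auto
    then have "orbit \<sigma> x = V" "orbit \<sigma> x \<subseteq> S"
      using assms(3) that orbit_subset_invariant[OF that(2)] by auto
    then show ?thesis using that by auto
  qed simp
  {
    case base
    show ?case using xi_add[OF assms(1,2), of 0] lam_0[OF assms(1), of \<sigma>] by (simp add: xi_0 assms)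
  next
    case (step p)
    have "lam V p \<sigma> = 0" 
    proof (rule lam_eq_0)
      fix S assume "S \<subseteq> V" "card S = p" "\<sigma> ` S = S"
      with inv[of S] step show False by auto
    qed
    then show ?case using xi_add[OF assms(1,2), of p] step
      by (cases p) (auto simp: add_eq_0_iff)
  }
qed

text \<open>An invariant set is the disjoint union of its traces on \<open>C\<close> and on the
  complement, both invariant, and the sign is multiplicative over this splitting.\<close>

lemma sum_invariant_split:
  assumes V: "finite V" "\<sigma> permutes V" and C: "C \<subseteq> V" "\<sigma> ` C = C"
  shows "(\<Sum>S | S \<subseteq> V \<and> \<sigma> ` S = S. F S * rsign S \<sigma>) =
    (\<Sum>S1 | S1 \<subseteq> C \<and> \<sigma> ` S1 = S1. \<Sum>S2 | S2 \<subseteq> V - C \<and> \<sigma> ` S2 = S2.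
      F (S1 \<union> S2) * (rsign S1 \<sigma> * rsign S2 \<sigma>))"
proof -
  let ?A = "{S1. S1 \<subseteq> C \<and> \<sigma> ` S1 = S1}" and ?B = "{S2. S2 \<subseteq> V - C \<and> \<sigma> ` S2 = S2}"
  note inj = permutes_inj[OF V(2)]
  have VC: "\<sigma> ` (V - C) = V - C" using image_set_diff[OF inj, of V C] C permutes_image[OF V(2)] by simp
  have "(\<Sum>S | S \<subseteq> V \<and> \<sigma> ` S = S. F S * rsign S \<sigma>) =
    (\<Sum>(S1, S2) \<in> ?A \<times> ?B. F (S1 \<union> S2) * (rsign S1 \<sigma> * rsign S2 \<sigma>))"
  proof (rule sum.reindex_bij_witness[of _ "\<lambda>(S1, S2). S1 \<union> S2" "\<lambda>S. (S \<inter> C, S - C)"], goal_cases)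
    case (1 S) then show ?case by auto
  next
    case (2 S)
    then have "\<sigma> ` (S \<inter> C) = S \<inter> C" "\<sigma> ` (S - C) = S - C"
      using C image_Int[OF inj] image_set_diff[OF inj] by auto
    with 2 show ?case by auto
  next
    case (3 T)
    then show ?case by auto
  next
    case (4 T)
    then obtain S1 S2 where T: "T = (S1, S2)" "S1 \<in> ?A" "S2 \<in> ?B" by auto
    then have "\<sigma> ` (S1 \<union> S2) = S1 \<union> S2" by (simp add: image_Un)
    then show ?case using T C by auto
  next
    case (5 S)
    have S: "\<sigma> ` (S \<inter> C) = S \<inter> C" "\<sigma> ` (S - C) = S - C"
      using 5 C image_Int[OF inj] image_set_diff[OF inj] by auto
    have fS: "finite S" using 5 finite_subset[OF _ V(1)] by blast
    have inj_on: "inj_on \<sigma> X" for X using inj_on_subset[OF inj subset_UNIV] .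
    have "perm_restrict \<sigma> S = perm_restrict \<sigma> (S \<inter> C) \<circ> perm_restrict \<sigma> (S - C)"
    proof
      fix x
      consider "x \<in> S \<inter> C" | "x \<in> S - C" | "x \<notin> S" by blast
      then show "perm_restrict \<sigma> S x = (perm_restrict \<sigma> (S \<inter> C) \<circ> perm_restrict \<sigma> (S - C)) x"
      proof cases
        case 1 then show ?thesis by (simp add: perm_restrict_def)
      next
        case 2
        then have "\<sigma> x \<in> S - C" using S(2) by blast
        then show ?thesis using 2 by (simp add: perm_restrict_def)
      next
        case 3 then show ?thesis by (simp add: perm_restrict_def)
      qed
    qed
    moreover have "permutation (perm_restrict \<sigma> (S \<inter> C))"
      using perm_restrict_permutes[OF _ inj_on S(1)] permutes_imp_permutation fS finite_Int by metis
    moreover have "permutation (perm_restrict \<sigma> (S - C))"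
      using perm_restrict_permutes[OF _ inj_on S(2)] permutes_imp_permutation fS finite_Diff by metis
    ultimately have "rsign (S \<inter> C) \<sigma> * rsign (S - C) \<sigma> = rsign S \<sigma>"
      by (simp add: rsign_def sign_compose)
    moreover have "S \<inter> C \<union> (S - C) = S" by blast
    ultimately show ?case by simp
  qed
  then show ?thesis by (simp add: sum.cartesian_product)
qed

lemma lam_alternating_sum_invariant:
  assumes "finite V" "\<sigma> permutes V" "C \<subseteq> V" "\<sigma> ` C = C" "C \<noteq> {}"
  shows "(\<Sum>S | S \<subseteq> C \<and> \<sigma> ` S = S. (-1) ^ card S * rsign S \<sigma>) = 0"
proof -
  have C: "finite C" using finite_subset[OF assms(3,1)] .
  have "perm_restrict \<sigma> C permutes C"
    using perm_restrict_permutes[OF C _ assms(4)] permutes_inj_on[OF assms(2)] by blast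
  note lam_alternating_sum[OF C assms(5) this]
  also have "(\<Sum>S | S \<subseteq> C \<and> perm_restrict \<sigma> C ` S = S. (-1) ^ card S * rsign S (perm_restrict \<sigma> C)) =
    (\<Sum>S | S \<subseteq> C \<and> \<sigma> ` S = S. (-1) ^ card S * rsign S \<sigma>)"
  proof (rule sum.cong, goal_cases)
    case 1
    have "perm_restrict \<sigma> C ` S = \<sigma> ` S" if "S \<subseteq> C" for S
      using that by (auto simp: perm_restrict_def image_def)
    then show ?case by (intro Collect_cong conj_cong refl) simp
  next
    case (2 S)
    then have "rsign S (perm_restrict \<sigma> C) = rsign S \<sigma>"
      by (intro rsign_cong) (auto simp: perm_restrict_def)
    then show ?case by simp
  qed
  finally show ?thesis .
qed

text \<open>Summing \<open>xi_expansion\<close> once more gives \<open>lam V q\<close> the weight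
  \<open>card V - q\<close>. Since the unweighted alternating sum vanishes for nonempty
  \<open>V\<close>, the right-hand sum is then minus the derivative of
  \<open>det (1 - t \<sigma>)\<close> at \<open>t = 1\<close>.\<close>

lemma xi_alternating_sum_eq:
  assumes V: "finite V" "\<sigma> permutes V"
  shows "(\<Sum>p=1..card V. (-1) ^ (p - 1) * xi V p \<sigma>) = of_nat (card V) *
      (\<Sum>S | S \<subseteq> V \<and> \<sigma> ` S = S. (of_nat (card V) - of_nat (card S)) * (-1) ^ card S * rsign S \<sigma>)"
proof -
  let ?n = "card V"
  have ind: "(\<Sum>p=1..m. (-1) ^ (p - 1) * xi V p \<sigma>) =
      of_nat ?n * (\<Sum>q\<le>m. (of_nat m - of_nat q) * (-1) ^ q * lam V q \<sigma>)" for m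
  proof (induction m)
    case 0 then show ?case by simp
  next
    case (Suc m)
    have pw: "(-1) ^ m * (-1) ^ (m - q) = ((-1) ^ q :: complex)" if qm: "q \<le> m" for q
    proof -
      obtain k where "m = q + k" using qm by (auto simp: le_iff_add)
      moreover have "(-1) ^ k * (-1) ^ k = (1 :: complex)" by (simp add: minus_one_power_iff)
      ultimately show ?thesis by (simp add: power_add mult.assoc)
    qed
    have "(-1) ^ m * xi V (Suc m) \<sigma> = of_nat ?n * (\<Sum>q\<le>m. (-1) ^ q * lam V q \<sigma>)"
      unfolding xi_expansion[OF V] lessThan_Suc_atMost sum_distrib_left
    proof (rule sum.cong, goal_cases)
      case (2 q)
      then show ?case using pw[of q] by (simp add: mult_ac)
    qed simp
    then have "(\<Sum>p=1..Suc m. (-1) ^ (p - 1) * xi V p \<sigma>) =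
      of_nat ?n * ((\<Sum>q\<le>m. (of_nat m - of_nat q) * (-1) ^ q * lam V q \<sigma>) + (\<Sum>q\<le>m. (-1) ^ q * lam V q \<sigma>))"
      using Suc by (simp add: ring_distribs)
    also have "\<dots> = of_nat ?n * (\<Sum>q\<le>m. (of_nat (Suc m) - of_nat q) * (-1) ^ q * lam V q \<sigma>)"
      by (simp add: sum.distrib[symmetric] algebra_simps)
    also have "\<dots> = of_nat ?n * (\<Sum>q\<le>Suc m. (of_nat (Suc m) - of_nat q) * (-1) ^ q * lam V q \<sigma>)" by simp
    finally show ?case .
  qed
  have "(\<Sum>q\<le>?n. (of_nat ?n - of_nat q) * (-1) ^ q * lam V q \<sigma>) =
      (\<Sum>q\<le>?n. \<Sum>S\<in>{S \<in> {S. S \<subseteq> V \<and> \<sigma> ` S = S}. card S = q}. (of_nat ?n - of_nat (card S)) * (-1) ^ card S * rsign S \<sigma>)"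
    unfolding lam_def sum_distrib_left
    by (intro sum.cong refl) auto
  also have "\<dots> = (\<Sum>S | S \<subseteq> V \<and> \<sigma> ` S = S. (of_nat ?n - of_nat (card S)) * (-1) ^ card S * rsign S \<sigma>)"
    by (rule sum.group) (auto simp: finite_subset_card V card_mono)
  finally show ?thesis unfolding ind by simp
qed

text \<open>The polynomial \<open>det (1 - t \<sigma>)\<close> is the product of
  \<open>1 - t ^ k\<close> over the cycle lengths \<open>k\<close>. With two or more cycles it has a
  multiple zero at \<open>t = 1\<close> and the derivative vanishes there; with one cycle the
  derivative is \<open>- card V\<close>, which together with the outer factor \<open>card V\<close>
  gives the square.\<close>

lemma xi_alternating_sum:
  assumes V: "finite V" "\<sigma> permutes V" "V \<noteq> {}"
  shows "(\<Sum>p=1..card V. (-1) ^ (p - 1) * xi V p \<sigma>) = (if orbit \<sigma> ` V = {V} then of_nat (card V) ^ 2 else 0)"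
proof (cases "orbit \<sigma> ` V = {V}")
  case True
  have "(\<Sum>p=1..card V. (-1) ^ (p - 1) * xi V p \<sigma>) = (\<Sum>p=1..card V. of_nat (card V))"
  proof (rule sum.cong, goal_cases)
    case (2 p)
    then show ?case using xi_full_cycle[OF V(1,2) True, of p]
      by (simp add: mult.assoc[symmetric] power_add[symmetric])
  qed simp
  then show ?thesis using True by (simp add: power2_eq_square)
next
  case False
  then obtain x where x: "x \<in> V" "orbit \<sigma> x \<noteq> V" using V(3) by auto
  define C where "C = orbit \<sigma> x"
  have C: "C \<subseteq> V" "\<sigma> ` C = C" "C \<noteq> {}" "C \<noteq> V"
    using image_orbit[OF V(1,2)] orbit_subset_invariant[OF permutes_image[OF V(2)] x(1)] x(2)
      permutes_self_in_orbit[OF V(1,2), of x] by (auto simp: C_def)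
  have D: "\<sigma> ` (V - C) = V - C" "V - C \<noteq> {}"
    using image_set_diff[OF permutes_inj[OF V(2)], of V C] C permutes_image[OF V(2)] by auto
  let ?A = "{S1. S1 \<subseteq> C \<and> \<sigma> ` S1 = S1}" and ?B = "{S2. S2 \<subseteq> V - C \<and> \<sigma> ` S2 = S2}"
  let ?e = "\<lambda>S. (-1) ^ card S * rsign S \<sigma>"
  have fC: "finite C" using finite_subset[OF C(1) V(1)] .
  have A0: "sum ?e ?A = 0" by (rule lam_alternating_sum_invariant[OF V(1,2) C(1-3)])
  have B0: "sum ?e ?B = 0" by (rule lam_alternating_sum_invariant[OF V(1,2) _ D]) auto
  have "(\<Sum>S | S \<subseteq> V \<and> \<sigma> ` S = S. (of_nat (card V) - of_nat (card S)) * (-1) ^ card S * rsign S \<sigma>) =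
     (\<Sum>S1\<in>?A. \<Sum>S2\<in>?B. (of_nat (card V) - of_nat (card (S1 \<union> S2))) * (-1) ^ card (S1 \<union> S2) * (rsign S1 \<sigma> * rsign S2 \<sigma>))"
    by (rule sum_invariant_split[OF V(1,2) C(1,2)])
  \<comment> \<open>The weight is linear in the two cardinalities, so each summand keeps one
    unweighted alternating sum, over \<open>?A\<close> or over \<open>?B\<close>, and both are zero.
    This is the product rule at a double zero.\<close>
  also have "\<dots> = (\<Sum>S1\<in>?A. \<Sum>S2\<in>?B. (of_nat (card V) - of_nat (card S1)) * ?e S1 * ?e S2 - ?e S1 * (of_nat (card S2) * ?e S2))"
  proof (intro sum.cong refl)
    fix S1 S2 assume S: "S1 \<in> ?A" "S2 \<in> ?B"
    have "finite S1" "finite S2" using S finite_subset[of S1 C] finite_subset[of S2 V] V(1) fC by auto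
    moreover have "S1 \<inter> S2 = {}" using S by auto
    ultimately have "card (S1 \<union> S2) = card S1 + card S2" by (rule card_Un_disjoint)
    then show "(of_nat (card V) - of_nat (card (S1 \<union> S2))) * (-1) ^ card (S1 \<union> S2) * (rsign S1 \<sigma> * rsign S2 \<sigma>) =
      (of_nat (card V) - of_nat (card S1)) * ?e S1 * ?e S2 - ?e S1 * (of_nat (card S2) * ?e S2)"
      by (simp add: power_add algebra_simps)
  qed
  also have "\<dots> = (\<Sum>S1\<in>?A. (of_nat (card V) - of_nat (card S1)) * ?e S1 * sum ?e ?B - ?e S1 * (\<Sum>S2\<in>?B. of_nat (card S2) * ?e S2))"
    by (simp only: sum_subtractf sum_distrib_left)
  also have "\<dots> = - (sum ?e ?A * (\<Sum>S2\<in>?B. of_nat (card S2) * ?e S2))"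
    unfolding B0 by (simp add: sum_negf sum_distrib_right)
  also have "\<dots> = 0" unfolding A0 by simp
  finally show ?thesis unfolding xi_alternating_sum_eq[OF V(1,2)] using False by simp
qed

text \<open>The invariant sets are only the empty set, \<open>{f}\<close>, \<open>C\<close> and
  \<open>V\<close>. The fixed point makes \<open>lam V 1\<close> cancel \<open>xi V 1\<close> in the
  recursion, after which nothing happens until the top degree, where the sign of
  \<open>\<sigma>\<close> appears.\<close>

lemma xi_near_full_cycle:
  assumes V: "finite V" "\<sigma> permutes V" and orb: "orbit \<sigma> ` V = {C, {f}}" "C \<noteq> {f}" and q: "1 \<le> q" "q \<le> card V"
  shows "xi V q \<sigma> = (if q = 1 then of_nat (card V) else if q = card V then (-1) ^ card V * of_nat (card V) else 0)"
proof -
  let ?n = "card V"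
  have self: "x \<in> orbit \<sigma> x" for x using permutes_self_in_orbit[OF V] .
  obtain c g where cg: "c \<in> V" "C = orbit \<sigma> c" "g \<in> V" "{f} = orbit \<sigma> g" 
  proof -
    have "C \<in> orbit \<sigma> ` V" "{f} \<in> orbit \<sigma> ` V" using orb by simp_all
    then show ?thesis using that by blast
  qed
  have "g = f" using self[of g] cg by auto
  then have f: "f \<in> V" "orbit \<sigma> f = {f}" using cg by auto
  have orbV: "orbit \<sigma> x \<subseteq> V" if "x \<in> V" for x
    using orbit_subset_invariant[OF permutes_image[OF V(2)] that] .
  have V_eq: "V = insert f C"
  proof
    show "V \<subseteq> insert f C"
    proof
      fix x assume "x \<in> V"
      then have "orbit \<sigma> x \<in> {C, {f}}" using orb by blast
      then show "x \<in> insert f C" using self[of x] by auto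
    qed
    show "insert f C \<subseteq> V" using cg f orbV by auto
  qed
  have C_inv: "\<sigma> ` C = C" using image_orbit[OF V] cg by simp
  have fC: "f \<notin> C"
  proof
    assume "f \<in> C"
    then have "orbit \<sigma> f = C" using cg V by (metis orbit_cyclic_eq3 cyclic_on_orbit permutes_imp_permutation)
    then show False using f orb by simp
  qed
  have C_ne: "C \<noteq> {}" using cg self by auto
  have finC: "finite C" using V V_eq by simp
  have n: "?n = Suc (card C)" using V_eq fC finC by simp
  have inv: "S \<in> {{}, {f}, C, V}" if S: "S \<subseteq> V" "\<sigma> ` S = S" for S
  proof (cases "S \<inter> C = {}")
    case True then show ?thesis using S V_eq by auto
  next
    case False
    then obtain x where x: "x \<in> S" "x \<in> C" by auto
    then have "orbit \<sigma> x = C" using cg V by (metis orbit_cyclic_eq3 cyclic_on_orbit permutes_imp_permutation)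
    then have "C \<subseteq> S" using orbit_subset_invariant[OF S(2) x(1)] by simp
    then show ?thesis using S V_eq by auto
  qed
  have xi1: "xi V 1 \<sigma> = of_nat ?n" using xi_add[OF V, of 0] lam_0[OF V(1), of \<sigma>] by (simp add: xi_0 V)
  have \<sigma>f: "\<sigma> f = f" using f orbit.base[of \<sigma> f] by simp
  have mid: "xi V q \<sigma> = 0" if "2 \<le> q" "q < ?n" for q
    using that
  proof (induction q rule: dec_induct)
    case base
    \<comment> \<open>The range \<open>2 \<le> q < card V\<close> forces
      \<open>card V \<ge> 3\<close>, so \<open>{f}\<close> is the only invariant singleton.\<close>
    have "card C \<noteq> 1" "card V \<noteq> 1" using base n by simp_all
    then have "lam V 1 \<sigma> = rsign {f} \<sigma>"
    proof (intro lam_eq_single)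
      fix S assume S: "S \<subseteq> V" "card S = 1" "\<sigma> ` S = S"
      then show "S = {f}" using inv[of S] \<open>card C \<noteq> 1\<close> \<open>card V \<noteq> 1\<close> by auto
    qed (use \<sigma>f f in simp_all)
    also have "\<dots> = 1"
    proof -
      have "perm_restrict \<sigma> {f} = id" using \<sigma>f by (auto simp: perm_restrict_def)
      then show ?thesis by (simp add: rsign_def)
    qed
    finally show ?case using xi_add[OF V, of 1] xi1 by (simp add: numeral_2_eq_2)
  next
    case (step q)
    have "lam V q \<sigma> = 0"
    proof (rule lam_eq_0)
      fix S assume "S \<subseteq> V" "card S = q" "\<sigma> ` S = S"
      with inv[of S] step n show False by auto
    qed
    then show ?case using xi_add[OF V, of q] step by simp
  qed
  \<comment> \<open>The top value is computed from above: \<open>xi V (Suc ?n) \<sigma> = 0\<close>,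
    so \<open>xi_add\<close> leaves \<open>card V\<close> times the sign of
    \<open>\<sigma>\<close>.\<close>
  have top: "xi V ?n \<sigma> = (-1) ^ ?n * of_nat ?n"
  proof -
    have "lam V ?n \<sigma> = rsign V \<sigma>"
      using card_subset_eq[OF V(1)] permutes_image[OF V(2)] by (intro lam_eq_single) auto
    moreover have "perm_restrict \<sigma> V = perm_restrict \<sigma> C"
      using V_eq \<sigma>f by (auto simp: perm_restrict_def)
    ultimately have lamn: "lam V ?n \<sigma> = rsign C \<sigma>" by (simp add: rsign_def)
    \<comment> \<open>The sign of the cycle on \<open>C\<close> is read off from the vanishing
      alternating sum over its two invariant subsets.\<close>
    have "{S. S \<subseteq> C \<and> \<sigma> ` S = S} = {{}, C}"
    proof -
      have "S = {} \<or> S = C" if "S \<subseteq> C" "\<sigma> ` S = S" for S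
        using inv[of S] that V_eq fC by auto
      then show ?thesis using C_inv by blast
    qed
    then have "1 + (-1) ^ card C * rsign C \<sigma> = 0"
      using lam_alternating_sum_invariant[OF V _ C_inv C_ne] V_eq C_ne
      by (simp add: subset_insertI)
    then have "(-1) ^ card C * ((-1) ^ card C * rsign C \<sigma>) = (-1) ^ card C * (- 1)"
      by (simp only: add_eq_0_iff)
    then have "rsign C \<sigma> = (-1) ^ ?n"
      by (simp add: n mult.assoc[symmetric] power_mult_distrib[symmetric])
    then show ?thesis using xi_add[OF V, of ?n] xi_gt[OF V(1), of "Suc ?n"] lamn by simp
  qed
  show ?thesis using xi1 mid[of q] top q by auto
qed

section \<open>Weighted sums over coloured permutations\<close>

text \<open>A function multiplicative over coloured cycles. With \<open>g\<close> equal to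
  \<open>b\<close> at 1 and to 1 elsewhere it is \<open>b\<close> to the number of cycles with
  product 1; multiplying \<open>g\<close> by \<open>\<eta> ^ c\<close> adds the factor
  \<open>\<delta> ^ c\<close>.\<close>

definition cycle_weight :: "'a set \<Rightarrow> ('a \<Rightarrow> 'a) \<Rightarrow> ('a \<Rightarrow> complex) \<Rightarrow> (complex \<Rightarrow> complex) \<Rightarrow> complex" where
  "cycle_weight V \<sigma> u g = (\<Prod>C\<in>orbit \<sigma> ` V. g (\<Prod>i\<in>C. u i))"

lemma orbit_subset_permutes:
  assumes "\<sigma> permutes V" "x \<in> V"
  shows "orbit \<sigma> x \<subseteq> V"
proof
  fix y assume "y \<in> orbit \<sigma> x"
  then show "y \<in> V" by induction (simp_all add: permutes_in_image[OF assms(1)] assms(2))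
qed

lemma cycle_weight_cong:
  assumes "\<sigma> permutes V" "\<And>i. i \<in> V \<Longrightarrow> u i = w i"
  shows "cycle_weight V \<sigma> u g = cycle_weight V \<sigma> w g"
  unfolding cycle_weight_def
proof (rule prod.cong, goal_cases)
  case (2 C)
  then have "C \<subseteq> V" using orbit_subset_permutes[OF assms(1)] by auto
  then have "(\<Prod>i\<in>C. u i) = (\<Prod>i\<in>C. w i)" using assms(2) by (intro prod.cong) auto
  then show ?case by simp
qed simp

lemma cycle_weight_insert_fixed:
  assumes "finite V" "v \<notin> V" "q permutes V"
  shows "cycle_weight (insert v V) q u g = g (u v) * cycle_weight V q u g"
proof -
  have "orbit q v = {v}" using assms by (simp add: orbit_eq_singleton_iff permutes_not_in)
  moreover have "{v} \<notin> orbit q ` V" using orbit_subset_permutes[OF assms(3)] assms(2) by fastforce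
  ultimately show ?thesis using assms(1) by (simp add: cycle_weight_def)
qed

text \<open>The new permutation goes from \<open>i\<close> to \<open>v\<close> to
  \<open>q i\<close>: it inserts \<open>v\<close> right after \<open>i\<close> into its cycle and
  leaves the other cycles alone.\<close>

lemma orbit_insert_transpose:
  assumes V: "finite V" "v \<notin> V" "q permutes V" and i: "i \<in> V" and y: "y \<in> V"
  shows "orbit (Transposition.transpose v (q i) \<circ> q) y =
    (if i \<in> orbit q y then insert v (orbit q y) else orbit q y)" (is "orbit ?\<sigma> y = ?R")
proof
  have self: "y \<in> orbit q y" for y
    using permutation_self_in_orbit permutes_imp_permutation[OF V(1,3)] by metis
  have qV: "q z \<in> V \<longleftrightarrow> z \<in> V" for z using permutes_in_image[OF V(3)] .
  have qv: "q v = v" using V by (simp add: permutes_not_in)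
  have \<sigma>v: "?\<sigma> v = q i" by (simp add: qv)
  have \<sigma>i: "?\<sigma> i = v" by simp
  have \<sigma>z: "?\<sigma> z = q z" if "z \<in> V" "z \<noteq> i" for z
  proof -
    have "q z \<noteq> v" "q z \<noteq> q i"
      using that qV[of z] V(2) permutes_inj[OF V(3)] by (auto simp: inj_eq)
    then show ?thesis by (simp add: transpose_apply_other)
  qed
  have orbV: "z \<in> V" if "z \<in> orbit q y" for z using that orbit_subset_permutes[OF V(3) y] by auto
  show "orbit ?\<sigma> y \<subseteq> ?R"
  proof
    fix z assume "z \<in> orbit ?\<sigma> y"
    then show "z \<in> ?R"
    proof induction
      case base
      show ?case
      proof (cases "y = i")
        case True then show ?thesis using self[of y] \<sigma>i by simp
      next
        case False then show ?thesis using \<sigma>z[OF y False] orbit.base[of q y] by simp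
      qed
    next
      case (step z)
      show ?case
      proof (cases "z = v")
        case True
        then have "i \<in> orbit q y" using step V(2) orbV by (auto split: if_splits)
        then show ?thesis using True \<sigma>v orbit.step[of i q y] by simp
      next
        case False
        then have z: "z \<in> orbit q y" using step by (auto split: if_splits)
        show ?thesis
        proof (cases "z = i")
          case True then show ?thesis using z \<sigma>i by simp
        next
          case False then show ?thesis using \<sigma>z[OF orbV[OF z] False] orbit.step[OF z] by simp
        qed
      qed
    qed
  qed
  have step_q: "q z \<in> orbit ?\<sigma> x" if "z \<in> V" "z \<in> orbit ?\<sigma> x \<or> z = x" for z x
  proof -
    have 1: "?\<sigma> z \<in> orbit ?\<sigma> x" using that orbit.intros by fast
    show ?thesis
    proof (cases "z = i")
      case True
      have "?\<sigma> (?\<sigma> z) \<in> orbit ?\<sigma> x" using 1 by (rule orbit.step)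
      then show ?thesis using True \<sigma>v \<sigma>i by simp
    next
      case False then show ?thesis using 1 \<sigma>z[OF that(1)] by simp
    qed
  qed
  have sub: "orbit q y \<subseteq> orbit ?\<sigma> y"
  proof
    fix z assume "z \<in> orbit q y"
    then show "z \<in> orbit ?\<sigma> y"
    proof induction
      case base show ?case by (rule step_q[OF y]) simp
    next
      case (step z)
      show ?case by (rule step_q[OF orbV[OF step(1)]]) (use step(2) in blast)
    qed
  qed
  show "?R \<subseteq> orbit ?\<sigma> y"
  proof (cases "i \<in> orbit q y")
    case True
    then have "?\<sigma> i \<in> orbit ?\<sigma> y" using sub by (intro orbit.step) blast
    then show ?thesis using sub True \<sigma>i by (simp del: comp_apply)
  qed (use sub in simp)
qed

text \<open>Since \<open>v\<close> joins the cycle of \<open>i\<close>, its colour can be absorbed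
  into the colour of \<open>i\<close> without changing any cycle product.\<close>

lemma cycle_weight_insert_transpose:
  assumes V: "finite V" "v \<notin> V" "q permutes V" and i: "i \<in> V"
  shows "cycle_weight (insert v V) (Transposition.transpose v (q i) \<circ> q) u g =
    cycle_weight V q (u(i := u i * u v)) g"
proof -
  let ?\<sigma> = "Transposition.transpose v (q i) \<circ> q"
  define \<phi> where "\<phi> C = (if i \<in> C then insert v C else C)" for C
  have orb: "orbit ?\<sigma> y = \<phi> (orbit q y)" if "y \<in> V" for y
    using orbit_insert_transpose[OF V i that] by (simp add: \<phi>_def)
  have qv: "q v = v" using V by (simp add: permutes_not_in)
  have perm: "permutation ?\<sigma>"
    using permutes_imp_permutation[OF V(1,3)] by (intro permutation_compose permutation_swap_id)
  have "v \<in> orbit ?\<sigma> i"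
    using orbit.base[of ?\<sigma> i] by simp
  then have orb_v: "orbit ?\<sigma> v = orbit ?\<sigma> i"
    using orbit_cyclic_eq3[OF cyclic_on_orbit'[OF perm]] by blast
  have im: "orbit ?\<sigma> ` insert v V = \<phi> ` orbit q ` V"
  proof -
    have "orbit ?\<sigma> ` insert v V = orbit ?\<sigma> ` V" using orb_v i by auto
    also have "\<dots> = \<phi> ` orbit q ` V" unfolding image_image by (rule image_cong[OF refl orb])
    finally show ?thesis .
  qed
  have sub: "C \<subseteq> V" "finite C" "v \<notin> C" if "C \<in> orbit q ` V" for C
    using that orbit_subset_permutes[OF V(3)] V finite_subset[of C V] by auto
  have inj: "inj_on \<phi> (orbit q ` V)"
  proof (rule inj_onI)
    fix C D assume CD: "C \<in> orbit q ` V" "D \<in> orbit q ` V" "\<phi> C = \<phi> D"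
    have "\<phi> C - {v} = C" "\<phi> D - {v} = D" by (simp_all add: \<phi>_def sub(3)[OF CD(1)] sub(3)[OF CD(2)])
    then show "C = D" using CD(3) by metis
  qed
  have "cycle_weight (insert v V) ?\<sigma> u g = (\<Prod>C\<in>orbit q ` V. g (\<Prod>j\<in>\<phi> C. u j))"
    unfolding cycle_weight_def im by (simp add: prod.reindex[OF inj] comp_def)
  also have "\<dots> = cycle_weight V q (u(i := u i * u v)) g"
    unfolding cycle_weight_def
  proof (rule prod.cong, goal_cases)
    case (2 C)
    note C = sub[OF 2]
    have "(\<Prod>j\<in>\<phi> C. u j) = (\<Prod>j\<in>C. (u(i := u i * u v)) j)"
    proof (cases "i \<in> C")
      case True
      have "(\<Prod>j\<in>C - {i}. (u(i := u i * u v)) j) = (\<Prod>j\<in>C - {i}. u j)"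
        by (rule prod.cong) auto
      then show ?thesis
        using True C by (simp add: \<phi>_def prod.remove[OF C(2) True])
    next
      case False
      then show ?thesis using C by (auto simp: \<phi>_def intro!: prod.cong)
    qed
    then show ?case by simp
  qed simp
  finally show ?thesis .
qed

lemma invariant_insert_transpose:
  assumes V: "v \<notin> V" "q permutes V" "S \<subseteq> V" "b \<in> insert v V"
  shows "(Transposition.transpose v b \<circ> q) ` S = S \<longleftrightarrow> q ` S = S \<and> b \<notin> S" (is "?A \<longleftrightarrow> ?B")
    and "(Transposition.transpose v b \<circ> q) ` insert v S = insert v S \<longleftrightarrow> q ` S = S \<and> (b = v \<or> b \<in> S)" (is "?C \<longleftrightarrow> ?D")
proof -
  let ?t = "Transposition.transpose v b"
  have vS: "v \<notin> S" "v \<notin> q ` S" using V permutes_in_image[OF V(2)] by blast+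
  have qv: "q v = v" using V by (simp add: permutes_not_in)
  have invol: "?t ` X = Y \<longleftrightarrow> X = ?t ` Y" for X Y by (metis image_comp transpose_comp_involutory image_id id_apply)
  have A: "?A \<longleftrightarrow> q ` S = ?t ` S" by (simp only: image_comp[symmetric] invol)
  have C: "?C \<longleftrightarrow> insert v (q ` S) = ?t ` insert v S"
    by (simp only: image_comp[symmetric] invol) (simp add: qv)
  have t1: "?t ` S = S" if "b \<notin> S" using that vS 
    by (auto simp: image_iff transpose_apply_other)
  have t2: "?t ` insert v S = insert v S" if "b = v \<or> b \<in> S"
    using that vS by (auto simp: image_iff Transposition.transpose_def)
  have t3: "v \<in> ?t ` S" if "b \<in> S" using that by (metis imageI transpose_apply_second)
  have t4: "v \<notin> ?t ` insert v S" if "b \<noteq> v" "b \<notin> S"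
    using that vS by (auto simp: Transposition.transpose_def split: if_splits)
  show "?A \<longleftrightarrow> ?B" using A t1 t3 vS by metis
  show "?C \<longleftrightarrow> ?D" using C t2 t4 vS by (metis insertI1 insert_ident)
qed

text \<open>Invariant sets without \<open>v\<close> are those of \<open>q\<close> avoiding
  \<open>b\<close>. Invariant sets with \<open>v\<close> come from an invariant set of
  \<open>q\<close>, either because \<open>v\<close> is a fixed point (\<open>b = v\<close>) or
  because \<open>v\<close> lengthens a cycle inside the set (\<open>b \<in> S\<close>), and
  lengthening a cycle flips the sign.\<close>

lemma lam_insert_transpose:
  assumes V: "finite V" "v \<notin> V" "q permutes V" "b \<in> insert v V"
  shows "lam (insert v V) (Suc p) (Transposition.transpose v b \<circ> q) =
    (\<Sum>S | S \<subseteq> V \<and> card S = Suc p \<and> q ` S = S. if b \<in> S then 0 else rsign S q) +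
    (\<Sum>S | S \<subseteq> V \<and> card S = p \<and> q ` S = S. if b = v then rsign S q else if b \<in> S then - rsign S q else 0)"
proof -
  let ?t = "Transposition.transpose v b"
  let ?F = "{S. S \<subseteq> insert v V \<and> card S = Suc p \<and> (?t \<circ> q) ` S = S}"
  let ?A = "{S. S \<subseteq> V \<and> card S = Suc p \<and> q ` S = S}" and ?B = "{S. S \<subseteq> V \<and> card S = p \<and> q ` S = S}"
  note inv = invariant_insert_transpose[OF V(2,3) _ V(4)]
  have qv: "q v = v" using V by (simp add: permutes_not_in)
  have fin: "finite S" if "S \<subseteq> V" for S using finite_subset[OF that V(1)] .
  have "lam (insert v V) (Suc p) (?t \<circ> q) = (\<Sum>S | S \<in> ?F \<and> v \<notin> S. rsign S (?t \<circ> q)) + (\<Sum>S | S \<in> ?F \<and> v \<in> S. rsign S (?t \<circ> q))"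
    unfolding lam_def using V(1)
    by (subst sum.union_disjoint[symmetric]) (auto simp: finite_subset_card intro!: sum.cong)
  also have "(\<Sum>S | S \<in> ?F \<and> v \<notin> S. rsign S (?t \<circ> q)) = (\<Sum>S | S \<in> ?A \<and> b \<notin> S. rsign S q)"
  proof (rule sum.cong, goal_cases)
    case 1
    have "S \<in> ?F \<and> v \<notin> S \<longleftrightarrow> S \<in> ?A \<and> b \<notin> S" for S
    proof (cases "S \<subseteq> V")
      case True then show ?thesis using inv(1)[OF True] V(2) by blast
    qed auto
    then show ?case by (rule Collect_cong)
  next
    case (2 S)
    then have S: "S \<subseteq> V" "q ` S = S" "b \<notin> S" by auto
    have "(?t \<circ> q) s = q s" if "s \<in> S" for s
    proof -
      have "q s \<in> S" using S that by blast
      then have "q s \<noteq> v" "q s \<noteq> b" using S V by auto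
      then show ?thesis by (simp add: transpose_apply_other)
    qed
    then show ?case by (rule rsign_cong)
  qed
  also have "\<dots> = (\<Sum>S\<in>?A. if b \<in> S then 0 else rsign S q)"
    using finite_subset_card[OF V(1)] by (intro sum.mono_neutral_cong_left) auto
  also have "(\<Sum>S | S \<in> ?F \<and> v \<in> S. rsign S (?t \<circ> q)) =
      (\<Sum>S | S \<in> ?B \<and> (b = v \<or> b \<in> S). (if b = v then 1 else - 1) * rsign S q)"
  proof (rule sum.reindex_bij_witness[of _ "\<lambda>S. insert v S" "\<lambda>S. S - {v}"], goal_cases)
    case (1 S) then show ?case by auto
  next
    case (2 S)
    then have S: "S - {v} \<subseteq> V" "insert v (S - {v}) = S" "v \<in> S" by auto
    then have "card (S - {v}) = p" using 2 by (simp add: card_Diff_singleton)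
    moreover have "(?t \<circ> q) ` insert v (S - {v}) = insert v (S - {v})" using 2 S by simp
    ultimately show ?case using inv(2)[OF S(1)] S(1) by blast
  next
    case (3 S) then show ?case using V(2) by auto
  next
    case (4 S)
    then have S: "S \<subseteq> V" "v \<notin> S" using V(2) by auto
    then show ?case using inv(2)[OF S(1)] 4 fin[OF S(1)] by auto
  next
    case (5 S)
    define R where "R = S - {v}"
    have S: "R \<subseteq> V" "S = insert v R" "v \<notin> R" using 5 by (auto simp: R_def)
    then have R: "q ` R = R" "b = v \<or> b \<in> R" using inv(2)[OF S(1)] 5 by auto
    have "perm_restrict (?t \<circ> q) S = ?t \<circ> perm_restrict q R"
    proof
      fix s
      consider "s = v" | "s \<in> R" | "s \<notin> R" "s \<noteq> v" by blast
      then show "perm_restrict (?t \<circ> q) S s = (?t \<circ> perm_restrict q R) s"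
      proof cases
        case 1 then show ?thesis using S qv by (simp add: perm_restrict_def)
      next
        case 2 then show ?thesis using S by (simp add: perm_restrict_def)
      next
        case 3
        then have "s \<noteq> b" using R by auto
        then show ?thesis using 3 S by (simp add: perm_restrict_def transpose_apply_other)
      qed
    qed
    moreover have "permutation (perm_restrict q R)"
      using perm_restrict_permutes[OF fin[OF S(1)] permutes_inj_on[OF V(3)] R(1)]
        permutes_imp_permutation[OF fin[OF S(1)]] by blast
    ultimately show ?case
      by (simp add: R_def[symmetric] rsign_def sign_compose permutation_swap_id sign_swap_id)
  qed
  also have "\<dots> = (\<Sum>S\<in>?B. if b = v then rsign S q else if b \<in> S then - rsign S q else 0)"
    using finite_subset_card[OF V(1)] by (intro sum.mono_neutral_cong_left) auto
  finally show ?thesis .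
qed

section \<open>Generating functions over all coloured permutations\<close>

definition weight_sum :: "complex set \<Rightarrow> 'a set \<Rightarrow> ('a \<Rightarrow> 'a) \<Rightarrow> (complex \<Rightarrow> complex) \<Rightarrow> complex" where
  "weight_sum Z V \<sigma> g = (\<Sum>u\<in>V \<rightarrow>\<^sub>E Z. cycle_weight V \<sigma> u g)"

lemma sum_PiE_insert:
  fixes F :: "('a \<Rightarrow> 'b) \<Rightarrow> complex"
  assumes "v \<notin> V"
  shows "(\<Sum>u\<in>insert v V \<rightarrow>\<^sub>E Z. F u) = (\<Sum>\<eta>\<in>Z. \<Sum>u\<in>V \<rightarrow>\<^sub>E Z. F (u(v := \<eta>)))"
proof -
  have "(\<Sum>u\<in>insert v V \<rightarrow>\<^sub>E Z. F u) = (\<Sum>(\<eta>, u)\<in>Z \<times> (V \<rightarrow>\<^sub>E Z). F (u(v := \<eta>)))"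
    unfolding PiE_insert_eq using assms
    by (subst sum.reindex[OF inj_combinator]) (auto simp: comp_def case_prod_unfold)
  then show ?thesis by (simp add: sum.cartesian_product)
qed

locale root_group =
  fixes Z :: "complex set"
  assumes finite_Z [simp]: "finite Z"
    and Z_mult: "x \<in> Z \<Longrightarrow> y \<in> Z \<Longrightarrow> x * y \<in> Z"
    and Z_inverse: "x \<in> Z \<Longrightarrow> inverse x \<in> Z"
    and Z_nonzero: "x \<in> Z \<Longrightarrow> x \<noteq> 0"
begin

lemma weight_sum_insert_fixed:
  assumes "finite V" "v \<notin> V" "q permutes V"
  shows "weight_sum Z (insert v V) q g = sum g Z * weight_sum Z V q g"
proof -
  have "cycle_weight (insert v V) q (u(v := \<eta>)) g = g \<eta> * cycle_weight V q u g" for u \<eta>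
  proof -
    have "cycle_weight V q (u(v := \<eta>)) g = cycle_weight V q u g"
      by (rule cycle_weight_cong[OF assms(3)]) (use assms(2) in auto)
    then show ?thesis by (simp add: cycle_weight_insert_fixed[OF assms])
  qed
  then show ?thesis
    by (simp add: weight_sum_def sum_PiE_insert[OF assms(2)] sum_product)
qed

text \<open>The colour of \<open>v\<close> only multiplies the colour of its predecessor, and this
  is a bijection of the colourings of \<open>V\<close>. Every one of the \<open>card Z\<close>
  colours of \<open>v\<close> therefore contributes the same amount.\<close>

lemma weight_sum_insert_transpose:
  assumes V: "finite V" "v \<notin> V" "q permutes V" and b: "b \<in> V"
  shows "weight_sum Z (insert v V) (Transposition.transpose v b \<circ> q) g = of_nat (card Z) * weight_sum Z V q g"
proof -
  define i where "i = perm_inv q b"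
  have i: "i \<in> V" "q i = b" using b permutes_inverses[OF V(3)] permutes_in_image[OF permutes_inv[OF V(3)]]
    by (auto simp: i_def)
  have iv: "i \<noteq> v" using i V(2) by auto
  have "(\<Sum>u\<in>V \<rightarrow>\<^sub>E Z. cycle_weight (insert v V) (Transposition.transpose v b \<circ> q) (u(v := \<eta>)) g) = weight_sum Z V q g"
    if \<eta>: "\<eta> \<in> Z" for \<eta>
  proof -
    have "(\<Sum>u\<in>V \<rightarrow>\<^sub>E Z. cycle_weight (insert v V) (Transposition.transpose v b \<circ> q) (u(v := \<eta>)) g) =
        (\<Sum>u\<in>V \<rightarrow>\<^sub>E Z. cycle_weight V q (u(i := u i * \<eta>)) g)"
    proof (rule sum.cong, goal_cases)
      case (2 u)
      have "cycle_weight (insert v V) (Transposition.transpose v b \<circ> q) (u(v := \<eta>)) g =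
          cycle_weight V q ((u(v := \<eta>))(i := (u(v := \<eta>)) i * (u(v := \<eta>)) v)) g"
        unfolding i(2)[symmetric] by (rule cycle_weight_insert_transpose[OF V i(1)])
      also have "\<dots> = cycle_weight V q (u(i := u i * \<eta>)) g"
        by (rule cycle_weight_cong[OF V(3)]) (use V(2) iv in auto)
      finally show ?case .
    qed simp
    also have "\<dots> = (\<Sum>u\<in>V \<rightarrow>\<^sub>E Z. cycle_weight V q u g)"
    proof (rule sum.reindex_bij_witness[of _ "\<lambda>u. u(i := u i * inverse \<eta>)" "\<lambda>u. u(i := u i * \<eta>)"], goal_cases)
      case (1 u) then show ?case using Z_nonzero[OF \<eta>] by auto
    next
      case (2 u)
      then have "u i * \<eta> \<in> Z" using i(1) \<eta> Z_mult by auto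
      then show ?case using 2 i(1) by (auto simp: PiE_iff extensional_def)
    next
      case (3 u) then show ?case using Z_nonzero[OF \<eta>] by auto
    next
      case (4 u)
      then have "u i * inverse \<eta> \<in> Z" using i(1) \<eta> Z_mult Z_inverse by auto
      then show ?case using 4 i(1) by (auto simp: PiE_iff extensional_def)
    qed auto
    finally show ?thesis by (simp add: weight_sum_def)
  qed
  then show ?thesis by (simp add: weight_sum_def sum_PiE_insert[OF V(2)])
qed

definition lam_sum :: "'a set \<Rightarrow> nat \<Rightarrow> (complex \<Rightarrow> complex) \<Rightarrow> complex" where
  "lam_sum V p g = (\<Sum>\<sigma> | \<sigma> permutes V. lam V p \<sigma> * weight_sum Z V \<sigma> g)"

text \<open>Every permutation of \<open>insert v V\<close> is uniquely a transposition of
  \<open>v\<close> with some \<open>b\<close> after a permutation of \<open>V\<close>. The case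
  \<open>b = v\<close> adds a fixed point, weighted by \<open>sum g Z\<close>; every other
  \<open>b\<close> is weighted by \<open>card Z\<close>.\<close>

lemma lam_sum_insert_eq:
  assumes V: "finite V" "v \<notin> V"
  shows "lam_sum (insert v V) p g = (\<Sum>q | q permutes V.
    (lam (insert v V) p q * sum g Z +
     (\<Sum>b\<in>V. lam (insert v V) p (Transposition.transpose v b \<circ> q)) * of_nat (card Z)) * weight_sum Z V q g)"
proof -
  have "lam_sum (insert v V) p g = (\<Sum>b\<in>insert v V. \<Sum>q | q permutes V.
      lam (insert v V) p (Transposition.transpose v b \<circ> q) * weight_sum Z (insert v V) (Transposition.transpose v b \<circ> q) g)"
    unfolding lam_sum_def by (rule sum_over_permutations_insert[OF V])
  also have "\<dots> = (\<Sum>q | q permutes V. \<Sum>b\<in>insert v V.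
      lam (insert v V) p (Transposition.transpose v b \<circ> q) * weight_sum Z (insert v V) (Transposition.transpose v b \<circ> q) g)"
    by (rule sum.swap)
  also have "\<dots> = (\<Sum>q | q permutes V.
    (lam (insert v V) p q * sum g Z +
     (\<Sum>b\<in>V. lam (insert v V) p (Transposition.transpose v b \<circ> q)) * of_nat (card Z)) * weight_sum Z V q g)"
  proof (rule sum.cong, goal_cases)
    case (2 q)
    then have q: "q permutes V" by simp
    have same: "Transposition.transpose v v = id" by simp
    have "(\<Sum>b\<in>V. lam (insert v V) p (Transposition.transpose v b \<circ> q) *
        weight_sum Z (insert v V) (Transposition.transpose v b \<circ> q) g) =
        (\<Sum>b\<in>V. lam (insert v V) p (Transposition.transpose v b \<circ> q)) * of_nat (card Z) * weight_sum Z V q g"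
      unfolding sum_distrib_right
      by (rule sum.cong) (simp_all only: weight_sum_insert_transpose[OF V q] mult.assoc)
    then show ?case
      unfolding sum.insert[OF V] same id_comp weight_sum_insert_fixed[OF V q]
      by (simp only: distrib_right mult.assoc)
  qed simp
  finally show ?thesis .
qed

lemma lam_sum_insert_0:
  assumes V: "finite V" "v \<notin> V"
  shows "lam_sum (insert v V) 0 g = (sum g Z + of_nat (card V) * of_nat (card Z)) * lam_sum V 0 g"
  using V by (subst lam_sum_insert_eq[OF V]) (simp add: lam_0 lam_sum_def sum_distrib_left)

text \<open>The coefficients count the positions of \<open>b\<close> in
  \<open>lam_insert_transpose\<close>: an invariant set of size \<open>p + 1\<close> without
  \<open>v\<close> admits the \<open>card V - (p + 1)\<close> points outside it, while one of size
  \<open>p\<close> extended by \<open>v\<close> admits its own \<open>p\<close> points with a minus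
  sign. The term \<open>sum g Z\<close> is the fixed point in both cases.\<close>

lemma lam_sum_insert_Suc:
  assumes V: "finite V" "v \<notin> V"
  shows "lam_sum (insert v V) (Suc p) g =
    (sum g Z + (of_nat (card V) - of_nat (Suc p)) * of_nat (card Z)) * lam_sum V (Suc p) g +
    (sum g Z - of_nat p * of_nat (card Z)) * lam_sum V p g"
proof -
  have 1: "lam (insert v V) (Suc p) q = lam V (Suc p) q + lam V p q" if q: "q permutes V" for q
  proof -
    have "(\<Sum>S | S \<subseteq> V \<and> card S = Suc p \<and> q ` S = S. if v \<in> S then 0 else rsign S q) = lam V (Suc p) q"
      unfolding lam_def by (rule sum.cong) (use V(2) in auto)
    then show ?thesis using lam_insert_transpose[OF V q, of v p] by (simp add: lam_def)
  qed
  have sums: "(\<Sum>b\<in>V. lam (insert v V) (Suc p) (Transposition.transpose v b \<circ> q)) =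
    (of_nat (card V) - of_nat (Suc p)) * lam V (Suc p) q - of_nat p * lam V p q" if q: "q permutes V" for q
  proof -
    let ?A = "{S. S \<subseteq> V \<and> card S = Suc p \<and> q ` S = S}" and ?B = "{S. S \<subseteq> V \<and> card S = p \<and> q ` S = S}"
    have "(\<Sum>b\<in>V. lam (insert v V) (Suc p) (Transposition.transpose v b \<circ> q)) =
      (\<Sum>b\<in>V. \<Sum>S\<in>?A. if b \<in> S then 0 else rsign S q) + (\<Sum>b\<in>V. \<Sum>S\<in>?B. if b \<in> S then - rsign S q else 0)"
      unfolding sum.distrib[symmetric]
    proof (rule sum.cong, goal_cases)
      case (2 b)
      then have b: "b \<in> insert v V" "b \<noteq> v" using V(2) by auto
      show ?case using b(2) by (simp add: lam_insert_transpose[OF V q b(1)])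
    qed simp
    also have "(\<Sum>b\<in>V. \<Sum>S\<in>?A. if b \<in> S then 0 else rsign S q) = (\<Sum>S\<in>?A. \<Sum>b\<in>V. if b \<in> S then 0 else rsign S q)"
      by (rule sum.swap)
    also have "\<dots> = (\<Sum>S\<in>?A. (of_nat (card V) - of_nat (Suc p)) * rsign S q)"
    proof (rule sum.cong, goal_cases)
      case (2 S)
      then have S: "S \<subseteq> V" "card S = Suc p" by auto
      have "(\<Sum>b\<in>V. if b \<in> S then 0 else rsign S q) = (\<Sum>b\<in>V - S. rsign S q)"
        by (rule sum.mono_neutral_cong_right) (use V(1) in auto)
      then show ?case
        using S card_mono[OF V(1) S(1)] finite_subset[OF S(1) V(1)]
        by (simp add: card_Diff_subset of_nat_diff del: of_nat_Suc)
    qed simp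
    also have "\<dots> = (of_nat (card V) - of_nat (Suc p)) * lam V (Suc p) q"
      by (simp add: lam_def sum_distrib_left)
    also have "(\<Sum>b\<in>V. \<Sum>S\<in>?B. if b \<in> S then - rsign S q else 0) = (\<Sum>S\<in>?B. \<Sum>b\<in>V. if b \<in> S then - rsign S q else 0)"
      by (rule sum.swap)
    also have "\<dots> = (\<Sum>S\<in>?B. - of_nat p * rsign S q)"
    proof (rule sum.cong, goal_cases)
      case (2 S)
      then have S: "S \<subseteq> V" "card S = p" by auto
      have "(\<Sum>b\<in>V. if b \<in> S then - rsign S q else 0) = (\<Sum>b\<in>S. - rsign S q)"
        by (rule sum.mono_neutral_cong_right) (use V(1) S in auto)
      then show ?case using S by simp
    qed simp
    also have "\<dots> = - of_nat p * lam V p q"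
      by (simp only: lam_def sum_distrib_left)
    finally show ?thesis by (simp del: comp_apply)
  qed
  have "lam_sum (insert v V) (Suc p) g = (\<Sum>q | q permutes V.
      (sum g Z + (of_nat (card V) - of_nat (Suc p)) * of_nat (card Z)) * (lam V (Suc p) q * weight_sum Z V q g) +
      (sum g Z - of_nat p * of_nat (card Z)) * (lam V p q * weight_sum Z V q g))"
    unfolding lam_sum_insert_eq[OF V]
  proof (rule sum.cong, goal_cases)
    case (2 q)
    then have q: "q permutes V" by simp
    show ?case unfolding 1[OF q] sums[OF q] by (simp add: algebra_simps del: of_nat_Suc)
  qed simp
  then show ?thesis by (simp add: lam_sum_def sum.distrib sum_distrib_left)
qed

text \<open>For \<open>p = 0\<close> this is the rising factorial that enumerates permutations by
  cycles, with \<open>N\<close> the average of \<open>g\<close> over \<open>Z\<close> as cycle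
  variable. The induction starts at singletons because the product has one factor fewer than
  \<open>V\<close> has elements.\<close>

lemma lam_sum_closed:
  fixes V :: "'a set"
  assumes "finite V" "V \<noteq> {}" and g: "sum g Z = of_nat (card Z) * N"
  shows "lam_sum V p g = of_nat (card Z) ^ card V * of_nat (card V choose p) * N * pochhammer (N - of_nat p + 1) (card V - 1)"
  using assms(1,2)
proof (induction V arbitrary: p rule: finite_ne_induct)
  case (singleton v)
  have e: "lam_sum ({} :: 'a set) p g = (if p = 0 then 1 else 0)" for p
    by (auto simp: lam_sum_def lam_0 weight_sum_def cycle_weight_def lam_def cong: conj_cong)
  show ?case
  proof (cases p)
    case 0
    then show ?thesis using lam_sum_insert_0[of "{}" v g] by (simp add: e g)
  next
    case (Suc p')
    then show ?thesis using lam_sum_insert_Suc[of "{}" v p' g] by (cases p') (simp_all add: e g)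
  qed
next
  case (insert v V)
  define m where "m = card V - 1"
  have m: "card V = Suc m" using insert(1,2) by (simp add: m_def card_gt_0_iff)
  have cins: "card (insert v V) = Suc (Suc m)" using insert m by simp
  show ?case
  proof (cases p)
    case 0
    have "pochhammer (N + 1) (Suc m) = pochhammer (N + 1) m * (N + 1 + of_nat m)" by (simp add: pochhammer_Suc)
    then show ?thesis
      unfolding 0 lam_sum_insert_0[OF insert(1,3)] insert.IH g cins m
      by (simp add: algebra_simps)
  next
    case (Suc k)
    \<comment> \<open>Both terms of the recursion contain the same rising factorial, split once at
      its upper and once at its lower end; what remains is Pascal's rule.\<close>
    have p1: "pochhammer (N - of_nat k) (Suc m) = pochhammer (N - of_nat k) m * (N - of_nat k + of_nat m)"
      by (rule pochhammer_Suc)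
    have p2: "pochhammer (N - of_nat k) (Suc m) = (N - of_nat k) * pochhammer (N - of_nat k + 1) m"
      by (rule pochhammer_rec)
    have e: "N - of_nat (Suc k) + 1 = N - of_nat k" by simp
    have "lam_sum (insert v V) p g = of_nat (card Z) ^ Suc (Suc m) * N *
       (of_nat (Suc m choose Suc k) * (pochhammer (N - of_nat k) m * (N - of_nat k + of_nat m)) +
        of_nat (Suc m choose k) * ((N - of_nat k) * pochhammer (N - of_nat k + 1) m))"
      unfolding Suc lam_sum_insert_Suc[OF insert(1,3)] insert.IH g m e
      by (simp add: algebra_simps)
    also have "\<dots> = of_nat (card Z) ^ Suc (Suc m) * N * (of_nat (Suc (Suc m) choose Suc k) * pochhammer (N - of_nat k) (Suc m))"
      unfolding p1[symmetric] p2[symmetric] by (simp add: algebra_simps)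
    finally show ?thesis unfolding cins Suc e by (simp add: mult_ac)
  qed
qed

definition xi_sum :: "'a set \<Rightarrow> nat \<Rightarrow> (complex \<Rightarrow> complex) \<Rightarrow> complex" where
  "xi_sum V p g = (\<Sum>\<sigma> | \<sigma> permutes V. xi V p \<sigma> * weight_sum Z V \<sigma> g)"

text \<open>The factors \<open>N - p + 1, ..., N - p + card V\<close> are \<open>N\<close> plus the
  contents of the boxes of the hook with a column of length \<open>p\<close>, as expected for an
  irreducible character of the symmetric group paired with a power of the number of cycles.\<close>

lemma xi_sum_closed:
  assumes V: "finite V" "V \<noteq> {}" and g: "sum g Z = of_nat (card Z) * N"
  shows "xi_sum V p g = of_nat p * of_nat (card V choose p) * of_nat (card Z) ^ card V * pochhammer (N - of_nat p + 1) (card V)"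
proof (induction p)
  case 0
  then show ?case by (simp add: xi_sum_def xi_0 V)
next
  case (Suc p)
  have "xi_sum V p g + xi_sum V (Suc p) g = of_nat (card V) * lam_sum V p g"
    unfolding xi_sum_def lam_sum_def sum.distrib[symmetric] sum_distrib_left
    by (rule sum.cong) (simp_all add: xi_add[OF V(1), symmetric] mult.assoc[symmetric] distrib_right)
  then have eq: "xi_sum V (Suc p) g = of_nat (card V) * lam_sum V p g - xi_sum V p g" by (simp add: algebra_simps)
  define m where "m = card V - 1"
  have m: "card V = Suc m" using V by (simp add: m_def card_gt_0_iff)
  define K where "K = pochhammer (N - of_nat p + 1) m"
  have p1: "pochhammer (N - of_nat p + 1) (Suc m) = K * (N - of_nat p + 1 + of_nat m)"
    unfolding K_def by (rule pochhammer_Suc)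
  have p2: "pochhammer (N - of_nat p) (Suc m) = (N - of_nat p) * K"
    unfolding K_def by (rule pochhammer_rec)
  have abs: "of_nat (Suc p) * of_nat (Suc m choose Suc p) = (of_nat (Suc m) - of_nat p) * (of_nat (Suc m choose p) :: complex)"
  proof (cases "p \<le> Suc m")
    case True
    have "Suc p * (Suc m choose Suc p) = (Suc m - p) * (Suc m choose p)"
      by (metis Suc_times_binomial_eq binomial_absorb_comp binomial_absorption mult.commute)
    then show ?thesis using True by (metis of_nat_diff of_nat_mult)
  qed (simp add: binomial_eq_0)
  have "xi_sum V (Suc p) g = of_nat (card Z) ^ Suc m * K * of_nat (Suc m choose p) *
      (of_nat (Suc m) * N - of_nat p * (N - of_nat p + 1 + of_nat m))"
    unfolding eq Suc lam_sum_closed[OF V g] m p1 by (simp add: K_def algebra_simps)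
  also have "of_nat (Suc m) * N - of_nat p * (N - of_nat p + 1 + of_nat m) =
      (N - of_nat p) * (of_nat (Suc m) - of_nat p)"
    by (simp add: algebra_simps)
  also have "of_nat (card Z) ^ Suc m * K * of_nat (Suc m choose p) * ((N - of_nat p) * (of_nat (Suc m) - of_nat p)) =
      (of_nat (Suc p) * of_nat (Suc m choose Suc p)) * of_nat (card Z) ^ Suc m * ((N - of_nat p) * K)"
    unfolding abs by (simp only: mult_ac)
  finally show ?case unfolding m p2[symmetric] by simp
qed

end

section \<open>Twisted hook characters of the wreath product\<close>

text \<open>Indexed by columns: the basis vector \<open>b\<close> goes to \<open>u b\<close> times
  the basis vector \<open>\<sigma> b\<close>, so \<open>\<sigma>\<close> and \<open>u\<close> are
  the data used for types and descents.\<close>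

definition gmat :: "nat \<Rightarrow> (nat \<Rightarrow> nat) \<Rightarrow> (nat \<Rightarrow> complex) \<Rightarrow> complex mat" where
  "gmat n \<sigma> u = mat n n (\<lambda>(a, b). if a = \<sigma> b then u b else 0)"

lemma gmat_carrier [simp]: "gmat n \<sigma> u \<in> carrier_mat n n"
  by (simp add: gmat_def)

lemma gmat_index [simp]: "a < n \<Longrightarrow> b < n \<Longrightarrow> gmat n \<sigma> u $$ (a, b) = (if a = \<sigma> b then u b else 0)"
  by (simp add: gmat_def)

lemma gmat_dim [simp]: "dim_row (gmat n \<sigma> u) = n" "dim_col (gmat n \<sigma> u) = n"
  by (simp_all add: gmat_def)

lemma permutes_lessThan: "\<sigma> permutes {..<n} \<Longrightarrow> \<sigma> b < n \<longleftrightarrow> b < n"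
  using permutes_in_image[of \<sigma> "{..<n}" b] by simp

lemma gmat_cong:
  "(\<And>b. b < n \<Longrightarrow> u b = w b) \<Longrightarrow> gmat n \<sigma> u = gmat n \<sigma> w"
  by (rule eq_matI) auto

lemma gmat_mult:
  assumes "\<tau> permutes {..<n}"
  shows "gmat n \<sigma> u * gmat n \<tau> w = gmat n (\<sigma> \<circ> \<tau>) (\<lambda>b. u (\<tau> b) * w b)"
proof (rule eq_matI)
  fix a b assume "a < dim_row (gmat n (\<sigma> \<circ> \<tau>) (\<lambda>b. u (\<tau> b) * w b))"
    "b < dim_col (gmat n (\<sigma> \<circ> \<tau>) (\<lambda>b. u (\<tau> b) * w b))"
  then have ab: "a < n" "b < n" by simp_all
  have \<tau>b: "\<tau> b < n" using permutes_lessThan[OF assms] ab by simp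
  have "(gmat n \<sigma> u * gmat n \<tau> w) $$ (a, b) = (\<Sum>k\<in>{0..<n}. gmat n \<sigma> u $$ (a, k) * gmat n \<tau> w $$ (k, b))"
    using ab by (simp add: scalar_prod_def)
  also have "\<dots> = (\<Sum>k\<in>{0..<n}. if k = \<tau> b then (if a = \<sigma> k then u k else 0) * w b else 0)"
    by (rule sum.cong) (use ab in auto)
  also have "\<dots> = (if a = \<sigma> (\<tau> b) then u (\<tau> b) else 0) * w b"
    using \<tau>b by simp
  finally show "(gmat n \<sigma> u * gmat n \<tau> w) $$ (a, b) = gmat n (\<sigma> \<circ> \<tau>) (\<lambda>b. u (\<tau> b) * w b) $$ (a, b)"
    using ab by simp
qed simp_all

lemma gmat_one: "gmat n id (\<lambda>_. 1) = 1\<^sub>m n"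
  by (rule eq_matI) auto

lemma gmat_eq_iff:
  assumes "\<sigma> permutes {..<n}" "\<tau> permutes {..<n}" "\<And>b. b < n \<Longrightarrow> u b \<noteq> 0"
  shows "gmat n \<sigma> u = gmat n \<tau> w \<longleftrightarrow> \<sigma> = \<tau> \<and> (\<forall>b<n. u b = w b)"
proof
  assume eq: "gmat n \<sigma> u = gmat n \<tau> w"
  have *: "\<sigma> b = \<tau> b \<and> u b = w b" if "b < n" for b
  proof -
    have "\<sigma> b < n" using permutes_lessThan[OF assms(1)] that by simp
    then have "u b = (if \<sigma> b = \<tau> b then w b else 0)"
      using arg_cong[OF eq, of "\<lambda>m. m $$ (\<sigma> b, b)"] that by simp
    then show ?thesis using assms(3)[OF that] by (auto split: if_splits)
  qed
  have "\<sigma> b = \<tau> b" for b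
    using * assms(1,2) by (cases "b < n") (auto simp: permutes_not_in)
  then show "\<sigma> = \<tau> \<and> (\<forall>b<n. u b = w b)" using * by auto
next
  assume "\<sigma> = \<tau> \<and> (\<forall>b<n. u b = w b)"
  then show "gmat n \<sigma> u = gmat n \<tau> w" by (auto intro!: gmat_cong)
qed

lemma gmat_unit_vec:
  assumes "i < n" "\<sigma> permutes {..<n}"
  shows "gmat n \<sigma> u *\<^sub>v unit_vec n i = u i \<cdot>\<^sub>v unit_vec n (\<sigma> i)"
proof (rule eq_vecI)
  fix a assume "a < dim_vec (u i \<cdot>\<^sub>v unit_vec n (\<sigma> i))"
  then have a: "a < n" by simp
  have "\<sigma> i < n" using permutes_lessThan[OF assms(2)] assms(1) by simp
  then show "(gmat n \<sigma> u *\<^sub>v unit_vec n i) $ a = (u i \<cdot>\<^sub>v unit_vec n (\<sigma> i)) $ a"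
    using a assms(1) by (simp add: scalar_prod_right_unit)
qed simp

section \<open>The group in permutation and colour coordinates\<close>

locale wreath =
  fixes r n :: nat and \<zeta> :: complex
  assumes r2: "r \<ge> 2" and n1: "n \<ge> 1" and prim: "primitive_root_of_unity r \<zeta>"
begin

abbreviation "G \<equiv> Grn \<zeta> n"
abbreviation "V \<equiv> {..<n}"

definition Z :: "complex set" where "Z = (\<lambda>k. \<zeta> ^ k) ` {..<r}"

lemma r_pos: "r > 0" and \<zeta>_pow_r: "\<zeta> ^ r = 1"
  and \<zeta>_pow_ne: "0 < k \<Longrightarrow> k < r \<Longrightarrow> \<zeta> ^ k \<noteq> 1"
  using prim by (auto simp: primitive_root_of_unity_def)

lemma \<zeta>_nonzero: "\<zeta> \<noteq> 0"
  using \<zeta>_pow_r r_pos by (auto simp: power_0_left)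

lemma \<zeta>_pow_mod: "\<zeta> ^ (k mod r) = \<zeta> ^ k"
proof -
  have "\<zeta> ^ k = \<zeta> ^ (r * (k div r) + k mod r)" by simp
  also have "\<dots> = \<zeta> ^ (k mod r)" by (simp only: power_add power_mult \<zeta>_pow_r power_one mult_1)
  finally show ?thesis by simp
qed

lemma \<zeta>_pow_eq_iff: "\<zeta> ^ j = \<zeta> ^ k \<longleftrightarrow> j mod r = k mod r"
proof -
  have "j = k" if "j \<le> k" "k < r" "\<zeta> ^ j = \<zeta> ^ k" for j k
  proof (rule ccontr)
    assume "j \<noteq> k"
    have "\<zeta> ^ k = \<zeta> ^ j * \<zeta> ^ (k - j)" unfolding power_add[symmetric] using that by simp
    then have "\<zeta> ^ (k - j) = 1" using that \<zeta>_nonzero by simp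
    then show False using \<zeta>_pow_ne[of "k - j"] that \<open>j \<noteq> k\<close> by simp
  qed
  then have "j mod r = k mod r" if "\<zeta> ^ (j mod r) = \<zeta> ^ (k mod r)"
    using that r_pos by (metis mod_less_divisor nle_le)
  then show ?thesis using \<zeta>_pow_mod by metis
qed

lemma inj_on_\<zeta>_pow: "inj_on (\<lambda>k. \<zeta> ^ k) {..<r}"
  by (rule inj_onI) (simp add: \<zeta>_pow_eq_iff)

lemma card_Z: "card Z = r"
  by (simp add: Z_def card_image[OF inj_on_\<zeta>_pow])

lemma \<zeta>_pow_in_Z: "\<zeta> ^ k \<in> Z"
  using \<zeta>_pow_mod[of k] r_pos unfolding Z_def by (metis imageI lessThan_iff mod_less_divisor)

lemma Z_range: "Z = range (\<lambda>k. \<zeta> ^ k)"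
  using \<zeta>_pow_in_Z by (auto simp: Z_def)

lemma Z_pow_r: "x \<in> Z \<Longrightarrow> x ^ r = 1"
  by (auto simp: Z_def power_mult[symmetric] mult.commute[of _ r]) (simp add: power_mult \<zeta>_pow_r)

lemma inverse_Z: "x \<in> Z \<Longrightarrow> inverse x = x ^ (r - 1)"
proof -
  assume x: "x \<in> Z"
  have "x * x ^ (r - 1) = 1" using Z_pow_r[OF x] r_pos by (metis Suc_diff_1 power_Suc)
  then show ?thesis by (rule inverse_unique)
qed

lemma one_in_Z: "1 \<in> Z"
  using \<zeta>_pow_in_Z[of 0] by simp

sublocale root_group Z
proof
  show "finite Z" by (simp add: Z_def)
  show "x * y \<in> Z" if "x \<in> Z" "y \<in> Z" for x y
    using that by (auto simp: Z_range power_add[symmetric])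
  show "inverse x \<in> Z" if "x \<in> Z" for x
    unfolding inverse_Z[OF that] using that by (auto simp: Z_range power_mult[symmetric])
  show "x \<noteq> 0" if "x \<in> Z" for x
    using that \<zeta>_nonzero by (auto simp: Z_def)
qed

lemma Z_prod: "(\<And>i. i \<in> I \<Longrightarrow> u i \<in> Z) \<Longrightarrow> prod u I \<in> Z"
  by (induction I rule: infinite_finite_induct) (auto intro: Z_mult one_in_Z)

lemma sum_Z_pow: "(\<Sum>\<eta>\<in>Z. \<eta> ^ c) = (if r dvd c then of_nat r else 0)"
proof -
  have "(\<Sum>\<eta>\<in>Z. \<eta> ^ c) = (\<Sum>k<r. (\<zeta> ^ c) ^ k)"
    unfolding Z_def by (simp add: sum.reindex[OF inj_on_\<zeta>_pow] power_mult[symmetric] mult.commute)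
  also have "\<dots> = (if r dvd c then of_nat r else 0)"
  proof (cases "r dvd c")
    case True
    then have "\<zeta> ^ c = 1" using \<zeta>_pow_eq_iff[of c 0] by simp
    then show ?thesis using True by simp
  next
    case False
    then have "\<zeta> ^ c \<noteq> 1" using \<zeta>_pow_eq_iff[of c 0] by (simp add: dvd_eq_mod_eq_0)
    moreover have "(\<zeta> ^ c) ^ r = 1" by (rule Z_pow_r[OF \<zeta>_pow_in_Z])
    ultimately show ?thesis using False by (simp add: geometric_sum)
  qed
  finally show ?thesis .
qed

lemma PiD_Z: "u \<in> V \<rightarrow> Z \<Longrightarrow> b < n \<Longrightarrow> u b \<in> Z"
  by auto

lemma gmat_in_G:
  assumes "\<sigma> permutes V" "u \<in> V \<rightarrow> Z"
  shows "gmat n \<sigma> u \<in> G"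
proof -
  have u: "u b \<noteq> 0" if "b < n" for b using Z_nonzero[OF PiD_Z[OF assms(2) that]] .
  have lt: "\<sigma> b < n \<longleftrightarrow> b < n" for b by (rule permutes_lessThan[OF assms(1)])
  have "\<exists>!j. j < n \<and> gmat n \<sigma> u $$ (i, j) \<noteq> 0" if "i < n" for i
  proof (rule ex1I[of _ "perm_inv \<sigma> i"])
    have "perm_inv \<sigma> i < n" using permutes_lessThan[OF permutes_inv[OF assms(1)]] that by simp
    then show "perm_inv \<sigma> i < n \<and> gmat n \<sigma> u $$ (i, perm_inv \<sigma> i) \<noteq> 0"
      using that u by (simp add: permutes_inverses[OF assms(1)])
    show "j = perm_inv \<sigma> i" if "j < n \<and> gmat n \<sigma> u $$ (i, j) \<noteq> 0" for j
      using that \<open>i < n\<close> by (auto simp: permutes_inverses[OF assms(1)] split: if_splits)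
  qed
  moreover have "\<exists>!i. i < n \<and> gmat n \<sigma> u $$ (i, j) \<noteq> 0" if "j < n" for j
  proof (rule ex1I[of _ "\<sigma> j"])
    show "\<sigma> j < n \<and> gmat n \<sigma> u $$ (\<sigma> j, j) \<noteq> 0" using that u[OF that] lt[of j] by simp
    show "i = \<sigma> j" if "i < n \<and> gmat n \<sigma> u $$ (i, j) \<noteq> 0" for i
      using that \<open>j < n\<close> by (cases "i = \<sigma> j") auto
  qed
  moreover have "gmat n \<sigma> u $$ (i, j) \<in> range (\<lambda>k. \<zeta> ^ k)" if "i < n" "j < n" "gmat n \<sigma> u $$ (i, j) \<noteq> 0" for i j
    using that PiD_Z[OF assms(2), of j] by (auto simp: Z_range split: if_splits)
  ultimately show ?thesis by (simp add: Grn_def)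
qed

lemma G_cases:
  assumes "x \<in> G"
  obtains \<sigma> u where "\<sigma> permutes V" "u \<in> V \<rightarrow>\<^sub>E Z" "x = gmat n \<sigma> u"
proof -
  have x: "x \<in> carrier_mat n n" "\<And>i. i < n \<Longrightarrow> \<exists>!j. j < n \<and> x $$ (i, j) \<noteq> 0"
    "\<And>j. j < n \<Longrightarrow> \<exists>!i. i < n \<and> x $$ (i, j) \<noteq> 0"
    "\<And>i j. i < n \<Longrightarrow> j < n \<Longrightarrow> x $$ (i, j) \<noteq> 0 \<Longrightarrow> x $$ (i, j) \<in> Z"
    using assms by (auto simp: Grn_def Z_range)
  define \<sigma> where "\<sigma> b = (if b < n then THE a. a < n \<and> x $$ (a, b) \<noteq> 0 else b)" for b
  have \<sigma>: "\<sigma> b < n \<and> x $$ (\<sigma> b, b) \<noteq> 0" if "b < n" for b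
    using theI'[OF x(3)[OF that]] that by (simp add: \<sigma>_def)
  have \<sigma>_eq: "a = \<sigma> b" if "b < n" "a < n" "x $$ (a, b) \<noteq> 0" for a b
    using x(3)[OF that(1)] \<sigma>[OF that(1)] that by blast
  have "inj_on \<sigma> V"
  proof (rule inj_onI)
    fix b b' assume b: "b \<in> V" "b' \<in> V" "\<sigma> b = \<sigma> b'"
    then have lt: "b < n" "b' < n" by auto
    have "\<exists>!j. j < n \<and> x $$ (\<sigma> b, j) \<noteq> 0" using x(2) \<sigma>[OF lt(1)] by blast
    moreover have "x $$ (\<sigma> b, b) \<noteq> 0" "x $$ (\<sigma> b, b') \<noteq> 0" using \<sigma>[OF lt(1)] \<sigma>[OF lt(2)] b(3) by simp_all
    ultimately show "b = b'" using lt by blast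
  qed
  moreover have "\<sigma> ` V \<subseteq> V" using \<sigma> by auto
  ultimately have "bij_betw \<sigma> V V"
    by (simp add: bij_betw_def endo_inj_surj)
  then have perm: "\<sigma> permutes V" by (rule bij_imp_permutes) (simp add: \<sigma>_def)
  define u where "u = restrict (\<lambda>b. x $$ (\<sigma> b, b)) V"
  have "u \<in> V \<rightarrow>\<^sub>E Z" using \<sigma> x(4) by (auto simp: u_def)
  moreover have "x = gmat n \<sigma> u"
  proof (rule eq_matI)
    fix a b assume "a < dim_row (gmat n \<sigma> u)" "b < dim_col (gmat n \<sigma> u)"
    then have ab: "a < n" "b < n" by simp_all
    then show "x $$ (a, b) = gmat n \<sigma> u $$ (a, b)"
      using \<sigma>_eq[of b a] by (auto simp: u_def)
  qed (use x(1) in auto)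
  ultimately show ?thesis using that perm by blast
qed

lemma PiE_Z: "u \<in> V \<rightarrow>\<^sub>E Z \<Longrightarrow> b < n \<Longrightarrow> u b \<in> Z"
  by auto

lemma bij_betw_gmat:
  "bij_betw (\<lambda>(\<sigma>, u). gmat n \<sigma> u) ({\<sigma>. \<sigma> permutes V} \<times> (V \<rightarrow>\<^sub>E Z)) G"
  unfolding bij_betw_def
proof
  show "inj_on (\<lambda>(\<sigma>, u). gmat n \<sigma> u) ({\<sigma>. \<sigma> permutes V} \<times> (V \<rightarrow>\<^sub>E Z))"
  proof (rule inj_onI)
    fix s t assume "s \<in> {\<sigma>. \<sigma> permutes V} \<times> (V \<rightarrow>\<^sub>E Z)" "t \<in> {\<sigma>. \<sigma> permutes V} \<times> (V \<rightarrow>\<^sub>E Z)"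
      and eq: "(case s of (\<sigma>, u) \<Rightarrow> gmat n \<sigma> u) = (case t of (\<sigma>, u) \<Rightarrow> gmat n \<sigma> u)"
    then obtain \<sigma> u \<tau> w where st: "s = (\<sigma>, u)" "t = (\<tau>, w)" "\<sigma> permutes V" "\<tau> permutes V" "u \<in> V \<rightarrow>\<^sub>E Z" "w \<in> V \<rightarrow>\<^sub>E Z"
      by auto
    have "\<sigma> = \<tau> \<and> (\<forall>b<n. u b = w b)"
      using gmat_eq_iff[OF st(3,4), of u w] eq st Z_nonzero PiE_Z by simp
    then show "s = t" using st PiE_ext[of u V "\<lambda>_. Z" w] by auto
  qed
  show "(\<lambda>(\<sigma>, u). gmat n \<sigma> u) ` ({\<sigma>. \<sigma> permutes V} \<times> (V \<rightarrow>\<^sub>E Z)) = G"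
    by (auto intro!: gmat_in_G elim!: G_cases)
qed

lemma sum_G: "(\<Sum>x\<in>G. F x) = (\<Sum>\<sigma> | \<sigma> permutes V. \<Sum>u\<in>V \<rightarrow>\<^sub>E Z. F (gmat n \<sigma> u))" for F :: "_ \<Rightarrow> complex"
  by (simp add: sum.reindex_bij_betw[OF bij_betw_gmat, symmetric] sum.cartesian_product case_prod_unfold)

lemma card_G: "card G = r ^ n * fact n"
  using bij_betw_same_card[OF bij_betw_gmat]
  by (simp add: card_cartesian_product card_permutations card_PiE card_Z mult.commute)

lemma finite_G: "finite G"
  using bij_betw_finite[OF bij_betw_gmat] by (simp add: finite_permutations finite_PiE)

lemma sends_to_gmat:
  assumes "\<sigma> permutes V" "i < n" "p < n"
  shows "sends_to \<zeta> n (gmat n \<sigma> u) i e p \<longleftrightarrow> p = \<sigma> i \<and> u i = \<zeta> ^ e"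
proof -
  have "\<sigma> i < n" using permutes_lessThan[OF assms(1)] assms(2) by simp
  have "u i \<cdot>\<^sub>v unit_vec n (\<sigma> i) = (\<zeta> ^ e) \<cdot>\<^sub>v unit_vec n p \<longleftrightarrow> p = \<sigma> i \<and> u i = \<zeta> ^ e"
  proof
    assume "u i \<cdot>\<^sub>v unit_vec n (\<sigma> i) = (\<zeta> ^ e) \<cdot>\<^sub>v unit_vec n p"
    then have "(u i \<cdot>\<^sub>v unit_vec n (\<sigma> i)) $ p = ((\<zeta> ^ e) \<cdot>\<^sub>v unit_vec n p) $ p" by simp
    then have "u i * (if p = \<sigma> i then 1 else 0) = \<zeta> ^ e"
      using assms \<open>\<sigma> i < n\<close> by (simp add: unit_vec_def)
    then show "p = \<sigma> i \<and> u i = \<zeta> ^ e" using \<zeta>_nonzero by (auto split: if_splits)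
  qed simp
  then show ?thesis by (simp add: sends_to_def gmat_unit_vec[OF assms(2,1)])
qed

lemma mperm_gmat:
  assumes "\<sigma> permutes V" "u \<in> V \<rightarrow> Z"
  shows "mperm r \<zeta> n (gmat n \<sigma> u) = \<sigma>"
proof
  fix i
  show "mperm r \<zeta> n (gmat n \<sigma> u) i = \<sigma> i"
  proof (cases "i < n")
    case True
    then have lt: "\<sigma> i < n" using permutes_lessThan[OF assms(1)] by simp
    obtain e where e: "e < r" "u i = \<zeta> ^ e" using PiD_Z[OF assms(2) True] by (auto simp: Z_def)
    have "(THE p. p < n \<and> (\<exists>e<r. sends_to \<zeta> n (gmat n \<sigma> u) i e p)) = \<sigma> i"
      by (rule the_equality) (use sends_to_gmat[OF assms(1) True] lt e in auto)
    then show ?thesis using True by (simp add: mperm_def)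
  next
    case False
    then show ?thesis using assms(1) by (simp add: mperm_def permutes_not_in)
  qed
qed

lemma mexp_gmat:
  assumes "\<sigma> permutes V" "i < n" "u i = \<zeta> ^ e" "e < r"
  shows "mexp r \<zeta> n (gmat n \<sigma> u) i = e"
proof -
  have lt: "\<sigma> i < n" using permutes_lessThan[OF assms(1)] assms(2) by simp
  have "(THE e. e < r \<and> (\<exists>p<n. sends_to \<zeta> n (gmat n \<sigma> u) i e p)) = e"
    by (rule the_equality) (use sends_to_gmat[OF assms(1,2)] lt assms \<zeta>_pow_eq_iff in auto)
  then show ?thesis using assms(2) by (simp add: mexp_def)
qed

lemma cycle_prod_gmat:
  assumes "\<sigma> permutes V" "u \<in> V \<rightarrow> Z" "C \<subseteq> V"
  shows "cycle_prod r \<zeta> n (gmat n \<sigma> u) C = prod u C"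
proof -
  have "(\<Prod>i\<in>C. gmat n \<sigma> u $$ (\<sigma> i, i)) = prod u C"
  proof (rule prod.cong)
    fix i assume "i \<in> C"
    then have "i < n" using assms(3) by auto
    then show "gmat n \<sigma> u $$ (\<sigma> i, i) = u i" using permutes_lessThan[OF assms(1), of i] by simp
  qed simp
  then show ?thesis by (simp add: cycle_prod_def mperm_gmat[OF assms(1,2)])
qed

lemma mtype_gmat:
  assumes "\<sigma> permutes V" "u \<in> V \<rightarrow> Z"
  shows "mtype r \<zeta> n (gmat n \<sigma> u) =
    map (\<lambda>j. image_mset card (mset_set {C \<in> orbit \<sigma> ` V. prod u C = \<zeta> ^ j})) [0..<r]"
proof -
  have "{C \<in> mcycles r \<zeta> n (gmat n \<sigma> u). cycle_prod r \<zeta> n (gmat n \<sigma> u) C = \<zeta> ^ j} =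
      {C \<in> orbit \<sigma> ` V. prod u C = \<zeta> ^ j}" for j
  proof (rule Collect_cong)
    fix C
    show "C \<in> mcycles r \<zeta> n (gmat n \<sigma> u) \<and> cycle_prod r \<zeta> n (gmat n \<sigma> u) C = \<zeta> ^ j \<longleftrightarrow>
      C \<in> orbit \<sigma> ` V \<and> prod u C = \<zeta> ^ j"
    proof (cases "C \<in> orbit \<sigma> ` V")
      case True
      then have "C \<subseteq> V" using orbit_subset_permutes[OF assms(1)] by blast
      then show ?thesis using True cycle_prod_gmat[OF assms]
        by (simp add: mcycles_def mperm_gmat[OF assms])
    next
      case False
      then show ?thesis by (simp add: mcycles_def mperm_gmat[OF assms])
    qed
  qed
  then show ?thesis by (simp add: mtype_def)
qed

lemma ell_gmat:
  assumes "\<sigma> permutes V" "u \<in> V \<rightarrow> Z"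
  shows "ell r \<zeta> n (gmat n \<sigma> u) = card {C \<in> orbit \<sigma> ` V. prod u C = 1}"
  using r_pos by (simp add: ell_def mtype_gmat[OF assms])

text \<open>The linear character \<open>\<delta>\<close>, obtained by taking the product of the
  entries over all of \<open>V\<close> as if it were one cycle.\<close>

definition mdelta :: "complex mat \<Rightarrow> complex" where
  "mdelta x = cycle_prod r \<zeta> n x V"

lemma mdelta_gmat:
  assumes "\<sigma> permutes V" "u \<in> V \<rightarrow> Z"
  shows "mdelta (gmat n \<sigma> u) = prod u V"
  unfolding mdelta_def by (rule cycle_prod_gmat[OF assms]) auto

lemma prod_orbits:
  assumes "\<sigma> permutes V"
  shows "(\<Prod>C\<in>orbit \<sigma> ` V. prod u C) = prod (u :: nat \<Rightarrow> complex) V"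
proof -
  have fin: "finite V" by simp
  have disj: "C \<inter> D = {}" if "C \<in> orbit \<sigma> ` V" "D \<in> orbit \<sigma> ` V" "C \<noteq> D" for C D
  proof (rule ccontr)
    assume "C \<inter> D \<noteq> {}"
    then obtain y where y: "y \<in> C" "y \<in> D" by blast
    have "orbit \<sigma> y = E" if "E \<in> orbit \<sigma> ` V" "y \<in> E" for E
      using that orbit_cyclic_eq3[OF cyclic_on_orbit[OF assms fin]] by blast
    then show False using that y by blast
  qed
  have un: "\<Union> (orbit \<sigma> ` V) = V"
    using orbit_subset_permutes[OF assms] permutes_self_in_orbit[OF fin assms] by blast
  have "prod u (\<Union> (orbit \<sigma> ` V)) = (\<Prod>C\<in>orbit \<sigma> ` V. prod u C)"
    unfolding comp_def[symmetric]
    by (subst prod.Union_disjoint) (use disj orbit_subset_permutes[OF assms] finite_subset[OF _ fin] in \<open>auto simp: comp_def\<close>)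
  then show ?thesis by (simp add: un)
qed

end

section \<open>Class functions and Schur's lemma for the twisted characters\<close>

lemma orbit_conj:
  assumes "finite V" "g permutes V" "\<sigma> permutes V"
  shows "orbit (g \<circ> \<sigma> \<circ> perm_inv g) (g a) = g ` orbit \<sigma> a"
  by (rule orbit_inverse[symmetric])
     (simp_all add: permutes_self_in_orbit[OF assms(1,3)] permutes_inverses[OF assms(2)])

context wreath
begin

text \<open>Conjugation by a permutation matrix carries cycles to cycles with equal products. This
  suffices to see that a class function, once its colours are summed out, is a class function on the
  symmetric group.\<close>

lemma mtype_conj:
  assumes g: "g permutes V" and \<sigma>: "\<sigma> permutes V" and u: "u \<in> V \<rightarrow> Z"
  shows "mtype r \<zeta> n (gmat n (g \<circ> \<sigma> \<circ> perm_inv g) (u \<circ> perm_inv g)) = mtype r \<zeta> n (gmat n \<sigma> u)"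
proof -
  note gi = permutes_inverses[OF g]
  have inj: "inj_on g C" for C using permutes_inj_on[OF g] .
  have conj: "g \<circ> \<sigma> \<circ> perm_inv g permutes V" using g \<sigma> by (intro permutes_compose permutes_inv)
  have u': "u \<circ> perm_inv g \<in> V \<rightarrow> Z"
    using u permutes_lessThan[OF permutes_inv[OF g]] by auto
  have orbs: "orbit (g \<circ> \<sigma> \<circ> perm_inv g) ` V = (`) g ` (orbit \<sigma> ` V)"
  proof -
    have "orbit (g \<circ> \<sigma> \<circ> perm_inv g) ` V = orbit (g \<circ> \<sigma> \<circ> perm_inv g) ` g ` V"
      by (simp only: permutes_image[OF g])
    also have "\<dots> = (`) g ` (orbit \<sigma> ` V)"
      unfolding image_image by (rule image_cong) (simp_all only: orbit_conj[OF finite_lessThan g \<sigma>])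
    finally show ?thesis .
  qed
  have prod: "prod (u \<circ> perm_inv g) (g ` C) = prod u C" for C
    by (simp add: prod.reindex[OF inj] gi)
  have "{C \<in> orbit (g \<circ> \<sigma> \<circ> perm_inv g) ` V. prod (u \<circ> perm_inv g) C = \<zeta> ^ j} =
      (`) g ` {C \<in> orbit \<sigma> ` V. prod u C = \<zeta> ^ j}" for j
    unfolding orbs using prod by (auto simp del: comp_apply)
  moreover have "image_mset card (mset_set ((`) g ` A)) = image_mset card (mset_set A)" for A :: "nat set set"
  proof -
    have "inj_on ((`) g) A" by (rule inj_onI) (simp add: inj_image_eq_iff[OF permutes_inj[OF g]])
    then have "mset_set ((`) g ` A) = image_mset ((`) g) (mset_set A)" by (rule image_mset_mset_set[symmetric])
    then show ?thesis by (simp add: multiset.map_comp comp_def card_image[OF inj])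
  qed
  ultimately show ?thesis
    unfolding mtype_gmat[OF conj u'] mtype_gmat[OF \<sigma> u] by simp
qed

text \<open>Constancy on types takes the place of invariance under conjugation; indicators of
  classes and functions of \<open>ell\<close> then qualify by definition.\<close>

definition class_fun :: "(complex mat \<Rightarrow> complex) \<Rightarrow> bool" where
  "class_fun f \<longleftrightarrow> (\<forall>x\<in>G. \<forall>y\<in>G. mtype r \<zeta> n x = mtype r \<zeta> n y \<longrightarrow> f x = f y)"

definition Psi :: "nat \<Rightarrow> nat \<Rightarrow> complex mat \<Rightarrow> complex" where
  "Psi c p x = mdelta x ^ c * xi V p (mperm r \<zeta> n x)"

lemma Psi_gmat:
  assumes "\<sigma> permutes V" "u \<in> V \<rightarrow> Z"
  shows "Psi c p (gmat n \<sigma> u) = prod u V ^ c * xi V p \<sigma>"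
  by (simp add: Psi_def mdelta_gmat[OF assms] mperm_gmat[OF assms])

lemma G_mult:
  assumes "x \<in> G" "y \<in> G"
  shows "x * y \<in> G"
proof -
  obtain \<sigma> u \<tau> w where *: "\<sigma> permutes V" "u \<in> V \<rightarrow>\<^sub>E Z" "x = gmat n \<sigma> u" "\<tau> permutes V" "w \<in> V \<rightarrow>\<^sub>E Z" "y = gmat n \<tau> w"
    using assms G_cases by metis
  have "(\<lambda>b. u (\<tau> b) * w b) \<in> V \<rightarrow> Z"
    using * permutes_lessThan[OF *(4)] by (auto intro!: Z_mult)
  then show ?thesis
    unfolding * gmat_mult[OF *(4)] using * by (intro gmat_in_G permutes_compose)
qed

lemma G_carrier: "x \<in> G \<Longrightarrow> x \<in> carrier_mat n n"
  by (simp add: Grn_def)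

lemma G_one: "1\<^sub>m n \<in> G"
  unfolding gmat_one[symmetric] by (intro gmat_in_G permutes_id) (simp add: one_in_Z)

text \<open>The exponent \<open>(r - 1) * c\<close> is \<open>- c\<close> modulo \<open>r\<close> in
  natural numbers: inversion conjugates the twist and leaves the hook character unchanged.\<close>

lemma G_inverse:
  assumes "y \<in> G"
  obtains y' where "y' \<in> G" "y * y' = 1\<^sub>m n" "y' * y = 1\<^sub>m n" "\<And>c p. Psi c p y' = Psi ((r - 1) * c) p y"
proof -
  obtain \<tau> w where *: "\<tau> permutes V" "w \<in> V \<rightarrow>\<^sub>E Z" "y = gmat n \<tau> w" using assms G_cases by metis
  have w: "w \<in> V \<rightarrow> Z" using * by auto
  note inv = permutes_inv[OF *(1)]
  define w' where "w' b = inverse (w (perm_inv \<tau> b))" for b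
  have w': "w' \<in> V \<rightarrow> Z"
    using w permutes_lessThan[OF inv] by (auto simp: w'_def intro!: Z_inverse)
  define y' where "y' = gmat n (perm_inv \<tau>) w'"
  have 1: "y' \<in> G" unfolding y'_def by (intro gmat_in_G inv w')
  have 2: "y * y' = 1\<^sub>m n"
    unfolding * y'_def gmat_mult[OF inv] permutes_inv_o[OF *(1)] gmat_one[symmetric]
    using PiD_Z[OF w] permutes_lessThan[OF inv] Z_nonzero by (intro gmat_cong) (simp add: w'_def)
  have 3: "y' * y = 1\<^sub>m n"
    unfolding * y'_def gmat_mult[OF *(1)] permutes_inv_o[OF *(1)] gmat_one[symmetric]
    using PiD_Z[OF w] Z_nonzero by (intro gmat_cong) (simp add: w'_def permutes_inverses[OF *(1)])
  have 4: "Psi c p y' = Psi ((r - 1) * c) p y" for c p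
  proof -
    have "prod w' V = (\<Prod>b\<in>V. inverse (w b))"
      unfolding w'_def by (rule prod.permute[OF inv, of "\<lambda>b. inverse (w b)", unfolded comp_def, symmetric])
    also have "\<dots> = inverse (prod w V)" by (induction n) simp_all
    also have "\<dots> = prod w V ^ (r - 1)" by (rule inverse_Z[OF Z_prod]) (use w in auto)
    finally show ?thesis
      unfolding y'_def * Psi_gmat[OF inv w'] Psi_gmat[OF *(1) w]
      by (simp only: power_mult xi_inverse[OF finite_lessThan *(1)])
  qed
  show ?thesis by (rule that[OF 1 2 3 4])
qed

text \<open>Since \<open>\<delta>\<close> is multiplicative, the colours of \<open>y\<close> come
  out as a factor, and the colours of \<open>x\<close> can be summed first. The resulting function
  \<open>fc\<close> of the underlying permutation is a class function, to which
  \<open>xi_schur\<close> applies.\<close>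

lemma Psi_schur:
  assumes f: "class_fun f" and p: "p > 0" and y: "y \<in> G"
  shows "(\<Sum>x\<in>G. f x * Psi c p (x * y)) * of_nat (p * (n choose p)) = (\<Sum>x\<in>G. f x * Psi c p x) * Psi c p y"
proof -
  obtain \<tau> w where y: "\<tau> permutes V" "w \<in> V \<rightarrow>\<^sub>E Z" "y = gmat n \<tau> w" using y G_cases by metis
  have w: "w \<in> V \<rightarrow> Z" using y by auto
  define fc where "fc \<sigma> = (\<Sum>u\<in>V \<rightarrow>\<^sub>E Z. f (gmat n \<sigma> u) * prod u V ^ c)" for \<sigma>
  have fc: "fc (g \<circ> \<sigma> \<circ> perm_inv g) = fc \<sigma>" if g: "g permutes V" and \<sigma>: "\<sigma> permutes V" for g \<sigma>
  proof -
    note gi = permutes_inverses[OF g]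
    have PE: "u \<circ> h \<in> V \<rightarrow>\<^sub>E Z" if "u \<in> V \<rightarrow>\<^sub>E Z" "h permutes V" for u h
      using that permutes_lessThan[OF that(2)] permutes_not_in[OF that(2)] by (auto simp: PiE_iff extensional_def)
    show ?thesis unfolding fc_def
    proof (rule sum.reindex_bij_witness[of _ "\<lambda>u. u \<circ> perm_inv g" "\<lambda>u. u \<circ> g"], goal_cases)
      case (5 u)
      define u0 where "u0 = u \<circ> g"
      have u0: "u0 \<in> V \<rightarrow>\<^sub>E Z" and u_eq: "u = u0 \<circ> perm_inv g"
        using PE[OF 5 g] by (simp_all add: u0_def fun_eq_iff gi)
      have u0Z: "u0 \<in> V \<rightarrow> Z" using u0 by auto
      have conj: "g \<circ> \<sigma> \<circ> perm_inv g permutes V" using g \<sigma> by (intro permutes_compose permutes_inv)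
      have uZ: "u \<in> V \<rightarrow> Z" using 5 by auto
      have "f (gmat n (g \<circ> \<sigma> \<circ> perm_inv g) u) = f (gmat n \<sigma> u0)"
        using f mtype_conj[OF g \<sigma> u0Z] gmat_in_G[OF conj uZ] gmat_in_G[OF \<sigma> u0Z]
        unfolding class_fun_def u_eq by blast
      moreover have "prod u0 V = prod u V"
        unfolding u0_def by (rule prod.permute[OF g, symmetric])
      ultimately show ?case by (simp add: u0_def)
    qed (use PE g permutes_inv[OF g] in \<open>auto simp: fun_eq_iff gi simp del: PiE_iff\<close>)
  qed
  have L: "(\<Sum>x\<in>G. f x * Psi c p (x * y)) = prod w V ^ c * (\<Sum>\<sigma> | \<sigma> permutes V. fc \<sigma> * xi V p (\<sigma> \<circ> \<tau>))"
    unfolding sum_G fc_def sum_distrib_left sum_distrib_right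
  proof (intro sum.cong refl)
    fix \<sigma> u assume "\<sigma> \<in> {\<sigma>. \<sigma> permutes V}" and uP: "u \<in> V \<rightarrow>\<^sub>E Z"
    then have \<sigma>: "\<sigma> permutes V" by simp
    have u: "u \<in> V \<rightarrow> Z" using uP by auto
    have st: "\<sigma> \<circ> \<tau> permutes V" using \<sigma> y(1) by (intro permutes_compose)
    have uw: "(\<lambda>b. u (\<tau> b) * w b) \<in> V \<rightarrow> Z"
      using u w permutes_lessThan[OF y(1)] by (auto intro!: Z_mult)
    have "prod (\<lambda>b. u (\<tau> b) * w b) V = prod u V * prod w V"
      by (simp add: prod.distrib prod.permute[OF y(1), of u, symmetric, unfolded comp_def])
    then show "f (gmat n \<sigma> u) * Psi c p (gmat n \<sigma> u * y) =
        prod w V ^ c * (f (gmat n \<sigma> u) * prod u V ^ c * xi V p (\<sigma> \<circ> \<tau>))"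
      unfolding y(3) gmat_mult[OF y(1)] Psi_gmat[OF st uw] by (simp add: power_mult_distrib mult_ac)
  qed
  have R: "(\<Sum>x\<in>G. f x * Psi c p x) = (\<Sum>\<sigma> | \<sigma> permutes V. fc \<sigma> * xi V p \<sigma>)"
    unfolding sum_G fc_def sum_distrib_right
  proof (intro sum.cong refl)
    fix \<sigma> u assume "\<sigma> \<in> {\<sigma>. \<sigma> permutes V}" and uP: "u \<in> V \<rightarrow>\<^sub>E Z"
    then have \<sigma>: "\<sigma> permutes V" by simp
    have u: "u \<in> V \<rightarrow> Z" using uP by auto
    show "f (gmat n \<sigma> u) * Psi c p (gmat n \<sigma> u) = f (gmat n \<sigma> u) * prod u V ^ c * xi V p \<sigma>"
      unfolding Psi_gmat[OF \<sigma> u] by simp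
  qed
  have key: "(\<Sum>\<sigma> | \<sigma> permutes V. fc \<sigma> * xi V p (\<sigma> \<circ> \<tau>)) * of_nat (p * (n choose p)) =
      (\<Sum>\<sigma> | \<sigma> permutes V. fc \<sigma> * xi V p \<sigma>) * xi V p \<tau>"
    using xi_schur[where f = fc, OF finite_lessThan p y(1)] fc by simp
  have "Psi c p y = prod w V ^ c * xi V p \<tau>"
    unfolding y(3) by (rule Psi_gmat[OF y(1) w])
  then show ?thesis unfolding L R mult.assoc key by (simp add: mult_ac)
qed

text \<open>The summand is \<open>xi\<close> times a cycle weight, so \<open>xi_sum_closed\<close>
  applies with the average of \<open>g\<close> as \<open>N\<close>. A nontrivial twist sums to 0
  over \<open>Z\<close> and gives \<open>N = m\<close>; the trivial one sums to \<open>r\<close> and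
  gives \<open>N = m + 1\<close>. This is the origin of the shift.\<close>

lemma sum_pow_ell_Psi:
  "(\<Sum>x\<in>G. of_nat (r * m + 1) ^ ell r \<zeta> n x * Psi c p x) =
    of_nat (p * (n choose p) * r ^ n) * pochhammer (of_nat (m + (if r dvd c then 1 else 0)) - of_nat p + 1) n"
proof -
  define b :: complex where "b = of_nat (r * m + 1)"
  \<comment> \<open>The factor in front marks the cycles with product 1 for \<open>ell\<close>; the
    power of \<open>\<eta>\<close> accounts for the twist.\<close>
  define g where "g \<eta> = (if \<eta> = 1 then b else 1) * \<eta> ^ c" for \<eta> :: complex
  have "sum g Z = g 1 + sum g (Z - {1})" by (rule sum.remove[OF finite_Z one_in_Z])
  also have "sum g (Z - {1}) = (\<Sum>\<eta>\<in>Z - {1}. \<eta> ^ c)" by (rule sum.cong) (auto simp: g_def)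
  also have "\<dots> = (\<Sum>\<eta>\<in>Z. \<eta> ^ c) - 1" by (simp add: sum.remove[OF finite_Z one_in_Z, of "\<lambda>\<eta>. \<eta> ^ c"])
  also have "g 1 + ((\<Sum>\<eta>\<in>Z. \<eta> ^ c) - 1) = of_nat (card Z) * of_nat (m + (if r dvd c then 1 else 0))"
    by (simp add: sum_Z_pow g_def b_def card_Z algebra_simps)
  finally have gZ: "sum g Z = of_nat (card Z) * of_nat (m + (if r dvd c then 1 else 0))" .
  have "(\<Sum>x\<in>G. b ^ ell r \<zeta> n x * Psi c p x) = xi_sum V p g"
    unfolding sum_G xi_sum_def weight_sum_def sum_distrib_left
  proof (intro sum.cong refl)
    fix \<sigma> u assume "\<sigma> \<in> {\<sigma>. \<sigma> permutes V}" and uP: "u \<in> V \<rightarrow>\<^sub>E Z"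
    then have \<sigma>: "\<sigma> permutes V" by simp
    have u: "u \<in> V \<rightarrow> Z" using uP by auto
    have "b ^ ell r \<zeta> n (gmat n \<sigma> u) = (\<Prod>C\<in>{C \<in> orbit \<sigma> ` V. prod u C = 1}. b)"
      by (simp add: ell_gmat[OF \<sigma> u])
    also have "\<dots> = (\<Prod>C\<in>orbit \<sigma> ` V. if prod u C = 1 then b else 1)"
      by (rule prod.mono_neutral_cong_left) auto
    finally have "b ^ ell r \<zeta> n (gmat n \<sigma> u) * prod u V ^ c = cycle_weight V \<sigma> u g"
      by (simp add: cycle_weight_def g_def prod.distrib prod_power_distrib[symmetric] prod_orbits[OF \<sigma>])
    then show "b ^ ell r \<zeta> n (gmat n \<sigma> u) * Psi c p (gmat n \<sigma> u) = xi V p \<sigma> * cycle_weight V \<sigma> u g"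
      unfolding Psi_gmat[OF \<sigma> u] by (simp add: mult_ac)
  qed
  moreover have "V \<noteq> {}" using n1 by (simp add: lessThan_empty_iff)
  ultimately show ?thesis
    by (simp add: b_def xi_sum_closed[OF finite_lessThan _ gZ] card_Z)
qed

end

section \<open>The classes of full and nearly full cycles\<close>

lemma exists_full_cycle:
  assumes "finite V" "V \<noteq> {}"
  obtains \<sigma> where "\<sigma> permutes V" "orbit \<sigma> ` V = {V}"
proof -
  have "\<exists>\<sigma>. \<sigma> permutes V \<and> (\<forall>x\<in>V. orbit \<sigma> x = V)"
    using assms
  proof (induction V rule: finite_ne_induct)
    case (singleton v)
    have "orbit id v = {v}" by (simp add: orbit_eq_singleton_iff)
    then show ?case using permutes_id by auto
  next
    case (insert v V)
    then obtain q i where q: "q permutes V" "\<And>x. x \<in> V \<Longrightarrow> orbit q x = V" and i: "i \<in> V" by blast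
    let ?\<sigma> = "Transposition.transpose v (q i) \<circ> q"
    have perm: "?\<sigma> permutes insert v V"
      using i permutes_in_image[OF q(1)] permutes_imp_permutes_insert[OF q(1)]
      by (intro permutes_compose permutes_swap_id) auto
    have orb: "orbit ?\<sigma> x = insert v V" if "x \<in> V" for x
      using orbit_insert_transpose[OF insert(1,3) q(1) i that] q(2)[OF that] i by simp
    have "v \<in> orbit ?\<sigma> i" using orb[OF i] by simp
    then have "orbit ?\<sigma> v = orbit ?\<sigma> i"
      using orbit_cyclic_eq3[OF cyclic_on_orbit[OF perm]] insert(1) by blast
    then show ?case using perm orb i by blast
  qed
  then show ?thesis using that assms by (metis (no_types, lifting) image_cong image_constant_conv)
qed

lemma mset_set_card_single:
  assumes "finite A" "image_mset card (mset_set A) = {#k#}"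
  obtains C where "A = {C}" "card C = k"
proof -
  have "card A = 1" using arg_cong[OF assms(2), of size] by simp
  then obtain C where "A = {C}" by (auto simp: card_1_singleton_iff)
  then show ?thesis using that[of C] assms(2) by simp
qed

lemma mset_set_card_double:
  assumes "finite A" "image_mset card (mset_set A) = {#k, l#}"
  obtains C D where "A = {C, D}" "C \<noteq> D" "card C = k" "card D = l"
proof -
  have "card A = 2" using arg_cong[OF assms(2), of size] by simp
  then obtain C D where CD: "A = {C, D}" "C \<noteq> D" by (auto simp: card_2_iff)
  then have "{#card C, card D#} = {#k, l#}" using assms(2) by simp
  then have "card C = k \<and> card D = l \<or> card C = l \<and> card D = k" by (auto simp: add_mset_eq_single add_eq_conv_ex)
  then show ?thesis using that[of C D] that[of D C] CD by (auto simp: insert_commute)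
qed

context wreath
begin

definition orbs :: "(nat \<Rightarrow> nat) \<Rightarrow> nat set set" where
  "orbs \<sigma> = orbit \<sigma> ` V"

lemma finite_orbs [simp]: "finite (orbs \<sigma>)"
  by (simp add: orbs_def)

lemma type01_nth:
  "type01 r a b ! 0 = a" "type01 r a b ! Suc 0 = b" "2 \<le> j \<Longrightarrow> j < r \<Longrightarrow> type01 r a b ! j = {#}"
proof -
  show "type01 r a b ! j = {#}" if "2 \<le> j" "j < r"
  proof -
    have "j = Suc (Suc (j - 2))" using \<open>2 \<le> j\<close> by simp
    then obtain k where "j = Suc (Suc k)" ..
    then show ?thesis using \<open>j < r\<close> by (simp add: type01_def)
  qed
qed (simp_all add: type01_def)

lemma length_type01: "length (type01 r a b) = r"
  using r2 by (simp add: type01_def)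

lemma Kclass_gmat_iff:
  assumes "\<sigma> permutes V" "u \<in> V \<rightarrow> Z"
  shows "gmat n \<sigma> u \<in> Kclass r \<zeta> n (type01 r a b) \<longleftrightarrow>
    (\<forall>j<r. image_mset card (mset_set {C \<in> orbs \<sigma>. prod u C = \<zeta> ^ j}) = type01 r a b ! j)"
proof -
  have "mtype r \<zeta> n (gmat n \<sigma> u) = type01 r a b \<longleftrightarrow>
    (\<forall>j<r. image_mset card (mset_set {C \<in> orbs \<sigma>. prod u C = \<zeta> ^ j}) = type01 r a b ! j)"
    unfolding mtype_gmat[OF assms] list_eq_iff_nth_eq by (simp add: length_type01 orbs_def)
  then show ?thesis using gmat_in_G[OF assms] by (simp add: Kclass_def)
qed

text \<open>Only the cycle lengths of the permutation and the total product are kept, since these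
  determine \<open>Psi\<close>. The product is \<open>\<zeta>\<close> to the number of cycles of
  colour 1, as all others have colour 0.\<close>

lemma Kclass_type01_cases:
  assumes "x \<in> Kclass r \<zeta> n (type01 r a b)"
  obtains \<sigma> u where "\<sigma> permutes V" "u \<in> V \<rightarrow> Z" "x = gmat n \<sigma> u"
    "image_mset card (mset_set (orbs \<sigma>)) = a + b" "prod u V = \<zeta> ^ size b"
proof -
  have "x \<in> G" using assms by (simp add: Kclass_def)
  then obtain \<sigma> u where *: "\<sigma> permutes V" "u \<in> V \<rightarrow>\<^sub>E Z" "x = gmat n \<sigma> u" using G_cases by metis
  then have u: "u \<in> V \<rightarrow> Z" by auto
  define M where "M j = {C \<in> orbs \<sigma>. prod u C = \<zeta> ^ j}" for j
  have fM: "finite (M j)" for j by (simp add: M_def)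
  have M: "image_mset card (mset_set (M j)) = type01 r a b ! j" if "j < r" for j
    using assms that unfolding *(3) Kclass_gmat_iff[OF *(1) u] M_def by blast
  have M2: "M j = {}" if "2 \<le> j" "j < r" for j
    using M[OF that(2)] type01_nth(3)[OF that] fM by (simp add: mset_set_empty_iff)
  have M01: "M 0 \<inter> M 1 = {}"
  proof -
    have "\<zeta> ^ 0 \<noteq> \<zeta> ^ 1" using \<zeta>_pow_eq_iff[of 0 1] r2 by simp
    then show ?thesis by (auto simp: M_def)
  qed
  have un: "orbs \<sigma> = M 0 \<union> M 1"
  proof
    show "orbs \<sigma> \<subseteq> M 0 \<union> M 1"
    proof
      fix C assume C: "C \<in> orbs \<sigma>"
      then have "C \<subseteq> V" using orbit_subset_permutes[OF *(1)] by (auto simp: orbs_def)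
      then have "prod u C \<in> Z" using u by (intro Z_prod) auto
      then obtain j where j: "j < r" "prod u C = \<zeta> ^ j" by (auto simp: Z_def)
      then have "C \<in> M j" using C by (simp add: M_def)
      moreover have "\<not> 2 \<le> j" using M2[of j] j calculation by blast
      then have "j = 0 \<or> j = 1" by linarith
      ultimately show "C \<in> M 0 \<union> M 1" by blast
    qed
  qed (auto simp: M_def)
  have 1: "image_mset card (mset_set (orbs \<sigma>)) = a + b"
    unfolding un mset_set_Union[OF fM fM M01] using M[of 0] M[of 1] r2 by (simp add: type01_nth)
  have "card (M 1) = size b"
    using arg_cong[OF M[of 1], of size] r2 by (simp add: type01_nth)
  have "prod u V = (\<Prod>C\<in>orbs \<sigma>. prod u C)" unfolding orbs_def by (rule prod_orbits[OF *(1), symmetric])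
  also have "\<dots> = (\<Prod>C\<in>M 0. prod u C) * (\<Prod>C\<in>M 1. prod u C)"
    unfolding un by (rule prod.union_disjoint[OF fM fM M01])
  also have "(\<Prod>C\<in>M 0. prod u C) = 1" by (rule prod.neutral) (simp add: M_def)
  also have "(\<Prod>C\<in>M 1. prod u C) = (\<Prod>C\<in>M 1. \<zeta>)" by (rule prod.cong) (simp_all add: M_def)
  finally have 2: "prod u V = \<zeta> ^ size b" using \<open>card (M 1) = size b\<close> by simp
  show ?thesis by (rule that[OF *(1) u *(3) 1 2])
qed

lemma orbs_full:
  assumes "\<sigma> permutes V" "image_mset card (mset_set (orbs \<sigma>)) = {#n#}"
  shows "orbs \<sigma> = {V}"
proof -
  obtain C where C: "orbs \<sigma> = {C}" "card C = n" using mset_set_card_single[OF _ assms(2)] by auto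
  then have "C \<in> orbit \<sigma> ` V" by (simp add: orbs_def)
  then have "C \<subseteq> V" using orbit_subset_permutes[OF assms(1)] by blast
  then have "C = V" using C(2) card_subset_eq[of V C] by simp
  then show ?thesis using C by simp
qed

lemma Kclass_full_iff:
  assumes "\<sigma> permutes V" "u \<in> V \<rightarrow> Z"
  shows "gmat n \<sigma> u \<in> Kclass r \<zeta> n (type01 r {#n#} {#}) \<longleftrightarrow> orbs \<sigma> = {V} \<and> prod u V = 1"
proof
  assume A: "gmat n \<sigma> u \<in> Kclass r \<zeta> n (type01 r {#n#} {#})"
  show "orbs \<sigma> = {V} \<and> prod u V = 1"
  proof (rule Kclass_type01_cases[OF A])
    fix \<sigma>' u' assume *: "\<sigma>' permutes V" "u' \<in> V \<rightarrow> Z" "gmat n \<sigma> u = gmat n \<sigma>' u'"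
      "image_mset card (mset_set (orbs \<sigma>')) = {#n#} + {#}" "prod u' V = \<zeta> ^ size ({#} :: nat multiset)"
    have eq: "\<sigma> = \<sigma>'" "\<forall>b<n. u b = u' b"
      using gmat_eq_iff[OF assms(1) *(1), of u u'] *(3) Z_nonzero PiD_Z[OF assms(2)] by auto
    have "prod u V = prod u' V" by (rule prod.cong) (use eq in auto)
    then show ?thesis using orbs_full[OF *(1)] * eq by simp
  qed
next
  assume *: "orbs \<sigma> = {V} \<and> prod u V = 1"
  have "image_mset card (mset_set {C \<in> orbs \<sigma>. prod u C = \<zeta> ^ j}) = type01 r {#n#} {#} ! j" if "j < r" for j
  proof (cases "j = 0")
    case True
    then have "{C \<in> orbs \<sigma>. prod u C = \<zeta> ^ j} = {V}" using * by auto
    then show ?thesis using True by (simp add: type01_nth)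
  next
    case False
    then have "\<zeta> ^ j \<noteq> 1" using \<zeta>_pow_ne that by simp
    then have "{C \<in> orbs \<sigma>. prod u C = \<zeta> ^ j} = {}" using * by auto
    moreover have "type01 r {#n#} {#} ! j = {#}"
      using type01_nth(2)[of "{#n#}" "{#}"] type01_nth(3)[of j "{#n#}" "{#}"] False that
      by (cases "j = Suc 0") auto
    ultimately show ?thesis by (simp only: mset_set.empty image_mset_empty)
  qed
  then show "gmat n \<sigma> u \<in> Kclass r \<zeta> n (type01 r {#n#} {#})" unfolding Kclass_gmat_iff[OF assms] by blast
qed

text \<open>The sum over the twists detects product 1 and contributes \<open>r\<close>; the
  alternating sum over the hooks detects n-cycles and contributes the square of
  \<open>n\<close>.\<close>

lemma Psi_alternating_sum:
  assumes "x \<in> G"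
  shows "(\<Sum>c<r. \<Sum>p=1..n. (-1) ^ (p - 1) * Psi c p x) =
    (if x \<in> Kclass r \<zeta> n (type01 r {#n#} {#}) then of_nat (r * n\<^sup>2) else 0)"
proof -
  obtain \<sigma> u where *: "\<sigma> permutes V" "u \<in> V \<rightarrow>\<^sub>E Z" "x = gmat n \<sigma> u" using assms G_cases by metis
  then have u: "u \<in> V \<rightarrow> Z" by auto
  have V: "V \<noteq> {}" using n1 by (simp add: lessThan_empty_iff)
  have "prod u V \<in> Z" using u by (intro Z_prod) auto
  then have c: "(\<Sum>c<r. prod u V ^ c) = (if prod u V = 1 then of_nat r else 0)"
    using Z_pow_r by (simp add: geometric_sum)
  have "(\<Sum>c<r. \<Sum>p=1..n. (-1) ^ (p - 1) * Psi c p x) =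
      (\<Sum>c<r. \<Sum>p=1..n. prod u V ^ c * ((-1) ^ (p - 1) * xi V p \<sigma>))"
    unfolding *(3) Psi_gmat[OF *(1) u] by (simp only: mult.left_commute)
  also have "\<dots> = (\<Sum>c<r. prod u V ^ c) * (\<Sum>p=1..n. (-1) ^ (p - 1) * xi V p \<sigma>)"
    by (simp only: sum_product)
  also have "\<dots> = (if x \<in> Kclass r \<zeta> n (type01 r {#n#} {#}) then of_nat (r * n\<^sup>2) else 0)"
    using xi_alternating_sum[OF finite_lessThan *(1) V]
    unfolding c *(3) Kclass_full_iff[OF *(1) u] by (simp add: orbs_def)
  finally show ?thesis .
qed

lemma Psi_full:
  assumes "x \<in> Kclass r \<zeta> n (type01 r a b)" "a + b = {#n#}" "1 \<le> p" "p \<le> n"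
  shows "Psi c p x = (\<zeta> ^ size b) ^ c * ((-1) ^ (p - 1) * of_nat n)"
proof -
  obtain \<sigma> u where *: "\<sigma> permutes V" "u \<in> V \<rightarrow> Z" "x = gmat n \<sigma> u"
    "image_mset card (mset_set (orbs \<sigma>)) = a + b" "prod u V = \<zeta> ^ size b"
    using assms(1) by (rule Kclass_type01_cases)
  have "orbit \<sigma> ` V = {V}" using orbs_full[OF *(1)] *(4) assms(2) by (simp add: orbs_def)
  then show ?thesis
    using xi_full_cycle[OF finite_lessThan *(1)] assms(3,4)
    unfolding *(3) Psi_gmat[OF *(1,2)] *(5) by simp
qed

lemma Psi_near_full:
  assumes "x \<in> Kclass r \<zeta> n (type01 r a b)" "a + b = {#n - 1, 1#}" "1 \<le> p" "p \<le> n"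
  shows "Psi c p x = (\<zeta> ^ size b) ^ c * (if p = 1 then of_nat n else if p = n then (-1) ^ n * of_nat n else 0)"
proof -
  obtain \<sigma> u where *: "\<sigma> permutes V" "u \<in> V \<rightarrow> Z" "x = gmat n \<sigma> u"
    "image_mset card (mset_set (orbs \<sigma>)) = a + b" "prod u V = \<zeta> ^ size b"
    using assms(1) by (rule Kclass_type01_cases)
  obtain C D where CD: "orbs \<sigma> = {C, D}" "C \<noteq> D" "card C = n - 1" "card D = 1"
    using *(4) assms(2) mset_set_card_double[OF finite_orbs] by metis
  then obtain f where "D = {f}" by (auto simp: card_1_singleton_iff)
  then show ?thesis
    using xi_near_full_cycle[OF finite_lessThan *(1), of C f p] CD assms(3,4)
    unfolding *(3) Psi_gmat[OF *(1,2)] *(5) by (simp add: orbs_def)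
qed

lemma \<zeta>_ne_1: "\<zeta> \<noteq> 1"
  using \<zeta>_pow_ne[of 1] r2 by simp

text \<open>Nonempty classes make the uniform distributions and the averages over them
  meaningful.\<close>

lemma Kclass_full_nonempty:
  "Kclass r \<zeta> n (type01 r {#n#} {#}) \<noteq> {}" "Kclass r \<zeta> n (type01 r {#} {#n#}) \<noteq> {}"
proof -
  have V: "V \<noteq> {}" using n1 by (simp add: lessThan_empty_iff)
  obtain \<sigma> where \<sigma>: "\<sigma> permutes V" "orbit \<sigma> ` V = {V}" using exists_full_cycle[OF finite_lessThan V] .
  have "gmat n \<sigma> (\<lambda>_. 1) \<in> Kclass r \<zeta> n (type01 r {#n#} {#})"
    using \<sigma> one_in_Z by (subst Kclass_full_iff) (auto simp: orbs_def)
  then show "Kclass r \<zeta> n (type01 r {#n#} {#}) \<noteq> {}" by blast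
  \<comment> \<open>A single entry \<open>\<zeta>\<close> on an n-cycle gives the cycle product
    \<open>\<zeta>\<close>.\<close>
  define u where "u b = (if b = 0 then \<zeta> else 1)" for b :: nat
  have u: "u \<in> V \<rightarrow> Z" using one_in_Z \<zeta>_pow_in_Z[of 1] by (auto simp: u_def)
  have pu: "prod u V = \<zeta>" using n1 by (simp add: u_def prod.remove[of V 0])
  have "image_mset card (mset_set {C \<in> orbs \<sigma>. prod u C = \<zeta> ^ j}) = type01 r {#} {#n#} ! j" if "j < r" for j
  proof (cases "j = 1")
    case True
    then have "{C \<in> orbs \<sigma>. prod u C = \<zeta> ^ j} = {V}" using \<sigma> pu by (auto simp: orbs_def)
    then show ?thesis using True by (simp add: type01_nth)
  next
    case False
    have "\<zeta> \<noteq> \<zeta> ^ j" using \<zeta>_pow_eq_iff[of 1 j] False that r2 by simp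
    then have "{C \<in> orbs \<sigma>. prod u C = \<zeta> ^ j} = {}" using \<sigma> pu by (auto simp: orbs_def)
    moreover have "type01 r {#} {#n#} ! j = {#}"
      using type01_nth(1)[of "{#}" "{#n#}"] type01_nth(3)[of j "{#}" "{#n#}"] False that
      by (cases "j = 0") auto
    ultimately show ?thesis by (simp only: mset_set.empty image_mset_empty)
  qed
  then have "gmat n \<sigma> u \<in> Kclass r \<zeta> n (type01 r {#} {#n#})" unfolding Kclass_gmat_iff[OF \<sigma>(1) u] by blast
  then show "Kclass r \<zeta> n (type01 r {#} {#n#}) \<noteq> {}" by blast
qed

lemma Kclass_near_full_nonempty:
  assumes "n \<ge> 2"
  shows "Kclass r \<zeta> n (type01 r {#n - 1#} {#1#}) \<noteq> {}" "Kclass r \<zeta> n (type01 r {#n - 1, 1#} {#}) \<noteq> {}"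
proof -
  \<comment> \<open>The point \<open>m\<close> is fixed and the points below it form one cycle. The
    colour \<open>\<zeta>\<close> at \<open>m\<close> gives the class with one coloured fixed point,
    trivial colours give the other class.\<close>
  define m where "m = n - 1"
  have m: "n = Suc m" "m \<ge> 1" using assms by (auto simp: m_def)
  let ?W = "{..<m}"
  have W: "?W \<noteq> {}" using m by (simp add: lessThan_empty_iff)
  obtain \<sigma> where \<sigma>: "\<sigma> permutes ?W" "orbit \<sigma> ` ?W = {?W}" using exists_full_cycle[OF finite_lessThan W] .
  have \<sigma>V: "\<sigma> permutes V" by (rule permutes_subset[OF \<sigma>(1)]) (simp add: m)
  have "orbit \<sigma> m = {m}" using \<sigma>(1) by (simp add: orbit_eq_singleton_iff permutes_not_in)
  then have O: "orbs \<sigma> = {{m}, ?W}" using \<sigma>(2) by (simp add: orbs_def m(1)[THEN arg_cong, of lessThan] lessThan_Suc)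
  have ne: "?W \<noteq> {m}" by auto
  define u where "u b = (if b = m then \<zeta> else 1)" for b
  have u: "u \<in> V \<rightarrow> Z" using one_in_Z \<zeta>_pow_in_Z[of 1] by (auto simp: u_def)
  have pu: "prod u {m} = \<zeta>" "prod u ?W = 1" by (simp_all add: u_def)
  have "image_mset card (mset_set {C \<in> orbs \<sigma>. prod u C = \<zeta> ^ j}) = type01 r {#n - 1#} {#1#} ! j" if "j < r" for j
  proof -
    consider "j = 0" | "j = Suc 0" | "2 \<le> j" by linarith
    then show ?thesis
    proof cases
      case 1
      have "{C \<in> orbs \<sigma>. prod u C = \<zeta> ^ j} = {?W}" unfolding O using pu \<zeta>_ne_1 1 by auto
      then show ?thesis using 1 by (simp add: type01_nth m)
    next
      case 2
      have "{C \<in> orbs \<sigma>. prod u C = \<zeta> ^ j} = {{m}}" unfolding O using pu \<zeta>_ne_1 2 by auto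
      then show ?thesis using 2 by (simp add: type01_nth)
    next
      case 3
      have "\<zeta> ^ j \<noteq> \<zeta>" "\<zeta> ^ j \<noteq> 1" using \<zeta>_pow_eq_iff[of j 1] \<zeta>_pow_ne[of j] 3 that by auto
      then have "{C \<in> orbs \<sigma>. prod u C = \<zeta> ^ j} = {}" unfolding O using pu by auto
      then show ?thesis using type01_nth(3)[OF 3 that] by (simp only: mset_set.empty image_mset_empty)
    qed
  qed
  then have "gmat n \<sigma> u \<in> Kclass r \<zeta> n (type01 r {#n - 1#} {#1#})" unfolding Kclass_gmat_iff[OF \<sigma>V u] by blast
  then show "Kclass r \<zeta> n (type01 r {#n - 1#} {#1#}) \<noteq> {}" by blast
  define w :: "nat \<Rightarrow> complex" where "w = (\<lambda>_. 1)"
  have w: "w \<in> V \<rightarrow> Z" using one_in_Z by (auto simp: w_def)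
  have pw: "prod w C = 1" for C by (simp add: w_def)
  have "image_mset card (mset_set {C \<in> orbs \<sigma>. prod w C = \<zeta> ^ j}) = type01 r {#n - 1, 1#} {#} ! j" if "j < r" for j
  proof (cases "j = 0")
    case True
    then have "{C \<in> orbs \<sigma>. prod w C = \<zeta> ^ j} = {{m}, ?W}" using O pw by auto
    then show ?thesis using True ne by (simp add: type01_nth m)
  next
    case False
    then have "\<zeta> ^ j \<noteq> 1" using \<zeta>_pow_ne that by simp
    then have "{C \<in> orbs \<sigma>. prod w C = \<zeta> ^ j} = {}" using pw by auto
    moreover have "type01 r {#n - 1, 1#} {#} ! j = {#}"
      using type01_nth(2)[of "{#n - 1, 1#}" "{#}"] type01_nth(3)[of j "{#n - 1, 1#}" "{#}"] False that
      by (cases "j = Suc 0") auto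
    ultimately show ?thesis by (simp only: mset_set.empty image_mset_empty)
  qed
  then have "gmat n \<sigma> w \<in> Kclass r \<zeta> n (type01 r {#n - 1, 1#} {#})" unfolding Kclass_gmat_iff[OF \<sigma>V w] by blast
  then show "Kclass r \<zeta> n (type01 r {#n - 1, 1#} {#}) \<noteq> {}" by blast
qed

end

text \<open>The factors run from \<open>N - p + 1\<close> to \<open>N + k - p\<close>. For
  \<open>p > N\<close> one of them is 0, in agreement with the binomial coefficient; the bound on
  \<open>p\<close> keeps the natural subtraction from being truncated.\<close>

lemma pochhammer_eq_fact_binomial:
  assumes "p \<le> N + k"
  shows "pochhammer (of_nat N - of_nat p + 1 :: complex) k = fact k * of_nat ((N + k - p) choose k)"
proof -
  have "(of_nat (N + k - p) :: complex) - of_nat k + 1 = of_nat N - of_nat p + 1"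
    using assms by (simp add: of_nat_diff)
  then have "of_nat ((N + k - p) choose k) = pochhammer (of_nat N - of_nat p + 1 :: complex) k / fact k"
    by (simp only: binomial_gbinomial gbinomial_pochhammer')
  then show ?thesis by simp
qed

section \<open>The inner product\<close>

definition avg :: "complex mat set \<Rightarrow> (complex mat \<Rightarrow> complex) \<Rightarrow> complex mat \<Rightarrow> complex" where
  "avg K g y = (\<Sum>k\<in>K. g (k * y)) / of_nat (card K)"

context wreath
begin

abbreviation "K \<equiv> Kclass r \<zeta> n"

lemma K_subset: "K la \<subseteq> G"
  by (auto simp: Kclass_def)

lemma finite_K [simp]: "finite (K la)"
  using finite_subset[OF K_subset finite_G] .

lemma sum_indicator_K:
  fixes F :: "complex mat \<Rightarrow> complex"
  shows "(\<Sum>x\<in>G. (if x \<in> K la then 1 else 0) * F x) = (\<Sum>x\<in>K la. F x)"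
  by (rule sum.mono_neutral_cong_right) (use K_subset finite_G in auto)

lemma class_fun_indicator: "class_fun (\<lambda>x. if x \<in> K la then 1 else 0)"
  by (auto simp: class_fun_def Kclass_def)

lemma class_fun_ell: "class_fun (\<lambda>x. h (ell r \<zeta> n x))"
  by (auto simp: class_fun_def ell_def)

text \<open>Schur's lemma for the indicator of a class: the eigenvalue is the value of the character
  on the class divided by its value at the identity.\<close>

lemma avg_Psi:
  assumes "K la \<noteq> {}" "\<And>k. k \<in> K la \<Longrightarrow> Psi c p k = s" "1 \<le> p" "p \<le> n" "y \<in> G"
  shows "avg (K la) (Psi c p) y = s / of_nat (p * (n choose p)) * Psi c p y"
proof -
  have nz: "of_nat (p * (n choose p)) \<noteq> (0 :: complex)"
    using assms(3,4) by (simp add: binomial_eq_0_iff)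
  have "(\<Sum>k\<in>K la. Psi c p (k * y)) * of_nat (p * (n choose p)) = (\<Sum>k\<in>K la. Psi c p k) * Psi c p y"
    using Psi_schur[OF class_fun_indicator _ assms(5), of p la c] assms(3)
    by (simp only: sum_indicator_K)
  also have "(\<Sum>k\<in>K la. Psi c p k) = of_nat (card (K la)) * s" using assms(2) by simp
  finally show ?thesis
    using nz assms(1) by (simp add: avg_def field_simps)
qed

text \<open>The normalized scalar product of \<open>(r m + 1) ^ ell\<close> with a twisted hook
  character, after division by the group order and by \<open>p * (n choose p)\<close>; the extra 1
  belongs to the trivial twist.\<close>

definition cc :: "nat \<Rightarrow> nat \<Rightarrow> nat \<Rightarrow> complex" where
  "cc c m p = of_nat ((m + (if c = 0 then 1 else 0) + n - p) choose n)"

lemma sum_pow_ell_Psi_cc: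
  assumes "p \<le> n" "r dvd d \<longleftrightarrow> c = 0"
  shows "(\<Sum>x\<in>G. of_nat (r * m + 1) ^ ell r \<zeta> n x * Psi d p x) =
    of_nat (p * (n choose p)) * of_nat (r ^ n * fact n) * cc c m p"
  unfolding sum_pow_ell_Psi cc_def assms(2)
  using pochhammer_eq_fact_binomial[of p "m + (if c = 0 then 1 else 0)" n] assms(1) by simp

lemma r_dvd_pred_mult: "r dvd (r - 1) * c \<longleftrightarrow> r dvd c"
proof -
  have "coprime (Suc (r - 1)) (r - 1)" by simp
  then have "coprime r (r - 1)" using r_pos by simp
  then show ?thesis by (simp add: coprime_dvd_mult_right_iff)
qed

lemma r_dvd_iff: "c < r \<Longrightarrow> r dvd c \<longleftrightarrow> c = 0"
  by (auto dest: dvd_imp_le)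

abbreviation "A \<equiv> type01 r {#n#} {#}"

text \<open>The roles are exchanged: the indicator of the class is expanded into the
  \<open>Psi c p\<close>, and the power of \<open>ell\<close> serves as the class function in
  Schur's lemma. The expansion is at the inverse of \<open>y\<close>, hence the dual twist
  \<open>(r - 1) * c\<close>.\<close>

lemma sum_full_class:
  assumes y: "y \<in> G"
  shows "(\<Sum>k\<in>K A. of_nat (r * m + 1) ^ ell r \<zeta> n (k * y)) * of_nat (r * n\<^sup>2) =
    of_nat (r ^ n * fact n) * (\<Sum>c<r. \<Sum>p=1..n. (-1) ^ (p - 1) * cc c m p * Psi ((r - 1) * c) p y)"
proof -
  let ?e = "\<lambda>x. of_nat (r * m + 1) ^ ell r \<zeta> n x :: complex"
  obtain y' where y': "y' \<in> G" "y * y' = 1\<^sub>m n" "y' * y = 1\<^sub>m n" "\<And>c p. Psi c p y' = Psi ((r - 1) * c) p y"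
    using G_inverse[OF y] by blast
  note car = G_carrier
  have "(\<Sum>k\<in>K A. ?e (k * y)) * of_nat (r * n\<^sup>2) = (\<Sum>x\<in>G. (if x \<in> K A then of_nat (r * n\<^sup>2) else 0) * ?e (x * y))"
    unfolding sum_indicator_K[of A, symmetric] sum_distrib_right by (rule sum.cong) auto
  \<comment> \<open>The substitution \<open>u = x * y\<close> makes \<open>y'\<close> the argument
    that is averaged against.\<close>
  also have "\<dots> = (\<Sum>u\<in>G. (if u * y' \<in> K A then of_nat (r * n\<^sup>2) else 0) * ?e u)"
  proof (rule sum.reindex_bij_witness[of _ "\<lambda>u. u * y'" "\<lambda>x. x * y"], goal_cases)
    case (1 x)
    have "x * y * y' = x" using assoc_mult_mat[OF car[OF 1] car[OF y] car[OF y'(1)]] y' right_mult_one_mat[OF car[OF 1]] by simp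
    then show ?case .
  next
    case (2 x) then show ?case using G_mult y by blast
  next
    case (3 u)
    have "u * y' * y = u" using assoc_mult_mat[OF car[OF 3] car[OF y'(1)] car[OF y]] y' right_mult_one_mat[OF car[OF 3]] by simp
    then show ?case .
  next
    case (4 u) then show ?case using G_mult y' by blast
  next
    case (5 x)
    have "x * y * y' = x" using assoc_mult_mat[OF car[OF 5] car[OF y] car[OF y'(1)]] y' right_mult_one_mat[OF car[OF 5]] by simp
    then show ?case by simp
  qed
  also have "\<dots> = (\<Sum>u\<in>G. \<Sum>c<r. \<Sum>p=1..n. (-1) ^ (p - 1) * (?e u * Psi c p (u * y')))"
  proof (rule sum.cong)
    fix u assume "u \<in> G"
    then have "u * y' \<in> G" using G_mult y' by blast
    define e where "e = ?e u"
    from Psi_alternating_sum[OF \<open>u * y' \<in> G\<close>, symmetric]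
    show "(if u * y' \<in> K A then of_nat (r * n\<^sup>2) else 0) * ?e u = (\<Sum>c<r. \<Sum>p=1..n. (-1) ^ (p - 1) * (?e u * Psi c p (u * y')))"
      unfolding e_def[symmetric] by (simp only: sum_distrib_right) (simp only: mult_ac)
  qed simp
  also have "\<dots> = (\<Sum>c<r. \<Sum>u\<in>G. \<Sum>p=1..n. (-1) ^ (p - 1) * (?e u * Psi c p (u * y')))"
    by (rule sum.swap)
  also have "\<dots> = (\<Sum>c<r. \<Sum>p=1..n. \<Sum>u\<in>G. (-1) ^ (p - 1) * (?e u * Psi c p (u * y')))"
    by (intro sum.cong refl sum.swap)
  also have "\<dots> = (\<Sum>c<r. \<Sum>p=1..n. of_nat (r ^ n * fact n) * ((-1) ^ (p - 1) * cc c m p * Psi ((r - 1) * c) p y))"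
  proof (intro sum.cong refl)
    fix c p assume "c \<in> {..<r}" "p \<in> {1..n}"
    then have c: "c < r" and p: "1 \<le> p" "p \<le> n" by auto
    have nz: "of_nat (p * (n choose p)) \<noteq> (0 :: complex)"
      using p by (simp add: binomial_eq_0_iff)
    have "(\<Sum>u\<in>G. ?e u * Psi c p (u * y')) * of_nat (p * (n choose p)) =
        of_nat (p * (n choose p)) * of_nat (r ^ n * fact n) * cc c m p * Psi c p y'"
      using Psi_schur[OF class_fun_ell[of "\<lambda>l. of_nat (r * m + 1) ^ l"] _ y'(1), of p c] p
        sum_pow_ell_Psi_cc[OF p(2), of c c m] r_dvd_iff[OF c] by simp
    then have "(\<Sum>u\<in>G. ?e u * Psi c p (u * y')) = of_nat (r ^ n * fact n) * cc c m p * Psi c p y'"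
      using nz by (simp add: mult_ac)
    then show "(\<Sum>u\<in>G. (-1) ^ (p - 1) * (?e u * Psi c p (u * y'))) =
        of_nat (r ^ n * fact n) * ((-1) ^ (p - 1) * cc c m p * Psi ((r - 1) * c) p y)"
      unfolding sum_distrib_left[symmetric] y'(4) by (simp only: mult_ac)
  qed
  finally show ?thesis by (simp only: sum_distrib_left)
qed

text \<open>The case \<open>m = 0\<close> at the identity: the power of \<open>ell\<close> is
  constantly 1 and only the trivial character, \<open>c = 0\<close> and \<open>p = 1\<close>,
  survives.\<close>

lemma card_full_class: "of_nat (card (K A)) * of_nat (r * n\<^sup>2) = (of_nat (r ^ n * fact n * n) :: complex)"
proof -
  have cc0: "cc c 0 p = (if c = 0 \<and> p = 1 then 1 else 0)" if "1 \<le> p" "p \<le> n" for c p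
    using that by (auto simp: cc_def binomial_eq_0)
  have xi1: "Psi 0 1 (1\<^sub>m n) = of_nat n"
    using Psi_gmat[OF permutes_id, of "\<lambda>_. 1" 0 1] one_in_Z xi_id[OF finite_lessThan[of n], of 1]
    by (simp add: gmat_one)
  have "(\<Sum>c<r. \<Sum>p=1..n. (-1) ^ (p - 1) * cc c 0 p * Psi ((r - 1) * c) p (1\<^sub>m n)) =
      (\<Sum>c<r. \<Sum>p=1..n. if p = 1 then (if c = 0 then Psi ((r - 1) * c) 1 (1\<^sub>m n) else 0) else 0)"
    by (intro sum.cong refl) (simp add: cc0)
  also have "\<dots> = of_nat n" using n1 r_pos xi1 by simp
  finally show ?thesis using sum_full_class[OF G_one, of 0] by simp
qed

lemma avg_full:
  assumes "y \<in> G"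
  shows "avg (K A) (\<lambda>x. of_nat (r * m + 1) ^ ell r \<zeta> n x) y =
    (\<Sum>c<r. \<Sum>p=1..n. ((-1) ^ (p - 1) * cc c m p / of_nat n) * Psi ((r - 1) * c) p y)"
proof -
  define S where "S = (\<Sum>c<r. \<Sum>p=1..n. (-1) ^ (p - 1) * cc c m p * Psi ((r - 1) * c) p y)"
  define N where "N = (of_nat n :: complex)"
  define L where "L = (\<Sum>k\<in>K A. of_nat (r * m + 1) ^ ell r \<zeta> n (k * y) :: complex)"
  define q where "q = (of_nat (r * n\<^sup>2) :: complex)"
  define w where "w = (of_nat (r ^ n * fact n) :: complex)"
  define k where "k = (of_nat (card (K A)) :: complex)"
  have nz: "q \<noteq> 0" "w \<noteq> 0" "k \<noteq> 0" "N \<noteq> 0"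
    using r_pos n1 Kclass_full_nonempty(1) by (simp_all add: q_def w_def k_def N_def)
  have 1: "L * q = w * S" using sum_full_class[OF assms] by (simp only: L_def q_def w_def S_def)
  have 2: "k * q = w * N" using card_full_class by (simp only: k_def q_def w_def N_def of_nat_mult)
  have "L * N * (w * q) = S * k * (w * q)"
    using arg_cong2[OF 1 2[symmetric], of "(*)"] by (simp only: mult_ac)
  then have "L * N = S * k" using nz by simp
  then have "L / k = S / N" using nz by (simp add: field_simps)
  then show ?thesis by (simp add: avg_def L_def k_def S_def N_def sum_divide_distrib)
qed

lemma fold_avg_Psi:
  assumes "\<forall>k\<in>set Ks. k \<subseteq> G \<and> (\<forall>y\<in>G. \<forall>c p. 1 \<le> p \<longrightarrow> p \<le> n \<longrightarrow> avg k (Psi (d c) p) y = t k c p * Psi (d c) p y)"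
    and "\<And>y. y \<in> G \<Longrightarrow> g y = (\<Sum>c<r. \<Sum>p=1..n. a c p * Psi (d c) p y)" and "y \<in> G"
  shows "fold avg Ks g y = (\<Sum>c<r. \<Sum>p=1..n. a c p * prod_list (map (\<lambda>k. t k c p) Ks) * Psi (d c) p y)"
  using assms
proof (induction Ks arbitrary: a g y)
  case Nil
  then show ?case by simp
next
  case (Cons k Ks)
  have 1: "avg k g y = (\<Sum>c<r. \<Sum>p=1..n. (a c p * t k c p) * Psi (d c) p y)" if y: "y \<in> G" for y
  proof -
    have "avg k g y = (\<Sum>x\<in>k. \<Sum>c<r. \<Sum>p=1..n. a c p * Psi (d c) p (x * y)) / of_nat (card k)"
      unfolding avg_def using Cons.prems(1,2) y G_mult by (intro arg_cong2[of _ _ _ _ "(/)"] sum.cong refl) auto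
    also have "(\<Sum>x\<in>k. \<Sum>c<r. \<Sum>p=1..n. a c p * Psi (d c) p (x * y)) =
        (\<Sum>c<r. \<Sum>x\<in>k. \<Sum>p=1..n. a c p * Psi (d c) p (x * y))" by (rule sum.swap)
    also have "\<dots> = (\<Sum>c<r. \<Sum>p=1..n. \<Sum>x\<in>k. a c p * Psi (d c) p (x * y))"
      by (intro sum.cong refl sum.swap)
    also have "\<dots> / of_nat (card k) = (\<Sum>c<r. \<Sum>p=1..n. a c p * avg k (Psi (d c) p) y)"
      by (simp add: avg_def sum_divide_distrib sum_distrib_left)
    also have "\<dots> = (\<Sum>c<r. \<Sum>p=1..n. (a c p * t k c p) * Psi (d c) p y)"
      using Cons.prems(1) y by (intro sum.cong refl) simp
    finally show ?thesis .
  qed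
  have "fold avg Ks (avg k g) y =
      (\<Sum>c<r. \<Sum>p=1..n. (a c p * t k c p) * prod_list (map (\<lambda>k. t k c p) Ks) * Psi (d c) p y)"
    by (rule Cons.IH) (use Cons.prems 1 in auto)
  then show ?case by (simp add: mult.assoc)
qed

text \<open>With \<open>fold\<close> the last class of the list is the outermost average, so its
  element stands next to \<open>x\<close> in the product of all chosen elements with
  \<open>x\<close>.\<close>

definition pairing :: "nat multiset list list \<Rightarrow> nat \<Rightarrow> nat \<Rightarrow> complex" where
  "pairing lams M m = (\<Sum>x\<in>G. of_nat (r * M + 1) ^ ell r \<zeta> n x *
     fold avg (map K lams) (\<lambda>x. of_nat (r * m + 1) ^ ell r \<zeta> n x) x) / of_nat (card G)"

text \<open>The leading class \<open>A\<close> expands the average with coefficients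
  \<open>cc c m p / n\<close>, every further class multiplies by its eigenvalue, and the final
  scalar product contributes \<open>p * (n choose p)\<close> times \<open>cc c M p\<close>.\<close>

lemma pairing_full:
  assumes "\<forall>la\<in>set lams. K la \<noteq> {} \<and> (\<forall>k\<in>K la. \<forall>c p. 1 \<le> p \<longrightarrow> p \<le> n \<longrightarrow> Psi ((r - 1) * c) p k = s la c p)"
  shows "pairing (A # lams) M m = (\<Sum>c<r. \<Sum>p=1..n. (-1) ^ (p - 1) * (of_nat (p * (n choose p)) / of_nat n) *
     prod_list (map (\<lambda>la. s la c p / of_nat (p * (n choose p))) lams) * (cc c M p * cc c m p))"
proof -
  \<comment> \<open>\<open>fold_avg_Psi\<close> wants eigenvalues as a function of the set of
    matrices, whereas \<open>s\<close> depends on the type; evaluating at a chosen element of the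
    set mediates between the two.\<close>
  let ?t = "\<lambda>k c p. Psi ((r - 1) * c) p (SOME x. x \<in> k) / of_nat (p * (n choose p))"
  let ?B = "\<lambda>p. of_nat (p * (n choose p)) :: complex"
  have t: "?t (K la) c p = s la c p / ?B p" if "la \<in> set lams" "1 \<le> p" "p \<le> n" for la c p
  proof -
    have "(SOME x. x \<in> K la) \<in> K la" using assms that(1) by (simp add: some_in_eq)
    then show ?thesis using assms that by simp
  qed
  have f: "fold avg (map K (A # lams)) (\<lambda>x. of_nat (r * m + 1) ^ ell r \<zeta> n x) y =
     (\<Sum>c<r. \<Sum>p=1..n. ((-1) ^ (p - 1) * cc c m p / of_nat n) * prod_list (map (\<lambda>k. ?t k c p) (map K lams)) * Psi ((r - 1) * c) p y)"
    if "y \<in> G" for y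
    unfolding list.map fold.simps comp_apply
  proof (rule fold_avg_Psi[where d = "\<lambda>c. (r - 1) * c" and t = ?t])
    show "\<forall>k\<in>set (map K lams). k \<subseteq> G \<and> (\<forall>y\<in>G. \<forall>c p. 1 \<le> p \<longrightarrow> p \<le> n \<longrightarrow>
        avg k (Psi ((r - 1) * c) p) y = ?t k c p * Psi ((r - 1) * c) p y)"
    proof
      fix k assume "k \<in> set (map K lams)"
      then obtain la where la: "la \<in> set lams" "k = K la" by auto
      show "k \<subseteq> G \<and> (\<forall>y\<in>G. \<forall>c p. 1 \<le> p \<longrightarrow> p \<le> n \<longrightarrow> avg k (Psi ((r - 1) * c) p) y = ?t k c p * Psi ((r - 1) * c) p y)"
      proof (intro conjI ballI allI impI)
        show "k \<subseteq> G" using la K_subset by simp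
        fix y c p assume y: "y \<in> G" and p: "1 \<le> p" "p \<le> n"
        have "avg (K la) (Psi ((r - 1) * c) p) y = s la c p / ?B p * Psi ((r - 1) * c) p y"
          by (rule avg_Psi[OF _ _ p y]) (use assms la p in auto)
        then show "avg k (Psi ((r - 1) * c) p) y = ?t k c p * Psi ((r - 1) * c) p y"
          unfolding la(2) t[OF la(1) p] .
      qed
    qed
  qed (use avg_full that in auto)
  define w where "w = (of_nat (r ^ n * fact n) :: complex)"
  have w: "w \<noteq> 0" "of_nat (card G) = w" using r_pos by (simp_all add: w_def card_G)
  have "pairing (A # lams) M m = (\<Sum>x\<in>G. \<Sum>c<r. \<Sum>p=1..n. of_nat (r * M + 1) ^ ell r \<zeta> n x *
     (((-1) ^ (p - 1) * cc c m p / of_nat n) * prod_list (map (\<lambda>k. ?t k c p) (map K lams)) * Psi ((r - 1) * c) p x)) / w"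
    unfolding pairing_def w(2) by (intro arg_cong2[of _ _ _ _ "(/)"] sum.cong refl) (simp only: f sum_distrib_left)
  also have "\<dots> = (\<Sum>c<r. \<Sum>x\<in>G. \<Sum>p=1..n. of_nat (r * M + 1) ^ ell r \<zeta> n x *
     (((-1) ^ (p - 1) * cc c m p / of_nat n) * prod_list (map (\<lambda>k. ?t k c p) (map K lams)) * Psi ((r - 1) * c) p x)) / w"
    by (intro arg_cong2[of _ _ _ _ "(/)"] sum.swap refl)
  also have "\<dots> = (\<Sum>c<r. \<Sum>p=1..n. \<Sum>x\<in>G. of_nat (r * M + 1) ^ ell r \<zeta> n x *
     (((-1) ^ (p - 1) * cc c m p / of_nat n) * prod_list (map (\<lambda>k. ?t k c p) (map K lams)) * Psi ((r - 1) * c) p x)) / w"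
    by (intro arg_cong2[of _ _ _ _ "(/)"] sum.cong sum.swap refl)
  also have "\<dots> = (\<Sum>c<r. \<Sum>p=1..n. w * ((-1) ^ (p - 1) * (?B p / of_nat n) *
     prod_list (map (\<lambda>la. s la c p / ?B p) lams) * (cc c M p * cc c m p))) / w"
  proof (intro arg_cong2[of _ _ _ _ "(/)"] sum.cong refl)
    fix c p assume "c \<in> {..<r}" "p \<in> {1..n}"
    then have c: "c < r" and p: "1 \<le> p" "p \<le> n" by auto
    define R where "R = prod_list (map (\<lambda>la. s la c p / ?B p) lams)"
    have R: "prod_list (map (\<lambda>k. ?t k c p) (map K lams)) = R"
      unfolding R_def map_map using t p by (intro arg_cong[of _ _ prod_list] map_cong) auto
    have S: "(\<Sum>x\<in>G. of_nat (r * M + 1) ^ ell r \<zeta> n x * Psi ((r - 1) * c) p x) = ?B p * w * cc c M p"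
      unfolding w_def by (rule sum_pow_ell_Psi_cc[OF p(2)]) (use r_dvd_pred_mult r_dvd_iff[OF c] in simp)
    have "(\<Sum>x\<in>G. of_nat (r * M + 1) ^ ell r \<zeta> n x * (((-1) ^ (p - 1) * cc c m p / of_nat n) * R * Psi ((r - 1) * c) p x)) =
       ((-1) ^ (p - 1) * cc c m p / of_nat n) * R * (\<Sum>x\<in>G. of_nat (r * M + 1) ^ ell r \<zeta> n x * Psi ((r - 1) * c) p x)"
      unfolding sum_distrib_left by (rule sum.cong) (simp_all only: mult_ac)
    then show "(\<Sum>x\<in>G. of_nat (r * M + 1) ^ ell r \<zeta> n x *
       (((-1) ^ (p - 1) * cc c m p / of_nat n) * prod_list (map (\<lambda>k. ?t k c p) (map K lams)) * Psi ((r - 1) * c) p x)) =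
       w * ((-1) ^ (p - 1) * (?B p / of_nat n) * prod_list (map (\<lambda>la. s la c p / ?B p) lams) * (cc c M p * cc c m p))"
      unfolding R S R_def[symmetric] by (simp add: mult_ac)
  qed
  finally show ?thesis using w(1) by (simp only: sum_distrib_left[symmetric]) simp
qed

end

section \<open>Expected intersections as iterated averages\<close>

lemma foldr_mult_mat:
  fixes y :: "'a :: semiring_1 mat"
  assumes "set xs \<subseteq> carrier_mat n n" "y \<in> carrier_mat n n"
  shows "foldr (*) xs (1\<^sub>m n) \<in> carrier_mat n n \<and> foldr (*) xs (1\<^sub>m n) * y = foldr (*) xs y"
  using assms
proof (induction xs)
  case Nil
  then show ?case using left_mult_one_mat[of y n n] by simp
next
  case (Cons x xs)
  then have x: "x \<in> carrier_mat n n" and IH: "foldr (*) xs (1\<^sub>m n) \<in> carrier_mat n n"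
    "foldr (*) xs (1\<^sub>m n) * y = foldr (*) xs y" by auto
  then show ?case
    using assoc_mult_mat[OF x IH(1) Cons.prems(2)] mult_carrier_mat[OF x IH(1)] by simp
qed

context wreath
begin

lemma ell_le: "x \<in> G \<Longrightarrow> ell r \<zeta> n x \<le> n"
proof -
  assume "x \<in> G"
  then obtain \<sigma> u where *: "\<sigma> permutes V" "u \<in> V \<rightarrow>\<^sub>E Z" "x = gmat n \<sigma> u" using G_cases by metis
  then have u: "u \<in> V \<rightarrow> Z" by auto
  have "card {C \<in> orbit \<sigma> ` V. prod u C = 1} \<le> card (orbit \<sigma> ` V)" by (rule card_mono) auto
  also have "\<dots> \<le> card V" by (rule card_image_le) simp
  finally show ?thesis by (simp add: *(3) ell_gmat[OF *(1) u])
qed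

text \<open>The support of the product distribution, with the same default
  \<open>1\<^sub>m n\<close> outside the index range.\<close>

definition choices :: "nat multiset list list \<Rightarrow> (nat \<Rightarrow> complex mat) set" where
  "choices lams = PiE_dflt {..<length lams} (1\<^sub>m n) (\<lambda>u. K (lams ! u))"

definition word :: "nat multiset list list \<Rightarrow> (nat \<Rightarrow> complex mat) \<Rightarrow> complex mat" where
  "word lams k = foldr (*) (map k [0..<length lams]) (1\<^sub>m n)"

lemma word_snoc:
  assumes "k \<in> choices lams" "\<kappa> \<in> G"
  shows "word (lams @ [la]) (k(length lams := \<kappa>)) = word lams k * \<kappa>"
proof -
  have "word (lams @ [la]) (k(length lams := \<kappa>)) = foldr (*) (map k [0..<length lams]) \<kappa>"
    using G_carrier[OF assms(2)] by (simp add: word_def)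
  moreover have "set (map k [0..<length lams]) \<subseteq> carrier_mat n n"
    using assms(1) K_subset G_carrier by (fastforce simp: choices_def PiE_dflt_def)
  ultimately show ?thesis using foldr_mult_mat[of _ n \<kappa>] G_carrier[OF assms(2)] by (simp add: word_def)
qed

lemma choices_snoc:
  "bij_betw (\<lambda>(\<kappa>, k). k(length lams := \<kappa>)) (K la \<times> choices lams) (choices (lams @ [la]))"
proof (rule bij_betwI[of _ _ _ "\<lambda>k. (k (length lams), k(length lams := 1\<^sub>m n))"])
  have nth: "(lams @ [la]) ! u = lams ! u" if "u < length lams" for u using that by (simp add: nth_append)
  show "(\<lambda>(\<kappa>, k). k(length lams := \<kappa>)) \<in> K la \<times> choices lams \<rightarrow> choices (lams @ [la])"
    by (auto simp: choices_def PiE_dflt_def nth_append less_Suc_eq)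
  show "(\<lambda>k. (k (length lams), k(length lams := 1\<^sub>m n))) \<in> choices (lams @ [la]) \<rightarrow> K la \<times> choices lams"
  proof
    fix k assume "k \<in> choices (lams @ [la])"
    then have k: "\<And>u. u < Suc (length lams) \<Longrightarrow> k u \<in> K ((lams @ [la]) ! u)" "\<And>u. \<not> u < Suc (length lams) \<Longrightarrow> k u = 1\<^sub>m n"
      by (simp_all add: choices_def PiE_dflt_def)
    have "k (length lams) \<in> K la" using k(1)[of "length lams"] by simp
    moreover have "k u \<in> K (lams ! u)" if "u < length lams" for u using k(1)[of u] nth[OF that] that by simp
    moreover have "k u = 1\<^sub>m n" if "\<not> u < length lams" "u \<noteq> length lams" for u using k(2)[of u] that by simp
    ultimately show "(k (length lams), k(length lams := 1\<^sub>m n)) \<in> K la \<times> choices lams"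
      by (auto simp: choices_def PiE_dflt_def)
  qed
qed (auto simp: choices_def PiE_dflt_def fun_eq_iff)

lemma finite_choices: "finite (choices lams)"
  unfolding choices_def by (rule finite_PiE_dflt) auto

lemma word_in_G: "k \<in> choices lams \<Longrightarrow> word lams k \<in> G"
proof (induction lams arbitrary: k rule: rev_induct)
  case Nil
  then show ?case by (simp add: word_def G_one)
next
  case (snoc la lams)
  have "k \<in> (\<lambda>(\<kappa>, k). k(length lams := \<kappa>)) ` (K la \<times> choices lams)"
    using bij_betw_imp_surj_on[OF choices_snoc[of lams la]] snoc.prems by simp
  then obtain \<kappa> k' where *: "k = k'(length lams := \<kappa>)" "\<kappa> \<in> K la" "k' \<in> choices lams"
    by auto
  then have "\<kappa> \<in> G" using K_subset by blast
  then show ?case unfolding *(1) word_snoc[OF *(3) \<open>\<kappa> \<in> G\<close>] using snoc.IH[OF *(3)] G_mult by blast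
qed

text \<open>Induction from the right end of the list: the last factor is the one that multiplies
  \<open>x\<close> first, and \<open>fold\<close> applies its average last.\<close>

lemma sum_choices:
  assumes "\<forall>la\<in>set lams. K la \<noteq> {}" "x \<in> G"
  shows "(\<Sum>k\<in>choices lams. g (word lams k * x)) = of_nat (card (choices lams)) * fold avg (map K lams) g x"
  using assms
proof (induction lams arbitrary: x rule: rev_induct)
  case Nil
  have "choices [] = {\<lambda>_. 1\<^sub>m n}" by (auto simp: choices_def PiE_dflt_def)
  then show ?case using G_carrier[OF Nil(2)] by (simp add: word_def)
next
  case (snoc la lams)
  have card: "card (choices (lams @ [la])) = card (K la) * card (choices lams)"
    using bij_betw_same_card[OF choices_snoc[of lams la]] by (simp add: card_cartesian_product)
  have "(\<Sum>k\<in>choices (lams @ [la]). g (word (lams @ [la]) k * x)) =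
      (\<Sum>\<kappa>\<in>K la. \<Sum>k\<in>choices lams. g (word (lams @ [la]) (k(length lams := \<kappa>)) * x))"
    by (simp add: sum.reindex_bij_betw[OF choices_snoc, symmetric] sum.cartesian_product case_prod_unfold)
  also have "\<dots> = (\<Sum>\<kappa>\<in>K la. \<Sum>k\<in>choices lams. g (word lams k * (\<kappa> * x)))"
  proof (intro sum.cong refl)
    fix \<kappa> k assume \<kappa>: "\<kappa> \<in> K la" and k: "k \<in> choices lams"
    then have "\<kappa> \<in> G" using K_subset by blast
    then show "g (word (lams @ [la]) (k(length lams := \<kappa>)) * x) = g (word lams k * (\<kappa> * x))"
      using assoc_mult_mat[OF G_carrier[OF word_in_G[OF k]] G_carrier[OF \<open>\<kappa> \<in> G\<close>] G_carrier[OF snoc.prems(2)]]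
      by (simp add: word_snoc[OF k])
  qed
  also have "\<dots> = (\<Sum>\<kappa>\<in>K la. of_nat (card (choices lams)) * fold avg (map K lams) g (\<kappa> * x))"
  proof (intro sum.cong refl)
    fix \<kappa> assume "\<kappa> \<in> K la"
    then have "\<kappa> * x \<in> G" using K_subset G_mult snoc.prems(2) by blast
    then show "(\<Sum>k\<in>choices lams. g (word lams k * (\<kappa> * x))) = of_nat (card (choices lams)) * fold avg (map K lams) g (\<kappa> * x)"
      using snoc.IH snoc.prems(1) by simp
  qed
  also have "\<dots> = of_nat (card (choices (lams @ [la]))) * fold avg (map K (lams @ [la])) g x"
    using snoc.prems(1) by (simp add: avg_def card sum_distrib_left[symmetric])
  finally show ?case .
qed

text \<open>Independent uniform choices form the uniform distribution on the product, so the
  expectation is a plain average.\<close>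

lemma mu_seq_eq:
  assumes "\<forall>la\<in>set lams. K la \<noteq> {}"
  shows "mu_seq r \<zeta> n lams i j =
    (\<Sum>k\<in>choices lams. real (card ((\<lambda>x. word lams k * x) ` Cset r \<zeta> n i \<inter> Cset r \<zeta> n j))) / real (card (choices lams))"
proof -
  have ne: "choices lams \<noteq> {}" using assms by (auto simp: choices_def)
  have "Pi_pmf {..<length lams} (1\<^sub>m n) (\<lambda>u. pmf_of_set (K (lams ! u))) = pmf_of_set (choices lams)"
    unfolding choices_def by (rule Pi_pmf_of_set) (use assms in auto)
  then show ?thesis
    unfolding mu_seq_def word_def[symmetric] by (simp only: integral_pmf_of_set[OF ne finite_choices])
qed

lemma card_translate:
  assumes "g \<in> G"
  shows "of_nat (card ((\<lambda>x. g * x) ` Cset r \<zeta> n i \<inter> Cset r \<zeta> n j)) =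
    (\<Sum>x\<in>G. (if ell r \<zeta> n x = i then 1 else 0) * (if ell r \<zeta> n (g * x) = j then 1 else 0) :: complex)"
proof -
  obtain g' where g': "g' \<in> G" "g' * g = 1\<^sub>m n" using G_inverse[OF assms] by metis
  have inv: "g' * (g * x) = x" if "x \<in> G" for x
    using assoc_mult_mat[OF G_carrier[OF g'(1)] G_carrier[OF assms] G_carrier[OF that]] g'(2)
      left_mult_one_mat[OF G_carrier[OF that]] by simp
  have inj: "inj_on (\<lambda>x. g * x) G" by (rule inj_on_inverseI[where g = "\<lambda>x. g' * x"]) (rule inv)
  let ?S = "{x \<in> G. ell r \<zeta> n x = i \<and> ell r \<zeta> n (g * x) = j}"
  have "(\<lambda>x. g * x) ` Cset r \<zeta> n i \<inter> Cset r \<zeta> n j = (\<lambda>x. g * x) ` ?S"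
    using G_mult[OF assms] by (auto simp: Cset_def)
  then have "card ((\<lambda>x. g * x) ` Cset r \<zeta> n i \<inter> Cset r \<zeta> n j) = card ?S"
    using card_image[OF inj_on_subset[OF inj], of ?S] by auto
  also have "of_nat (card ?S) = (\<Sum>x\<in>?S. 1 :: complex)" by simp
  also have "\<dots> = (\<Sum>x\<in>G. (if ell r \<zeta> n x = i then 1 else 0) * (if ell r \<zeta> n (g * x) = j then 1 else 0))"
    by (rule sum.mono_neutral_cong_left) (use finite_G in auto)
  finally show ?thesis .
qed

text \<open>Each intersection is counted by the \<open>x\<close> with prescribed \<open>ell\<close>
  of \<open>x\<close> and of its translate. Weighting by powers and summing over all levels, which
  range up to \<open>n\<close>, replaces the exponents by the actual values of
  \<open>ell\<close>.\<close>

lemma sum_mu_seq: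
  assumes "\<forall>la\<in>set lams. K la \<noteq> {}"
  shows "(\<Sum>i\<le>n. \<Sum>j\<le>n. of_nat (r * M + 1) ^ i * of_nat (r * m + 1) ^ j * of_real (mu_seq r \<zeta> n lams i j)) =
    of_nat (card G) * pairing lams M m"
proof -
  define a b where "a = (of_nat (r * M + 1) :: complex)" and "b = (of_nat (r * m + 1) :: complex)"
  define N where "N = (of_nat (card (choices lams)) :: complex)"
  have ne: "choices lams \<noteq> {}" using assms by (auto simp: choices_def)
  then have N: "N \<noteq> 0" using finite_choices by (simp add: N_def)
  let ?I = "\<lambda>k i j x. (if ell r \<zeta> n x = i then 1 else 0) * (if ell r \<zeta> n (word lams k * x) = j then 1 else 0) :: complex"
  have inner: "(\<Sum>i\<le>n. \<Sum>j\<le>n. a ^ i * b ^ j * (\<Sum>x\<in>G. ?I k i j x)) = (\<Sum>x\<in>G. a ^ ell r \<zeta> n x * b ^ ell r \<zeta> n (word lams k * x))"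
    if k: "k \<in> choices lams" for k
  proof -
    have "(\<Sum>i\<le>n. \<Sum>j\<le>n. a ^ i * b ^ j * (\<Sum>x\<in>G. ?I k i j x)) = (\<Sum>i\<le>n. \<Sum>j\<le>n. \<Sum>x\<in>G. a ^ i * b ^ j * ?I k i j x)"
      by (simp only: sum_distrib_left)
    also have "\<dots> = (\<Sum>i\<le>n. \<Sum>x\<in>G. \<Sum>j\<le>n. a ^ i * b ^ j * ?I k i j x)"
      by (intro sum.cong sum.swap refl)
    also have "\<dots> = (\<Sum>x\<in>G. \<Sum>i\<le>n. \<Sum>j\<le>n. a ^ i * b ^ j * ?I k i j x)"
      by (rule sum.swap)
    also have "\<dots> = (\<Sum>x\<in>G. a ^ ell r \<zeta> n x * b ^ ell r \<zeta> n (word lams k * x))"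
    proof (intro sum.cong refl)
      fix x assume x: "x \<in> G"
      have l: "ell r \<zeta> n x \<le> n" "ell r \<zeta> n (word lams k * x) \<le> n"
        using ell_le x word_in_G[OF k] G_mult by blast+
      have "(\<Sum>i\<le>n. \<Sum>j\<le>n. a ^ i * b ^ j * ?I k i j x) =
          (\<Sum>i\<le>n. if ell r \<zeta> n x = i then a ^ i else 0) * (\<Sum>j\<le>n. if ell r \<zeta> n (word lams k * x) = j then b ^ j else 0)"
        unfolding sum_product by (intro sum.cong refl) simp
      then show "(\<Sum>i\<le>n. \<Sum>j\<le>n. a ^ i * b ^ j * ?I k i j x) = a ^ ell r \<zeta> n x * b ^ ell r \<zeta> n (word lams k * x)"
        using l by simp
    qed
    finally show ?thesis .
  qed
  have mu: "of_real (mu_seq r \<zeta> n lams i j) = (\<Sum>k\<in>choices lams. \<Sum>x\<in>G. ?I k i j x) / N" for i j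
  proof -
    have "of_real (mu_seq r \<zeta> n lams i j) = (\<Sum>k\<in>choices lams. of_nat (card ((\<lambda>x. word lams k * x) ` Cset r \<zeta> n i \<inter> Cset r \<zeta> n j))) / N"
      by (simp add: mu_seq_eq[OF assms] N_def)
    also have "(\<Sum>k\<in>choices lams. of_nat (card ((\<lambda>x. word lams k * x) ` Cset r \<zeta> n i \<inter> Cset r \<zeta> n j))) = (\<Sum>k\<in>choices lams. \<Sum>x\<in>G. ?I k i j x)"
      by (rule sum.cong) (simp_all only: card_translate[OF word_in_G])
    finally show ?thesis .
  qed
  have "(\<Sum>i\<le>n. \<Sum>j\<le>n. a ^ i * b ^ j * of_real (mu_seq r \<zeta> n lams i j)) =
      (\<Sum>i\<le>n. \<Sum>j\<le>n. \<Sum>k\<in>choices lams. a ^ i * b ^ j * (\<Sum>x\<in>G. ?I k i j x)) / N"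
    unfolding mu by (simp only: sum_divide_distrib sum_distrib_left times_divide_eq_right)
  also have "(\<Sum>i\<le>n. \<Sum>j\<le>n. \<Sum>k\<in>choices lams. a ^ i * b ^ j * (\<Sum>x\<in>G. ?I k i j x)) =
      (\<Sum>i\<le>n. \<Sum>k\<in>choices lams. \<Sum>j\<le>n. a ^ i * b ^ j * (\<Sum>x\<in>G. ?I k i j x))"
    by (intro sum.cong sum.swap refl)
  also have "\<dots> = (\<Sum>k\<in>choices lams. \<Sum>i\<le>n. \<Sum>j\<le>n. a ^ i * b ^ j * (\<Sum>x\<in>G. ?I k i j x))"
    by (rule sum.swap)
  also have "\<dots> = (\<Sum>k\<in>choices lams. \<Sum>x\<in>G. a ^ ell r \<zeta> n x * b ^ ell r \<zeta> n (word lams k * x))"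
    by (rule sum.cong) (simp_all only: inner)
  also have "\<dots> = (\<Sum>x\<in>G. \<Sum>k\<in>choices lams. a ^ ell r \<zeta> n x * b ^ ell r \<zeta> n (word lams k * x))"
    by (rule sum.swap)
  also have "\<dots> = (\<Sum>x\<in>G. a ^ ell r \<zeta> n x * (N * fold avg (map K lams) (\<lambda>x. b ^ ell r \<zeta> n x) x))"
    unfolding N_def
    by (rule sum.cong) (simp_all only: sum_distrib_left[symmetric] sum_choices[OF assms, where g = "\<lambda>x. b ^ ell r \<zeta> n x"])
  also have "\<dots> = N * (\<Sum>x\<in>G. a ^ ell r \<zeta> n x * fold avg (map K lams) (\<lambda>x. b ^ ell r \<zeta> n x) x)"
    by (simp only: sum_distrib_left mult_ac)
  finally show ?thesis
    using N card_G r_pos by (simp add: a_def b_def pairing_def)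
qed

section \<open>Evaluation of the pairings for the five sequences\<close>

abbreviation "B \<equiv> type01 r {#} {#n#}"
abbreviation "D \<equiv> type01 r {#n - 1#} {#1#}"
abbreviation "E \<equiv> type01 r {#n - 1, 1#} {#}"

definition Psi_rep :: "nat multiset list \<Rightarrow> nat \<Rightarrow> nat \<Rightarrow> complex" where
  "Psi_rep la c p = Psi ((r - 1) * c) p (SOME x. x \<in> K la)"

lemma Psi_rep_eq:
  assumes "K la \<noteq> {}" "\<And>k. k \<in> K la \<Longrightarrow> Psi ((r - 1) * c) p k = s"
  shows "Psi_rep la c p = s" "\<forall>k\<in>K la. Psi ((r - 1) * c) p k = Psi_rep la c p"
  using assms some_in_eq[of "K la"] by (auto simp: Psi_rep_def)

text \<open>The inverse of \<open>\<zeta>\<close>: the value of the dual of \<open>\<delta>\<close>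
  on the classes with exactly one cycle of colour 1.\<close>

definition \<omega> :: complex where "\<omega> = \<zeta> ^ (r - 1)"

lemma sum_\<omega>: "(\<Sum>c<r. \<omega> ^ c) = 0"
proof -
  have "\<omega> \<noteq> 1" using \<zeta>_pow_ne[of "r - 1"] r2 by (simp add: \<omega>_def)
  moreover have "\<omega> ^ r = 1" unfolding \<omega>_def by (rule Z_pow_r[OF \<zeta>_pow_in_Z])
  ultimately show ?thesis by (simp add: geometric_sum)
qed

lemma Psi_rep_full:
  assumes "1 \<le> p" "p \<le> n"
  shows "Psi_rep A c p = (-1) ^ (p - 1) * of_nat n" "\<forall>k\<in>K A. Psi ((r - 1) * c) p k = Psi_rep A c p"
    "Psi_rep B c p = \<omega> ^ c * ((-1) ^ (p - 1) * of_nat n)" "\<forall>k\<in>K B. Psi ((r - 1) * c) p k = Psi_rep B c p"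
proof -
  have A: "Psi ((r - 1) * c) p k = (-1) ^ (p - 1) * of_nat n" if "k \<in> K A" for k
    using Psi_full[OF that _ assms] by simp
  have B: "Psi ((r - 1) * c) p k = \<omega> ^ c * ((-1) ^ (p - 1) * of_nat n)" if "k \<in> K B" for k
    using Psi_full[OF that _ assms] by (simp add: \<omega>_def power_mult)
  show "Psi_rep A c p = (-1) ^ (p - 1) * of_nat n" "\<forall>k\<in>K A. Psi ((r - 1) * c) p k = Psi_rep A c p"
    by (rule Psi_rep_eq[OF Kclass_full_nonempty(1) A], assumption)+
  show "Psi_rep B c p = \<omega> ^ c * ((-1) ^ (p - 1) * of_nat n)" "\<forall>k\<in>K B. Psi ((r - 1) * c) p k = Psi_rep B c p"
    by (rule Psi_rep_eq[OF Kclass_full_nonempty(2) B], assumption)+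
qed

lemma Psi_rep_near_full:
  assumes "n \<ge> 2" "1 \<le> p" "p \<le> n"
  defines "s \<equiv> if p = 1 then of_nat n else if p = n then (-1) ^ n * of_nat n else 0"
  shows "Psi_rep D c p = \<omega> ^ c * s" "\<forall>k\<in>K D. Psi ((r - 1) * c) p k = Psi_rep D c p"
    "Psi_rep E c p = s" "\<forall>k\<in>K E. Psi ((r - 1) * c) p k = Psi_rep E c p"
proof -
  have D: "Psi ((r - 1) * c) p k = \<omega> ^ c * s" if "k \<in> K D" for k
    using Psi_near_full[OF that _ assms(2,3)] by (simp add: \<omega>_def power_mult s_def)
  have E: "Psi ((r - 1) * c) p k = s" if "k \<in> K E" for k
    using Psi_near_full[OF that _ assms(2,3)] by (simp add: s_def)
  show "Psi_rep D c p = \<omega> ^ c * s" "\<forall>k\<in>K D. Psi ((r - 1) * c) p k = Psi_rep D c p"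
    by (rule Psi_rep_eq[OF Kclass_near_full_nonempty(1)[OF assms(1)] D], assumption)+
  show "Psi_rep E c p = s" "\<forall>k\<in>K E. Psi ((r - 1) * c) p k = Psi_rep E c p"
    by (rule Psi_rep_eq[OF Kclass_near_full_nonempty(2)[OF assms(1)] E], assumption)+
qed

definition ff :: "nat \<Rightarrow> nat \<Rightarrow> nat \<Rightarrow> complex" where
  "ff M m p = of_nat ((M + n - p) choose n) * of_nat ((m + n - p) choose n)"

text \<open>The extra 1 carried by the trivial twist amounts to lowering \<open>p\<close> by one;
  \<open>p \<ge> 1\<close> makes this possible in natural numbers.\<close>

lemma cc_cc: "1 \<le> p \<Longrightarrow> cc c M p * cc c m p = (if c = 0 then ff M m (p - 1) else ff M m p)"
  by (cases p) (simp_all add: cc_def ff_def)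

text \<open>The trivial twist is separated from the others, whose total weight is
  \<open>r - 1\<close> for \<open>w = 1\<close> and \<open>- 1\<close> for
  \<open>w = \<omega>\<close>.\<close>

lemma sum_if_zero: "(\<Sum>c<r. w ^ c * (if c = 0 then h0 else h1)) = h0 + ((\<Sum>c<r. w ^ c) - 1) * h1" for w :: complex
proof -
  have "(\<Sum>c<r. w ^ c * (if c = 0 then h0 else h1)) = (\<Sum>c<r. w ^ c * h1 + (if c = 0 then h0 - h1 else 0))"
    by (rule sum.cong) auto
  also have "\<dots> = (\<Sum>c<r. w ^ c) * h1 + (h0 - h1)"
    using r_pos by (simp add: sum.distrib sum_distrib_right)
  finally show ?thesis by (simp add: algebra_simps)
qed

text \<open>In all five sequences the product of eigenvalues depends on the twist only through
  \<open>w ^ c\<close>, so a pairing is determined by \<open>w\<close> and the coefficients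
  \<open>h p\<close>.\<close>

lemma pairing_rep:
  assumes "\<forall>la\<in>set lams. K la \<noteq> {}"
    "\<And>la c p. la \<in> set lams \<Longrightarrow> 1 \<le> p \<Longrightarrow> p \<le> n \<Longrightarrow> \<forall>k\<in>K la. Psi ((r - 1) * c) p k = Psi_rep la c p"
    and h: "\<And>c p. 1 \<le> p \<Longrightarrow> p \<le> n \<Longrightarrow>
      (-1) ^ (p - 1) * (of_nat (p * (n choose p)) / of_nat n) *
      prod_list (map (\<lambda>la. Psi_rep la c p / of_nat (p * (n choose p))) lams) = w ^ c * h p"
  shows "pairing (A # lams) M m =
    (\<Sum>p=1..n. h p * ff M m (p - 1)) + ((\<Sum>c<r. w ^ c) - 1) * (\<Sum>p=1..n. h p * ff M m p)"
proof -
  have "pairing (A # lams) M m = (\<Sum>c<r. \<Sum>p=1..n. (-1) ^ (p - 1) * (of_nat (p * (n choose p)) / of_nat n) *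
     prod_list (map (\<lambda>la. Psi_rep la c p / of_nat (p * (n choose p))) lams) * (cc c M p * cc c m p))"
    by (rule pairing_full) (use assms(1,2) in blast)
  also have "\<dots> = (\<Sum>c<r. \<Sum>p=1..n. w ^ c * (if c = 0 then h p * ff M m (p - 1) else h p * ff M m p))"
  proof (intro sum.cong refl)
    fix c p assume "c \<in> {..<r}" "p \<in> {1..n}"
    then have p: "1 \<le> p" "p \<le> n" by auto
    show "(-1) ^ (p - 1) * (of_nat (p * (n choose p)) / of_nat n) *
        prod_list (map (\<lambda>la. Psi_rep la c p / of_nat (p * (n choose p))) lams) * (cc c M p * cc c m p) =
        w ^ c * (if c = 0 then h p * ff M m (p - 1) else h p * ff M m p)"
      unfolding h[OF p] cc_cc[OF p(1)] by simp
  qed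
  also have "\<dots> = (\<Sum>c<r. w ^ c * (if c = 0 then \<Sum>p=1..n. h p * ff M m (p - 1) else \<Sum>p=1..n. h p * ff M m p))"
    by (intro sum.cong refl) (simp add: sum_distrib_left)
  finally show ?thesis by (simp only: sum_if_zero)
qed

text \<open>The signs and the normalizations of the two full classes cancel, leaving the coefficient
  1 for every \<open>p\<close>.\<close>

lemma pairing_AA:
  "pairing [A, A] M m = (\<Sum>p=1..n. ff M m (p - 1)) + (of_nat r - 1) * (\<Sum>p=1..n. ff M m p)"
proof -
  have "pairing [A, A] M m = (\<Sum>p=1..n. 1 * ff M m (p - 1)) + ((\<Sum>c<r. 1 ^ c) - 1) * (\<Sum>p=1..n. 1 * ff M m p)"
  proof (rule pairing_rep)
    fix c p assume p: "1 \<le> p" "p \<le> n"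
    have nz: "of_nat (p * (n choose p)) \<noteq> (0 :: complex)" "of_nat n \<noteq> (0 :: complex)"
      using p by (simp_all add: binomial_eq_0_iff)
    show "(-1) ^ (p - 1) * (of_nat (p * (n choose p)) / of_nat n) *
      prod_list (map (\<lambda>la. Psi_rep la c p / of_nat (p * (n choose p))) [A]) = 1 ^ c * (1 :: complex)"
      using nz by (simp add: Psi_rep_full[OF p] power_mult_distrib[symmetric] del: of_nat_mult)
  qed (use Kclass_full_nonempty Psi_rep_full in auto)
  then show ?thesis by simp
qed

lemma pairing_AB:
  "pairing [A, B] M m = (\<Sum>p=1..n. ff M m (p - 1)) - (\<Sum>p=1..n. ff M m p)"
proof -
  have "pairing [A, B] M m = (\<Sum>p=1..n. 1 * ff M m (p - 1)) + ((\<Sum>c<r. \<omega> ^ c) - 1) * (\<Sum>p=1..n. 1 * ff M m p)"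
  proof (rule pairing_rep)
    fix c p assume p: "1 \<le> p" "p \<le> n"
    have nz: "of_nat (p * (n choose p)) \<noteq> (0 :: complex)" "of_nat n \<noteq> (0 :: complex)"
      using p by (simp_all add: binomial_eq_0_iff)
    show "(-1) ^ (p - 1) * (of_nat (p * (n choose p)) / of_nat n) *
      prod_list (map (\<lambda>la. Psi_rep la c p / of_nat (p * (n choose p))) [B]) = \<omega> ^ c * (1 :: complex)"
      using nz by (simp add: Psi_rep_full[OF p] power_mult_distrib[symmetric] del: of_nat_mult)
  qed (use Kclass_full_nonempty Psi_rep_full in auto)
  then show ?thesis by (simp add: sum_\<omega>)
qed

lemma sum_ends:
  assumes "n \<ge> 2"
  shows "(\<Sum>p=1..n. (if p = 1 then a else if p = n then b else 0) * X p) = a * X 1 + b * (X n :: complex)"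
proof -
  have "(\<Sum>p=1..n. (if p = 1 then a else if p = n then b else 0) * X p) =
      (\<Sum>p\<in>{1, n}. (if p = 1 then a else if p = n then b else 0) * X p)"
    by (rule sum.mono_neutral_right) (use assms in auto)
  then show ?thesis using assms by simp
qed

text \<open>Only \<open>p = 1\<close> and \<open>p = n\<close> survive. The sign at
  \<open>p = n\<close> is \<open>- 1\<close>, since full and nearly full cycles have opposite signs
  as permutations.\<close>

lemma pairing_AD:
  assumes n2: "n \<ge> 2"
  shows "pairing [A, D] M m = ff M m 0 - ff M m (n - 1) - (ff M m 1 - ff M m n)"
proof -
  have "pairing [A, D] M m = (\<Sum>p=1..n. (if p = 1 then 1 else if p = n then - 1 else 0) * ff M m (p - 1)) +
    ((\<Sum>c<r. \<omega> ^ c) - 1) * (\<Sum>p=1..n. (if p = 1 then 1 else if p = n then - 1 else 0) * ff M m p)"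
  proof (rule pairing_rep)
    fix c p assume p: "1 \<le> p" "p \<le> n"
    have "(-1) ^ (n - Suc 0) * ((-1) ^ n :: complex) = - 1"
      using n2 by (cases n) (simp_all add: power_mult_distrib[symmetric])
    then have e: "(-1) ^ (n - Suc 0) * (y * (-1) ^ n) = - y" for y :: complex
      by (simp only: mult.left_commute[of _ y]) simp
    show "(-1) ^ (p - 1) * (of_nat (p * (n choose p)) / of_nat n) *
      prod_list (map (\<lambda>la. Psi_rep la c p / of_nat (p * (n choose p))) [D]) =
      \<omega> ^ c * (if p = 1 then 1 else if p = n then - 1 else 0 :: complex)"
      unfolding list.map prod_list.Cons prod_list.Nil Psi_rep_near_full[OF n2 p] using n2 e by auto
  qed (use Kclass_near_full_nonempty[OF n2] Psi_rep_near_full[OF n2] in auto)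
  then show ?thesis unfolding sum_ends[OF n2] sum_\<omega> by simp
qed

text \<open>Both kinds of class occur twice, so all signs square away and both ends get the
  coefficient 1. At \<open>p = 1\<close> and at \<open>p = n\<close> the normalization
  \<open>p * (n choose p)\<close> is just \<open>n\<close>.\<close>

lemma pairing_AAxE:
  assumes n2: "n \<ge> 2" and "la \<in> {D, E}"
    and x: "\<And>c p. 1 \<le> p \<Longrightarrow> p \<le> n \<Longrightarrow> Psi_rep la c p = w ^ c * (if p = 1 then of_nat n else if p = n then (-1) ^ n * of_nat n else 0)"
  shows "pairing [A, A, la, E] M m = ff M m 0 + ff M m (n - 1) + ((\<Sum>c<r. w ^ c) - 1) * (ff M m 1 + ff M m n)"
proof -
  have "pairing [A, A, la, E] M m = (\<Sum>p=1..n. (if p = 1 then 1 else if p = n then 1 else 0) * ff M m (p - 1)) +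
    ((\<Sum>c<r. w ^ c) - 1) * (\<Sum>p=1..n. (if p = 1 then 1 else if p = n then 1 else 0) * ff M m p)"
  proof (rule pairing_rep)
    fix c p assume p: "1 \<le> p" "p \<le> n"
    have e: "(-1) ^ (n - Suc 0) * ((-1) ^ (n - Suc 0) :: complex) = 1" "(-1) ^ n * ((-1) ^ n :: complex) = 1"
      by (simp_all add: power_mult_distrib[symmetric])
    show "(-1) ^ (p - 1) * (of_nat (p * (n choose p)) / of_nat n) *
      prod_list (map (\<lambda>la. Psi_rep la c p / of_nat (p * (n choose p))) [A, la, E]) =
      w ^ c * (if p = 1 then 1 else if p = n then 1 else 0 :: complex)"
      unfolding list.map prod_list.Cons prod_list.Nil Psi_rep_near_full[OF n2 p] Psi_rep_full[OF p] x[OF p]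
      using n2 e by (auto simp: field_simps)
  qed (use assms(2) Kclass_full_nonempty Psi_rep_full Kclass_near_full_nonempty[OF n2] Psi_rep_near_full[OF n2] in auto)
  then show ?thesis unfolding sum_ends[OF n2] by simp
qed

lemma pairing_AAEE:
  assumes "n \<ge> 2"
  shows "pairing [A, A, E, E] M m = ff M m 0 + ff M m (n - 1) + (of_nat r - 1) * (ff M m 1 + ff M m n)"
  using pairing_AAxE[OF assms, of E 1] Psi_rep_near_full[OF assms] by simp

lemma pairing_AADE:
  assumes "n \<ge> 2"
  shows "pairing [A, A, D, E] M m = ff M m 0 + ff M m (n - 1) - (ff M m 1 + ff M m n)"
  using pairing_AAxE[OF assms, of D \<omega>] Psi_rep_near_full[OF assms] by (simp add: sum_\<omega>)

text \<open>Write \<open>F\<close> for the full sum of the \<open>f p\<close>. Up to the common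
  factor \<open>g\<close>, the first two sequences with their coefficients for
  \<open>n \<ge> 2\<close> add up to \<open>F - (f 0 + f n) / 2\<close>. The third contributes
  \<open>(f 0 - f 1 - f (n - 1) + f n) / 4\<close> and the last two together
  \<open>(f 0 + f 1 + f (n - 1) + f n) / 4\<close>, which is exactly the missing half of the two
  ends. For \<open>n = 1\<close> the ends are all of \<open>F\<close>, so doubling the first two
  contributions is enough.\<close>

lemma sum_mu:
  "(\<Sum>i\<le>n. \<Sum>j\<le>n. of_nat (r * M + 1) ^ i * of_nat (r * m + 1) ^ j * of_real (mu r \<zeta> n i j)) =
    of_nat (card G) * (\<Sum>p\<le>n. ff M m p)"
proof -
  define F where "F = (\<Sum>p\<le>n. ff M m p)"
  define W where "W i j = (of_nat (r * M + 1) ^ i * of_nat (r * m + 1) ^ j :: complex)" for i j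
  define g where "g = (of_nat (card G) :: complex)"
  define q where "q = (of_nat r :: complex)"
  define f where "f = ff M m"
  have q: "q \<noteq> 0" "of_real (real r) = q" using r_pos by (simp_all add: q_def)
  define T where "T la = (\<Sum>i\<le>n. \<Sum>j\<le>n. W i j * of_real (mu_seq r \<zeta> n la i j))" for la
  have T: "T la = g * pairing la M m" if "\<forall>l\<in>set la. K l \<noteq> {}" for la
    unfolding T_def W_def g_def by (rule sum_mu_seq[OF that])
  have S1: "(\<Sum>p=1..n. ff M m (p - 1)) = F - f n"
  proof -
    have "(\<Sum>p=1..n. ff M m (p - 1)) = (\<Sum>p<n. ff M m p)"
      by (rule sum.reindex_bij_witness[of _ Suc "\<lambda>p. p - 1"]) auto
    then show ?thesis by (simp add: F_def f_def lessThan_Suc_atMost[symmetric])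
  qed
  have S2: "(\<Sum>p=1..n. ff M m p) = F - f 0"
  proof -
    have "(\<Sum>p\<le>n. ff M m p) = ff M m 0 + (\<Sum>p=1..n. ff M m p)"
      by (simp add: atMost_atLeast0 sum.atLeast_Suc_atMost)
    then show ?thesis by (simp add: F_def f_def)
  qed
  have AA: "T [A, A] = g * (F - f n + (q - 1) * (F - f 0))"
    using T[of "[A, A]"] Kclass_full_nonempty by (simp only: pairing_AA S1 S2 q_def) simp
  have AB: "T [A, B] = g * (f 0 - f n)"
    using T[of "[A, B]"] Kclass_full_nonempty by (simp only: pairing_AB S1 S2) simp
  show ?thesis unfolding W_def[symmetric] g_def[symmetric] F_def[symmetric]
  proof (cases "n = 1")
    case True
    have mu: "of_real (mu r \<zeta> n i j) = 2 / q * of_real (mu_seq r \<zeta> n [A, A] i j) + (q - 2) / q * of_real (mu_seq r \<zeta> n [A, B] i j)" for i j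
      using True q(2) by (simp add: mu_def Let_def)
    have "(\<Sum>i\<le>n. \<Sum>j\<le>n. W i j * of_real (mu r \<zeta> n i j)) = 2 / q * T [A, A] + (q - 2) / q * T [A, B]"
      unfolding mu T_def by (simp only: distrib_left sum.distrib sum_distrib_left mult.left_commute)
    also have "\<dots> = g * (2 * F - f n - f 0)"
      unfolding AA AB using q(1) by (simp add: field_simps)
    also have "F = f 0 + f n" using True by (simp add: F_def f_def)
    then have "2 * F - f n - f 0 = F" by simp
    finally show "(\<Sum>i\<le>n. \<Sum>j\<le>n. W i j * of_real (mu r \<zeta> n i j)) = g * F" .
  next
    case False
    then have n2: "n \<ge> 2" using n1 by simp
    have AD: "T [A, D] = g * (f 0 - f (n - 1) - (f 1 - f n))"
      using T[of "[A, D]"] Kclass_full_nonempty Kclass_near_full_nonempty[OF n2] by (simp only: pairing_AD[OF n2] f_def) simp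
    have AAEE: "T [A, A, E, E] = g * (f 0 + f (n - 1) + (q - 1) * (f 1 + f n))"
      using T[of "[A, A, E, E]"] Kclass_full_nonempty Kclass_near_full_nonempty[OF n2] by (simp only: pairing_AAEE[OF n2] f_def q_def) simp
    have AADE: "T [A, A, D, E] = g * (f 0 + f (n - 1) - (f 1 + f n))"
      using T[of "[A, A, D, E]"] Kclass_full_nonempty Kclass_near_full_nonempty[OF n2] by (simp only: pairing_AADE[OF n2] f_def) simp
    have mu: "of_real (mu r \<zeta> n i j) = 1 / q * of_real (mu_seq r \<zeta> n [A, A] i j) + (q - 2) / (2 * q) * of_real (mu_seq r \<zeta> n [A, B] i j)
       + 1 / 4 * of_real (mu_seq r \<zeta> n [A, D] i j) + 1 / (2 * q) * of_real (mu_seq r \<zeta> n [A, A, E, E] i j)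
       + (q - 2) / (4 * q) * of_real (mu_seq r \<zeta> n [A, A, D, E] i j)" for i j
      using False q(2) by (simp add: mu_def Let_def)
    have "(\<Sum>i\<le>n. \<Sum>j\<le>n. W i j * of_real (mu r \<zeta> n i j)) = 1 / q * T [A, A] + (q - 2) / (2 * q) * T [A, B]
       + 1 / 4 * T [A, D] + 1 / (2 * q) * T [A, A, E, E] + (q - 2) / (4 * q) * T [A, A, D, E]"
      unfolding mu T_def by (simp only: distrib_left sum.distrib sum_distrib_left mult.left_commute)
    also have "\<dots> = g * F"
      unfolding AA AB AD AAEE AADE using q(1) by (simp add: field_simps)
    finally show "(\<Sum>i\<le>n. \<Sum>j\<le>n. W i j * of_real (mu r \<zeta> n i j)) = g * F" .
  qed
qed

end

section \<open>Descents and compatible sequences\<close>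

text \<open>In terms of power series, one factor of \<open>(1 - t) ^ (N + 1)\<close> is spent on the
  backward difference of \<open>X\<close>.\<close>

lemma alternating_binomial_sum_Suc:
  fixes X :: "nat \<Rightarrow> 'a :: comm_ring_1"
  shows "(\<Sum>m\<le>k. (-1) ^ (k - m) * of_nat (Suc N choose (k - m)) * X m) =
    (\<Sum>m\<le>k. (-1) ^ (k - m) * of_nat (N choose (k - m)) * (X m - (if m = 0 then 0 else X (m - 1))))"
proof -
  have "(\<Sum>m\<le>k. (-1) ^ (k - m) * of_nat (Suc N choose (k - m)) * X m) =
      (\<Sum>m<k. (-1) ^ (k - m) * of_nat (Suc N choose (k - m)) * X m) + X k"
    by (simp add: lessThan_Suc_atMost[symmetric])
  also have "(\<Sum>m<k. (-1) ^ (k - m) * of_nat (Suc N choose (k - m)) * X m) =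
      (\<Sum>m<k. (-1) ^ (k - m) * of_nat (N choose (k - m)) * X m - (-1) ^ (k - Suc m) * of_nat (N choose (k - Suc m)) * X m)"
  proof (rule sum.cong)
    fix m assume "m \<in> {..<k}"
    then obtain j where "k - m = Suc j" "k - Suc m = j" by (metis Suc_diff_Suc lessThan_iff)
    then show "(-1) ^ (k - m) * of_nat (Suc N choose (k - m)) * X m =
        (-1) ^ (k - m) * of_nat (N choose (k - m)) * X m - (-1) ^ (k - Suc m) * of_nat (N choose (k - Suc m)) * X m"
      by (simp add: algebra_simps)
  qed simp
  also have "\<dots> + X k = (\<Sum>m\<le>k. (-1) ^ (k - m) * of_nat (N choose (k - m)) * X m) -
      (\<Sum>m<k. (-1) ^ (k - Suc m) * of_nat (N choose (k - Suc m)) * X m)"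
    by (simp add: sum_subtractf lessThan_Suc_atMost[symmetric])
  also have "(\<Sum>m<k. (-1) ^ (k - Suc m) * of_nat (N choose (k - Suc m)) * X m) =
      (\<Sum>m\<le>k. (-1) ^ (k - m) * of_nat (N choose (k - m)) * (if m = 0 then 0 else X (m - 1)))"
    by (rule sum.reindex_bij_witness_not_neutral[of "{}" "{0}" _ "\<lambda>m. m - 1" Suc]) auto
  finally show ?thesis by (simp add: sum_subtractf right_diff_distrib)
qed

text \<open>For \<open>d \<le> n\<close> the series with coefficients
  \<open>(m + n - d) choose n\<close> is \<open>t ^ d / (1 - t) ^ (n + 1)\<close>; the sum extracts
  a coefficient after multiplication by the denominator.\<close>

lemma binomial_inversion:
  assumes "d \<le> n"
  shows "(\<Sum>m\<le>k. (-1) ^ (k - m) * of_nat (Suc n choose (k - m)) * of_nat ((m + n - d) choose n)) = (if d = k then 1 else 0 :: 'a :: comm_ring_1)"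
  using assms
proof (induction n arbitrary: d k)
  case 0
  have "(\<Sum>m\<le>k. (-1) ^ (k - m) * of_nat (Suc 0 choose (k - m)) * (1 :: 'a)) =
      (\<Sum>m\<le>k. if m = 0 then (-1) ^ k * of_nat (0 choose k) else 0)"
    unfolding alternating_binomial_sum_Suc by (rule sum.cong) auto
  then show ?case using 0 by (cases k) simp_all
next
  case (Suc n)
  have step: "(\<Sum>m\<le>k. (-1) ^ (k - m) * of_nat (Suc (Suc n) choose (k - m)) * of_nat ((m + Suc n - d) choose Suc n)) =
      (if d = k then 1 else 0 :: 'a)" if d: "d \<le> n" for d k
  proof -
    have "of_nat ((m + Suc n - d) choose Suc n) - (if m = 0 then 0 else of_nat ((m - 1 + Suc n - d) choose Suc n)) =
        (of_nat ((m + n - d) choose n) :: 'a)" for m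
    proof (cases m)
      case 0
      show ?thesis
      proof (cases "d = 0")
        case False
        then have "Suc n - d < Suc n" "n - d < n" using d by auto
        then show ?thesis using 0 by (simp add: binomial_eq_0)
      qed (simp add: 0)
    next
      case (Suc l)
      have "m + Suc n - d = Suc (m + n - d)" "m - 1 + Suc n - d = m + n - d" using d Suc by auto
      then show ?thesis using Suc by simp
    qed
    then show ?thesis
      by (subst alternating_binomial_sum_Suc) (simp only: Suc.IH[OF d])
  qed
  show ?case
  proof (cases "d = Suc n")
    case False
    then show ?thesis using step[of d k] Suc.prems by simp
  next
    \<comment> \<open>For \<open>d = Suc n\<close> the term \<open>m = 0\<close> vanishes, and
      lowering \<open>m\<close> by one leads to the case \<open>d = n\<close> already
      treated.\<close>
    case True
    show ?thesis
    proof (cases k)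
      case 0
      then show ?thesis using True by simp
    next
      case (Suc l)
      have "(\<Sum>m\<le>k. (-1) ^ (k - m) * of_nat (Suc (Suc n) choose (k - m)) * of_nat ((m + Suc n - d) choose Suc n)) =
          (\<Sum>m\<le>l. (-1) ^ (l - m) * of_nat (Suc (Suc n) choose (l - m)) * (of_nat ((m + Suc n - n) choose Suc n) :: 'a))"
        unfolding Suc sum.atMost_Suc_shift using True by simp
      also have "\<dots> = (if n = l then 1 else 0)" by (rule step) simp
      finally show ?thesis using True Suc by simp
    qed
  qed
qed

section \<open>Counting decreasing sequences with prescribed drops\<close>

definition dec_seqs :: "nat \<Rightarrow> (nat \<Rightarrow> nat) \<Rightarrow> nat \<Rightarrow> (nat \<Rightarrow> nat) set" where
  "dec_seqs n d m = {a. (\<forall>i\<ge>n. a i = 0) \<and> (\<forall>i<n. a (Suc i) + d i \<le> a i) \<and> a 0 \<le> m}"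

lemma sum_binomial_shift:
  assumes "D \<le> n"
  shows "(\<Sum>c<q. (c + n - D) choose n) = (q + n - D) choose Suc n"
proof (induction q)
  case 0
  have "n - D < Suc n" by simp
  then show ?case by (simp add: binomial_eq_0)
next
  case (Suc q)
  have "Suc q + n - D = Suc (q + n - D)" using assms by simp
  then show ?case using Suc by simp
qed

text \<open>Splitting off the first entry \<open>c\<close> leaves a sequence bounded by
  \<open>c - d 0\<close>; the sum over \<open>c\<close> is the hockey-stick identity.\<close>

lemma card_dec_seqs:
  assumes "\<And>i. i < n \<Longrightarrow> d i \<le> 1"
  shows "finite (dec_seqs n d m) \<and> card (dec_seqs n d m) = (m + n - (\<Sum>i<n. d i)) choose n"
  using assms
proof (induction n arbitrary: d m)
  case 0
  have "dec_seqs 0 d m = {\<lambda>_. 0}" by (auto simp: dec_seqs_def)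
  then show ?case by simp
next
  case (Suc n)
  let ?S = "Sigma {d 0..m} (\<lambda>c. dec_seqs n (d \<circ> Suc) (c - d 0))"
  have d: "(d \<circ> Suc) i \<le> 1" if "i < n" for i using Suc.prems that by simp
  define D where "D = (\<Sum>i<n. (d \<circ> Suc) i)"
  have "D \<le> (\<Sum>i<n. 1)" unfolding D_def by (rule sum_mono) (use d in auto)
  then have D: "D \<le> n" by simp
  have IH': "finite (dec_seqs n (d \<circ> Suc) m) \<and> card (dec_seqs n (d \<circ> Suc) m) = (m + n - D) choose n" for m
    unfolding D_def by (rule Suc.IH) (rule d)
  have IH: "finite (dec_seqs n (d \<circ> Suc) m)" "card (dec_seqs n (d \<circ> Suc) m) = (m + n - D) choose n" for m
    using IH' by blast+
  have "bij_betw (\<lambda>a. (a 0, a \<circ> Suc)) (dec_seqs (Suc n) d m) ?S"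
  proof (rule bij_betwI[of _ _ _ "\<lambda>(c, b). case_nat c b"])
    show "(\<lambda>a. (a 0, a \<circ> Suc)) \<in> dec_seqs (Suc n) d m \<rightarrow> ?S"
    proof
      fix a assume "a \<in> dec_seqs (Suc n) d m"
      then have a: "\<And>i. i \<ge> Suc n \<Longrightarrow> a i = 0" "\<And>i. i < Suc n \<Longrightarrow> a (Suc i) + d i \<le> a i" "a 0 \<le> m"
        by (auto simp: dec_seqs_def)
      show "(a 0, a \<circ> Suc) \<in> ?S" using a(1) a(2)[of 0] a(2)[of "Suc i" for i] a(3) by (auto simp: dec_seqs_def)
    qed
    show "(\<lambda>(c, b). case_nat c b) \<in> ?S \<rightarrow> dec_seqs (Suc n) d m"
    proof
      fix t assume "t \<in> ?S"
      then obtain c b where t: "t = (c, b)" "d 0 \<le> c" "c \<le> m" "b \<in> dec_seqs n (d \<circ> Suc) (c - d 0)" by auto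
      then have b: "\<And>i. i \<ge> n \<Longrightarrow> b i = 0" "\<And>i. i < n \<Longrightarrow> b (Suc i) + d (Suc i) \<le> b i" "b 0 \<le> c - d 0"
        by (auto simp: dec_seqs_def)
      have "case_nat c b i = 0" if "i \<ge> Suc n" for i using that b(1) by (cases i) auto
      moreover have "case_nat c b (Suc i) + d i \<le> case_nat c b i" if "i < Suc n" for i
        using that b(2) b(3) t(2) by (cases i) auto
      ultimately show "(case t of (c, b) \<Rightarrow> case_nat c b) \<in> dec_seqs (Suc n) d m"
        using t by (auto simp: dec_seqs_def)
    qed
    show "(case (a 0, a \<circ> Suc) of (c, b) \<Rightarrow> case_nat c b) = a" for a :: "nat \<Rightarrow> nat"
      by (auto simp: fun_eq_iff split: nat.split)
    show "((case t of (c, b) \<Rightarrow> case_nat c b) 0, (case t of (c, b) \<Rightarrow> case_nat c b) \<circ> Suc) = t" for t :: "nat \<times> (nat \<Rightarrow> nat)"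
      by (cases t) (auto simp: fun_eq_iff)
  qed
  then have fin: "finite (dec_seqs (Suc n) d m) \<longleftrightarrow> finite ?S" and card: "card (dec_seqs (Suc n) d m) = card ?S"
    by (auto dest: bij_betw_finite bij_betw_same_card)
  have "card ?S = (\<Sum>c=d 0..m. (c - d 0 + n - D) choose n)"
    by (subst card_SigmaI) (use IH in auto)
  also have "\<dots> = (\<Sum>c<Suc m - d 0. (c + n - D) choose n)"
    by (rule sum.reindex_bij_witness[of _ "\<lambda>c. c + d 0" "\<lambda>c. c - d 0"]) auto
  also have "\<dots> = (Suc m - d 0 + n - D) choose Suc n" by (rule sum_binomial_shift[OF D])
  also have "Suc m - d 0 + n - D = m + Suc n - (\<Sum>i<Suc n. d i)"
    using Suc.prems[of 0] D by (simp only: sum.lessThan_Suc_shift) (simp add: D_def comp_def)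
  finally have "card ?S = (m + Suc n - (\<Sum>i<Suc n. d i)) choose Suc n" .
  moreover have "finite ?S" using IH by (intro finite_SigmaI) auto
  ultimately show ?case by (simp only: fin card simp_thms)
qed

section \<open>Permutations recovered from the order they induce\<close>

lemma permutes_eq_rank:
  assumes "\<rho> permutes {..<n}" "i < n"
  shows "\<rho> i = card {j. j < n \<and> \<rho> j < \<rho> i}"
proof -
  have lt: "\<rho> j < n \<longleftrightarrow> j < n" for j by (rule permutes_lessThan[OF assms(1)])
  have "\<rho> ` {j. j < n \<and> \<rho> j < \<rho> i} = {..<\<rho> i}"
  proof
    show "{..<\<rho> i} \<subseteq> \<rho> ` {j. j < n \<and> \<rho> j < \<rho> i}"
    proof
      fix k assume k: "k \<in> {..<\<rho> i}"
      then have "k < n" using lt[of i] assms(2) by simp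
      obtain j where "\<rho> j = k" using permutes_surj[OF assms(1)] by (metis surjD)
      then show "k \<in> \<rho> ` {j. j < n \<and> \<rho> j < \<rho> i}" using k \<open>k < n\<close> lt[of j] by auto
    qed
  qed auto
  then have "card {j. j < n \<and> \<rho> j < \<rho> i} = card {..<\<rho> i}"
    using card_image[OF permutes_inj_on[OF assms(1)]] by metis
  then show ?thesis by simp
qed

lemma permutes_eq_if_same_order:
  fixes n :: nat
  assumes "\<rho> permutes {..<n}" "\<rho>' permutes {..<n}"
    and "\<And>i j. i < n \<Longrightarrow> j < n \<Longrightarrow> \<rho> i < \<rho> j \<longleftrightarrow> \<rho>' i < \<rho>' j"
  shows "\<rho> = \<rho>'"
proof
  fix i
  show "\<rho> i = \<rho>' i"
  proof (cases "i < n")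
    case True
    have "{j. j < n \<and> \<rho> j < \<rho> i} = {j. j < n \<and> \<rho>' j < \<rho>' i}" using assms(3) True by blast
    then show ?thesis using permutes_eq_rank[OF assms(1) True] permutes_eq_rank[OF assms(2) True] by simp
  qed (use assms(1,2) in \<open>simp add: permutes_not_in\<close>)
qed

lemma exists_sorting_permutation:
  fixes key :: "nat \<Rightarrow> nat"
  assumes "inj_on key {..<n}"
  obtains \<rho> where "\<rho> permutes {..<n}" "\<And>i j. i < n \<Longrightarrow> j < n \<Longrightarrow> \<rho> i < \<rho> j \<longleftrightarrow> key i < key j"
proof -
  define \<rho> where "\<rho> i = (if i < n then card {j. j < n \<and> key j < key i} else i)" for i
  have mono: "\<rho> i < \<rho> j" if "i < n" "j < n" "key i < key j" for i j
  proof -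
    have "{k. k < n \<and> key k < key i} \<subset> {k. k < n \<and> key k < key j}" using that by auto
    then show ?thesis using that by (simp add: \<rho>_def psubset_card_mono)
  qed
  have iff: "\<rho> i < \<rho> j \<longleftrightarrow> key i < key j" if "i < n" "j < n" for i j
    using mono[OF that] mono[OF that(2,1)] inj_onD[OF assms, of i j] that
    by (metis lessThan_iff linorder_neqE_nat order_less_asym)
  have "inj_on \<rho> {..<n}"
  proof (rule inj_onI)
    fix i j assume ij: "i \<in> {..<n}" "j \<in> {..<n}" "\<rho> i = \<rho> j"
    then have "\<not> key i < key j" "\<not> key j < key i" using iff[of i j] iff[of j i] by auto
    then show "i = j" using inj_onD[OF assms, of i j] ij by simp
  qed
  moreover have "\<rho> i < n" if "i < n" for i
  proof -
    have "{j. j < n \<and> key j < key i} \<subset> {..<n}" using that by auto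
    then have "card {j. j < n \<and> key j < key i} < card {..<n}" by (rule psubset_card_mono[rotated]) simp
    then show ?thesis using that by (simp add: \<rho>_def)
  qed
  then have "\<rho> ` {..<n} \<subseteq> {..<n}" by auto
  ultimately have "bij_betw \<rho> {..<n} {..<n}"
    by (simp add: bij_betw_def endo_inj_surj)
  then have "\<rho> permutes {..<n}" by (rule bij_imp_permutes) (simp add: \<rho>_def)
  then show ?thesis using that iff by blast
qed

section \<open>Sequences compatible with a group element\<close>

context wreath
begin

abbreviation "mp \<equiv> mperm r \<zeta> n"
abbreviation "me \<equiv> mexp r \<zeta> n"

lemma G_data:
  assumes "x \<in> G"
  shows "mp x permutes V" "i < n \<Longrightarrow> me x i < r" "x = gmat n (mp x) (\<lambda>i. \<zeta> ^ me x i)"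
proof -
  obtain \<sigma> u where *: "\<sigma> permutes V" "u \<in> V \<rightarrow>\<^sub>E Z" "x = gmat n \<sigma> u" using assms G_cases by metis
  then have u: "u \<in> V \<rightarrow> Z" by auto
  have e: "me x i < r \<and> u i = \<zeta> ^ me x i" if i: "i < n" for i
  proof -
    obtain e where "e < r" "u i = \<zeta> ^ e" using PiD_Z[OF u i] by (auto simp: Z_def)
    then show ?thesis using mexp_gmat[OF *(1) i, of u e] *(3) by simp
  qed
  have p: "mp x = \<sigma>" unfolding *(3) by (rule mperm_gmat[OF *(1) u])
  show "mp x permutes V" "i < n \<Longrightarrow> me x i < r" "x = gmat n (mp x) (\<lambda>i. \<zeta> ^ me x i)"
    using * e p by (auto intro!: gmat_cong)
qed

lemma gmat_data:
  assumes "\<sigma> permutes V" "\<And>i. i < n \<Longrightarrow> e i < r"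
  defines "x \<equiv> gmat n \<sigma> (\<lambda>i. \<zeta> ^ e i)"
  shows "x \<in> G" "mp x = \<sigma>" "i < n \<Longrightarrow> me x i = e i"
proof -
  have u: "(\<lambda>i. \<zeta> ^ e i) \<in> V \<rightarrow> Z" using \<zeta>_pow_in_Z by auto
  show "x \<in> G" "mp x = \<sigma>" unfolding x_def by (rule gmat_in_G[OF assms(1) u], rule mperm_gmat[OF assms(1) u])
  show "i < n \<Longrightarrow> me x i = e i" unfolding x_def by (rule mexp_gmat[OF assms(1)]) (use assms(2) in auto)
qed

lemma mult_data:
  assumes "x \<in> G" "y \<in> G"
  shows "mp (x * y) = mp x \<circ> mp y" "i < n \<Longrightarrow> me (x * y) i = (me y i + me x (mp y i)) mod r"
proof -
  note x = G_data[OF assms(1)] and y = G_data[OF assms(2)]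
  let ?e = "\<lambda>i. (me y i + me x (mp y i)) mod r"
  have "x * y = gmat n (mp x \<circ> mp y) (\<lambda>b. \<zeta> ^ me x (mp y b) * \<zeta> ^ me y b)"
    by (subst x(3), subst y(3), rule gmat_mult[OF y(1)])
  also have "\<dots> = gmat n (mp x \<circ> mp y) (\<lambda>i. \<zeta> ^ ?e i)"
    by (rule gmat_cong) (simp add: \<zeta>_pow_mod power_add mult.commute)
  finally have eq: "x * y = gmat n (mp x \<circ> mp y) (\<lambda>i. \<zeta> ^ ?e i)" .
  have p: "mp x \<circ> mp y permutes V" by (rule permutes_compose[OF y(1) x(1)])
  have lt: "?e i < r" if "i < n" for i using r_pos by simp
  show "mp (x * y) = mp x \<circ> mp y" "i < n \<Longrightarrow> me (x * y) i = ?e i"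
    unfolding eq using gmat_data[OF p, of ?e] lt by blast+
qed

lemma G_eqI:
  assumes "x \<in> G" "y \<in> G" "mp x = mp y" "\<And>i. i < n \<Longrightarrow> me x i = me y i"
  shows "x = y"
proof -
  have "gmat n (mp x) (\<lambda>i. \<zeta> ^ me x i) = gmat n (mp y) (\<lambda>i. \<zeta> ^ me y i)"
    unfolding assms(3) by (rule gmat_cong) (simp add: assms(4))
  then show ?thesis using G_data(3)[OF assms(1)] G_data(3)[OF assms(2)] by simp
qed

text \<open>Sequences compatible with \<open>x\<close> in the sense of P-partitions: the letter \<open>v i\<close> encodes the pair
  \<open>(a, z)\<close> of a natural number and a colour as \<open>r a - z\<close>.\<close>

definition compat_seqs :: "nat \<Rightarrow> complex mat \<Rightarrow> (nat \<Rightarrow> nat) set" where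
  "compat_seqs m x = {v. (\<forall>i\<ge>n. v i = 0) \<and> (\<forall>i<n. v i \<le> r * m \<and> r dvd v i + me x i) \<and>
     (\<forall>i j. i < j \<and> j < n \<longrightarrow> v j < v i \<or> v i = v j \<and> mp x i < mp x j)}"

text \<open>Numerical, so that it can act as the required drop in \<open>dec_seqs\<close>. At the
  last index the comparison is with \<open>me x n = 0\<close> and \<open>mp x n = n\<close>.\<close>

definition desc :: "complex mat \<Rightarrow> nat \<Rightarrow> nat" where
  "desc x i = (if me x i > me x (Suc i) \<or> me x i = me x (Suc i) \<and> mp x i > mp x (Suc i) then 1 else 0)"

lemma des_eq_sum: "des r \<zeta> n x = (\<Sum>i<n. desc x i)"
proof -
  have "(\<Sum>i<n. desc x i) = card {i \<in> V. me x i > me x (Suc i) \<or> me x i = me x (Suc i) \<and> mp x i > mp x (Suc i)}"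
    unfolding desc_def by (subst sum.inter_filter[symmetric]) auto
  then show ?thesis by (simp add: des_def)
qed

lemma des_le: "des r \<zeta> n x \<le> n"
proof -
  have "(\<Sum>i<n. desc x i) \<le> (\<Sum>i<n. 1)" by (rule sum_mono) (simp add: desc_def)
  then show ?thesis by (simp add: des_eq_sum)
qed

lemma me_ge: "i \<ge> n \<Longrightarrow> me x i = 0" and mp_ge: "i \<ge> n \<Longrightarrow> mp x i = i"
  by (simp_all add: mexp_def mperm_def)

text \<open>The quotient \<open>a\<close> satisfies \<open>r a = v + me x\<close>. At a descent the
  order of the letters makes \<open>v + me x\<close> drop strictly, hence also \<open>a\<close>;
  elsewhere \<open>v + me x\<close> increases by less than \<open>r\<close>, so \<open>a\<close>
  cannot increase.\<close>

lemma compat_to_dec_seqs: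
  assumes x: "x \<in> G" and v: "v \<in> compat_seqs m x"
  shows "(\<lambda>i. (v i + me x i) div r) \<in> dec_seqs n (desc x) m"
proof -
  define a where "a i = (v i + me x i) div r" for i
  note xd = G_data[OF x]
  have v0: "\<And>i. i \<ge> n \<Longrightarrow> v i = 0" and v1: "\<And>i. i < n \<Longrightarrow> v i \<le> r * m" "\<And>i. i < n \<Longrightarrow> r dvd v i + me x i"
    and v2: "\<And>i j. i < j \<Longrightarrow> j < n \<Longrightarrow> v j < v i \<or> v i = v j \<and> mp x i < mp x j"
    using v by (auto simp: compat_seqs_def)
  have ra: "r * a i = v i + me x i" for i
    using v1(2)[of i] v0[of i] me_ge[of i] by (cases "i < n") (simp_all add: a_def)
  have a0: "a i = 0" if "i \<ge> n" for i using v0[OF that] me_ge[OF that] by (simp add: a_def)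
  have lt: "a i < a j" if "v i + me x i < v j + me x j" for i j
  proof -
    have "r * a i < r * a j" using that by (simp only: ra)
    then show ?thesis by simp
  qed
  have "a 0 \<le> m"
  proof -
    have "r * a 0 < r * Suc m" using ra[of 0] v1(1)[of 0] xd(2)[of 0] n1 by simp
    then show ?thesis by (metis less_Suc_eq_le mult_less_cancel1)
  qed
  moreover have "a (Suc i) + desc x i \<le> a i" if i: "i < n" for i
  proof -
    \<comment> \<open>At the last index the comparison is with the conventional values
      \<open>v n = 0\<close> and \<open>mp x n = n\<close>, and still holds.\<close>
    have ord: "v (Suc i) < v i \<or> v i = v (Suc i) \<and> mp x i < mp x (Suc i)"
    proof (cases "Suc i < n")
      case False
      then have "Suc i = n" using i by simp
      then have "v (Suc i) = 0" "mp x (Suc i) = n" using v0[of n] mp_ge[of n] by simp_all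
      moreover have "mp x i < n" using permutes_lessThan[OF xd(1)] i by simp
      ultimately show ?thesis by auto
    qed (use v2 in simp)
    show ?thesis
    proof (cases "desc x i = 1")
      case True
      then have "me x (Suc i) < me x i \<or> me x i = me x (Suc i) \<and> mp x (Suc i) < mp x i"
        by (auto simp: desc_def split: if_splits)
      then have "v (Suc i) + me x (Suc i) < v i + me x i" using ord by auto
      then show ?thesis using lt True by fastforce
    next
      case False
      then have d: "desc x i = 0" by (simp add: desc_def split: if_splits)
      have "me x (Suc i) < r" using xd(2)[of "Suc i"] me_ge[of "Suc i"] r_pos by (cases "Suc i < n") simp_all
      then have "v (Suc i) + me x (Suc i) < v i + me x i + r" using ord by auto
      then have "r * a (Suc i) < r * Suc (a i)" using ra[of i] ra[of "Suc i"] by simp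
      then have "a (Suc i) < Suc (a i)" by (simp only: mult_less_cancel1)
      then show ?thesis using d by simp
    qed
  qed
  ultimately show ?thesis using a0 by (simp add: dec_seqs_def a_def)
qed

text \<open>Guarantees that the subtraction in the inverse map is not truncated. Going down from
  index \<open>n\<close>, the exponent can exceed the next one only at a descent, where
  \<open>a\<close> is positive and \<open>r\<close> exceeds any exponent.\<close>

lemma dec_seqs_bound:
  assumes x: "x \<in> G" and a: "a \<in> dec_seqs n (desc x) m"
  shows "i \<le> n \<Longrightarrow> me x i \<le> r * a i"
proof (induction i rule: inc_induct)
  case base
  then show ?case by (simp add: me_ge)
next
  case (step i)
  have ai: "a (Suc i) + desc x i \<le> a i" using a step by (simp add: dec_seqs_def)
  show ?case
  proof (cases "desc x i = 1")
    case True
    then have "1 \<le> a i" using ai by simp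
    then have "r \<le> r * a i" using mult_le_mono2[of 1 "a i" r] by simp
    moreover have "me x i < r" using G_data(2)[OF x] step by blast
    ultimately show ?thesis by linarith
  next
    case False
    then have "me x i \<le> me x (Suc i)" by (auto simp: desc_def split: if_splits)
    also have "\<dots> \<le> r * a (Suc i)" by (rule step)
    also have "\<dots> \<le> r * a i" using ai by simp
    finally show ?thesis .
  qed
qed

lemma dec_seqs_to_compat:
  assumes x: "x \<in> G" and a: "a \<in> dec_seqs n (desc x) m"
  shows "(\<lambda>i. r * a i - me x i) \<in> compat_seqs m x"
proof -
  note xd = G_data[OF x]
  define v where "v i = r * a i - me x i" for i
  have a0: "\<And>i. i \<ge> n \<Longrightarrow> a i = 0" and a1: "\<And>i. i < n \<Longrightarrow> a (Suc i) + desc x i \<le> a i" and am: "a 0 \<le> m"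
    using a by (auto simp: dec_seqs_def)
  have v: "v i + me x i = r * a i" for i
    using dec_seqs_bound[OF x a, of i] me_ge[of i] by (cases "i \<le> n") (simp_all add: v_def)
  have ale: "a i \<le> m" if "i \<le> n" for i
    using that
  proof (induction i)
    case (Suc i) then show ?case using a1[of i] by simp
  qed (use am in simp)
  have adj: "v (Suc i) < v i \<or> v i = v (Suc i) \<and> mp x i < mp x (Suc i)" if i: "Suc i < n" for i
  proof -
    have ai: "a (Suc i) + desc x i \<le> a i" using a1 i by simp
    have zlt: "me x i < r" using xd(2) i by simp
    consider "desc x i = 1" | "me x i < me x (Suc i)" "desc x i = 0"
      | "me x i = me x (Suc i)" "mp x i \<le> mp x (Suc i)" "desc x i = 0"
      by (cases "me x i < me x (Suc i)"; cases "me x i = me x (Suc i)"; cases "mp x i \<le> mp x (Suc i)";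
          simp add: desc_def)
    then show ?thesis
    proof cases
      case 1
      then have "r * (a (Suc i) + 1) \<le> r * a i" using ai by (intro mult_le_mono2) simp
      then have "v (Suc i) + me x (Suc i) + r \<le> v i + me x i" by (simp add: v)
      then show ?thesis using zlt by linarith
    next
      case 2
      have "r * a (Suc i) \<le> r * a i" using ai by (intro mult_le_mono2) simp
      then have "v (Suc i) + me x (Suc i) \<le> v i + me x i" by (simp only: v)
      then show ?thesis using 2 by linarith
    next
      case 3
      have "r * a (Suc i) \<le> r * a i" using ai by (intro mult_le_mono2) simp
      then have "v (Suc i) + me x (Suc i) \<le> v i + me x i" by (simp only: v)
      moreover have "mp x i \<noteq> mp x (Suc i)" using permutes_inj[OF xd(1)] by (simp add: inj_eq)
      ultimately show ?thesis using 3 by linarith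
    qed
  qed
  \<comment> \<open>The relation is transitive, so it is enough to have compared neighbours.\<close>
  have ord: "v j < v i \<or> v i = v j \<and> mp x i < mp x j" if "i < j" "j < n" for i j
    using that(1)[folded Suc_le_eq] that(2)
  proof (induction j rule: dec_induct)
    case base then show ?case using adj by simp
  next
    case (step j)
    then have "v j < v i \<or> v i = v j \<and> mp x i < mp x j" by simp
    then show ?case using adj[of j] step.prems by auto
  qed
  have "v i = 0" if "i \<ge> n" for i using that a0 me_ge by (simp add: v_def)
  moreover have "v i \<le> r * m" if "i < n" for i
  proof -
    have "r * a i \<le> r * m" using ale[of i] that by simp
    then show ?thesis unfolding v_def by (rule le_trans[OF diff_le_self])
  qed
  moreover have "r dvd v i + me x i" for i by (simp add: v)
  ultimately have "v \<in> compat_seqs m x" using ord by (simp add: compat_seqs_def)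
  moreover have "v = (\<lambda>i. r * a i - me x i)" by (simp add: fun_eq_iff v_def)
  ultimately show ?thesis by simp
qed

lemma card_compat:
  assumes x: "x \<in> G"
  shows "finite (compat_seqs m x)" "card (compat_seqs m x) = (m + n - des r \<zeta> n x) choose n"
proof -
  have bij: "bij_betw (\<lambda>v i. (v i + me x i) div r) (compat_seqs m x) (dec_seqs n (desc x) m)"
  proof (rule bij_betwI[of _ _ _ "\<lambda>a i. r * a i - me x i"])
    show "(\<lambda>v i. (v i + me x i) div r) \<in> compat_seqs m x \<rightarrow> dec_seqs n (desc x) m"
      using compat_to_dec_seqs[OF x] by blast
    show "(\<lambda>a i. r * a i - me x i) \<in> dec_seqs n (desc x) m \<rightarrow> compat_seqs m x"
      using dec_seqs_to_compat[OF x] by blast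
    show "(\<lambda>i. r * ((v i + me x i) div r) - me x i) = v" if v: "v \<in> compat_seqs m x" for v
    proof
      fix i
      have "r dvd v i + me x i" using v me_ge[of i] by (cases "i < n") (auto simp: compat_seqs_def)
      then show "r * ((v i + me x i) div r) - me x i = v i" by simp
    qed
    show "(\<lambda>i. (r * a i - me x i + me x i) div r) = a" if a: "a \<in> dec_seqs n (desc x) m" for a
    proof
      fix i
      have "me x i \<le> r * a i" using dec_seqs_bound[OF x a, of i] me_ge[of i] by (cases "i \<le> n") simp_all
      then show "(r * a i - me x i + me x i) div r = a i" using r_pos by simp
    qed
  qed
  have d: "desc x i \<le> 1" for i by (simp add: desc_def)
  note c = card_dec_seqs[of n "desc x" m, OF d]
  show "finite (compat_seqs m x)" using bij_betw_finite[OF bij] c by simp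
  show "card (compat_seqs m x) = (m + n - des r \<zeta> n x) choose n"
    using bij_betw_same_card[OF bij] c by (simp add: des_eq_sum)
qed

section \<open>Merging two sequences along a factorization\<close>

text \<open>The pair \<open>(w i, v (\<rho> i))\<close> written in base \<open>r m + 1\<close>,
  which orders pairs lexicographically as \<open>v\<close> is at most \<open>r m\<close>. The
  largest value \<open>(r m + 1) r m' + r m\<close> equals \<open>r (r m m' + m + m')\<close>, and
  since the base is 1 modulo \<open>r\<close>, the residues of the two letters add.\<close>

definition merge_seqs :: "nat \<Rightarrow> (nat \<Rightarrow> nat) \<Rightarrow> (nat \<Rightarrow> nat) \<Rightarrow> (nat \<Rightarrow> nat) \<Rightarrow> nat \<Rightarrow> nat" where
  "merge_seqs m \<rho> v w i = (if i < n then (r * m + 1) * w i + v (\<rho> i) else 0)"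

definition factor_seqs :: "nat \<Rightarrow> nat \<Rightarrow> complex mat \<Rightarrow> ((complex mat \<times> complex mat) \<times> (nat \<Rightarrow> nat) \<times> (nat \<Rightarrow> nat)) set" where
  "factor_seqs m m' z = Sigma {(x, y). x \<in> G \<and> y \<in> G \<and> x * y = z} (\<lambda>(x, y). compat_seqs m x \<times> compat_seqs m' y)"

lemma compat_seqsD:
  assumes "v \<in> compat_seqs m x"
  shows "i \<ge> n \<Longrightarrow> v i = 0" "i < n \<Longrightarrow> v i \<le> r * m" "i < n \<Longrightarrow> r dvd v i + me x i"
    "i < j \<Longrightarrow> j < n \<Longrightarrow> v j < v i \<or> v i = v j \<and> mp x i < mp x j"
  using assms by (auto simp: compat_seqs_def)

lemma merge_in_compat_seqs:
  assumes xy: "x \<in> G" "y \<in> G" and v: "v \<in> compat_seqs m x" and w: "w \<in> compat_seqs m' y"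
  shows "merge_seqs m (mp y) v w \<in> compat_seqs (r * m * m' + m + m') (x * y)"
proof -
  note vD = compat_seqsD[OF v] and wD = compat_seqsD[OF w]
  have lt: "mp y i < n \<longleftrightarrow> i < n" for i by (rule permutes_lessThan[OF G_data(1)[OF xy(2)]])
  have vle: "v (mp y i) \<le> r * m" if "i < n" for i using vD(2) lt that by simp
  have "merge_seqs m (mp y) v w i \<le> r * (r * m * m' + m + m')" if i: "i < n" for i
  proof -
    have "(r * m + 1) * w i \<le> (r * m + 1) * (r * m')" using wD(2)[OF i] by (rule mult_le_mono2)
    then have "merge_seqs m (mp y) v w i \<le> (r * m + 1) * (r * m') + r * m" using vle[OF i] i by (simp add: merge_seqs_def)
    also have "\<dots> = r * (r * m * m' + m + m')" by (simp add: algebra_simps)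
    finally show ?thesis .
  qed
  moreover have "r dvd merge_seqs m (mp y) v w i + me (x * y) i" if i: "i < n" for i
  proof -
    \<comment> \<open>Modulo \<open>r\<close> the merged letter is \<open>w i + v (mp y i)\<close>,
      so the two divisibility conditions add up to the one for the exponents of
      \<open>x * y\<close>.\<close>
    have "r dvd r * (m * w i) + (w i + me y i) + (v (mp y i) + me x (mp y i))"
      using vD(3)[of "mp y i"] lt[of i] i by (intro dvd_add[OF dvd_add[OF dvd_triv_left wD(3)[OF i]]]) simp
    then have "r dvd merge_seqs m (mp y) v w i + (me y i + me x (mp y i))"
      using i by (simp add: merge_seqs_def algebra_simps)
    then show ?thesis
      by (simp add: mult_data(2)[OF xy i] dvd_eq_mod_eq_0 mod_add_right_eq)
  qed
  moreover have "merge_seqs m (mp y) v w j < merge_seqs m (mp y) v w i \<or>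
      merge_seqs m (mp y) v w i = merge_seqs m (mp y) v w j \<and> mp (x * y) i < mp (x * y) j" if ij: "i < j" "j < n" for i j
    using wD(4)[OF ij]
  proof
    assume "w j < w i"
    then have "(r * m + 1) * (w j + 1) \<le> (r * m + 1) * w i" by (intro mult_le_mono2) simp
    then have "(r * m + 1) * w j + v (mp y j) < (r * m + 1) * w i" using vle[OF ij(2)] by simp
    then show ?thesis using ij by (simp add: merge_seqs_def)
  next
    assume "w i = w j \<and> mp y i < mp y j"
    then show ?thesis
      using vD(4)[of "mp y i" "mp y j"] lt[of j] ij by (auto simp: merge_seqs_def mult_data(1)[OF xy])
  qed
  ultimately show ?thesis by (simp add: compat_seqs_def merge_seqs_def)
qed

text \<open>The order of \<open>mp y\<close> is visible from the letters \<open>v (mp y i)\<close>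
  and the product alone: decreasing letters, ties broken by the product. This is what allows the
  factor \<open>y\<close> to be recovered from a merged sequence.\<close>

lemma sorting_order:
  assumes xy: "x \<in> G" "y \<in> G" and v: "v \<in> compat_seqs m x" and ij: "i < n" "j < n"
  shows "mp y i < mp y j \<longleftrightarrow> v (mp y j) < v (mp y i) \<or> v (mp y i) = v (mp y j) \<and> mp (x * y) i < mp (x * y) j"
proof -
  note vD = compat_seqsD[OF v]
  have lt: "mp y i < n \<longleftrightarrow> i < n" for i by (rule permutes_lessThan[OF G_data(1)[OF xy(2)]])
  have fwd: "v (mp y j) < v (mp y i) \<or> v (mp y i) = v (mp y j) \<and> mp (x * y) i < mp (x * y) j"
    if "mp y i < mp y j" "i < n" "j < n" for i j
    using vD(4)[OF that(1)] lt that by (simp add: mult_data(1)[OF xy])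
  show ?thesis
    using fwd[of i j] fwd[of j i] ij permutes_inj[OF G_data(1)[OF xy(2)]]
    by (metis injD linorder_neqE_nat order_less_asym order_less_irrefl)
qed

lemma merge_split:
  assumes "v (\<rho> i) \<le> r * m" "i < n"
  shows "merge_seqs m \<rho> v w i div (r * m + 1) = w i" "merge_seqs m \<rho> v w i mod (r * m + 1) = v (\<rho> i)"
proof -
  define N where "N = r * m + 1"
  have lt: "v (\<rho> i) < N" "N \<noteq> 0" using assms by (simp_all add: N_def)
  have eq: "merge_seqs m \<rho> v w i = N * w i + v (\<rho> i)" using assms(2) by (simp add: merge_seqs_def N_def)
  show "merge_seqs m \<rho> v w i div (r * m + 1) = w i" "merge_seqs m \<rho> v w i mod (r * m + 1) = v (\<rho> i)"
    unfolding eq N_def[symmetric] using lt by simp_all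
qed

lemma G_cancel_right:
  assumes "x \<in> G" "x' \<in> G" "y \<in> G" "x * y = x' * y"
  shows "x = x'"
proof -
  obtain y' where y': "y' \<in> G" "y * y' = 1\<^sub>m n" using G_inverse[OF assms(3)] by metis
  have "x * y * y' = x' * y * y'" using assms(4) by simp
  then show ?thesis
    using assms(1-3) y' G_carrier by (simp add: assoc_mult_mat[of _ n n _ n _ n] right_mult_one_mat[of _ n n])
qed

text \<open>Quotient and remainder return \<open>w\<close> and the rearranged \<open>v\<close>. The
  latter together with \<open>z\<close> fixes the permutation of \<open>y\<close> by
  \<open>sorting_order\<close>, \<open>w\<close> modulo \<open>r\<close> fixes its exponents, and
  \<open>x\<close> follows by cancellation.\<close>

lemma inj_on_merge:
  "inj_on (\<lambda>((x, y), v, w). merge_seqs m (mp y) v w) (factor_seqs m m' z)"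
proof (rule inj_onI)
  fix s t assume st: "s \<in> factor_seqs m m' z" "t \<in> factor_seqs m m' z"
    and eq0: "(\<lambda>((x, y), v, w). merge_seqs m (mp y) v w) s = (\<lambda>((x, y), v, w). merge_seqs m (mp y) v w) t"
  obtain x y v w where s: "s = ((x, y), v, w)" "x \<in> G" "y \<in> G" "x * y = z" "v \<in> compat_seqs m x" "w \<in> compat_seqs m' y"
    using st(1) by (auto simp: factor_seqs_def)
  obtain x' y' v' w' where t: "t = ((x', y'), v', w')" "x' \<in> G" "y' \<in> G" "x' * y' = z" "v' \<in> compat_seqs m x'" "w' \<in> compat_seqs m' y'"
    using st(2) by (auto simp: factor_seqs_def)
  have eq: "merge_seqs m (mp y) v w = merge_seqs m (mp y') v' w'" using eq0 by (simp add: s(1) t(1))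
  note vD = compat_seqsD[OF s(5)] and wD = compat_seqsD[OF s(6)] and vD' = compat_seqsD[OF t(5)] and wD' = compat_seqsD[OF t(6)]
  have p: "mp y permutes V" "mp y' permutes V" using G_data(1) s t by blast+
  have lt: "mp y i < n \<longleftrightarrow> i < n" "mp y' i < n \<longleftrightarrow> i < n" for i
    using permutes_lessThan p by blast+
  have 1: "w i = w' i" "v (mp y i) = v' (mp y' i)" if i: "i < n" for i
    using merge_split[of v "mp y" i m w] merge_split[of v' "mp y'" i m w'] vD(2) vD'(2) lt i eq by auto
  have ww: "w = w'"
  proof
    fix i show "w i = w' i" using 1(1)[of i] wD(1)[of i] wD'(1)[of i] by (cases "i < n") simp_all
  qed
  have mpy: "mp y = mp y'"
  proof (rule permutes_eq_if_same_order[OF p])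
    fix i j assume ij: "i < n" "j < n"
    show "mp y i < mp y j \<longleftrightarrow> mp y' i < mp y' j"
      unfolding sorting_order[OF s(2,3,5) ij] sorting_order[OF t(2,3,5) ij] s(4) t(4)
      using 1(2) ij by simp
  qed
  have "y = y'"
  proof (rule G_eqI[OF s(3) t(3) mpy])
    fix i assume i: "i < n"
    have "(w i + me y i) mod r = (w i + me y' i) mod r"
      using wD(3)[OF i] wD'(3)[OF i] ww by (simp add: dvd_eq_mod_eq_0)
    then have "me y i mod r = me y' i mod r" by (simp add: nat_mod_eq_iff)
    then show "me y i = me y' i" using G_data(2)[OF s(3) i] G_data(2)[OF t(3) i] by simp
  qed
  moreover have "x = x'" using G_cancel_right[OF s(2) t(2) s(3)] s(4) t(4) \<open>y = y'\<close> by simp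
  moreover have "v = v'"
  proof
    fix j
    show "v j = v' j"
    proof (cases "j < n")
      case True
      obtain i where i: "mp y i = j" using permutes_surj[OF p(1)] by (metis surjD)
      then have "i < n" using lt(1)[of i] True by simp
      then show ?thesis using 1(2)[of i] mpy i by simp
    qed (use vD(1) vD'(1) in simp)
  qed
  ultimately show "s = t" using s(1) t(1) ww by simp
qed

text \<open>Runs the recovery backwards: the remainders \<open>q\<close> dictate the permutation of
  \<open>y\<close>, the quotients \<open>w\<close> its exponents, and \<open>x\<close> is what is
  left of \<open>z\<close>. Compatibility of both parts is then the lexicographic order of
  \<open>u\<close> read digit by digit.\<close>

lemma merge_surj:
  assumes z: "z \<in> G" and u: "u \<in> compat_seqs (r * m * m' + m + m') z"
  shows "\<exists>x\<in>G. \<exists>y\<in>G. \<exists>v\<in>compat_seqs m x. \<exists>w\<in>compat_seqs m' y. x * y = z \<and> merge_seqs m (mp y) v w = u"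
proof -
  define N where "N = r * m + 1"
  define q where "q i = u i mod N" for i
  define w where "w i = u i div N" for i
  note uD = compat_seqsD[OF u]
  have uqw: "u i = N * w i + q i" for i by (simp add: q_def w_def)
  have qle: "q i \<le> r * m" for i
  proof -
    have "q i < N" unfolding q_def by (rule mod_less_divisor) (simp add: N_def)
    then show ?thesis by (simp add: N_def)
  qed
  have zp: "mp z permutes V" using G_data(1)[OF z] .
  have zlt: "mp z i < n \<longleftrightarrow> i < n" for i by (rule permutes_lessThan[OF zp])
  \<comment> \<open>One natural number for the lexicographic order by decreasing \<open>q\<close>,
    then increasing \<open>mp z\<close>; the factor \<open>n\<close> leaves room for the second
    entry.\<close>
  define key where "key i = (r * m - q i) * n + mp z i" for i
  have key_less: "key i < key j" if "i < n" "j < n" "q j < q i" for i j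
  proof -
    have "r * m - q i + 1 \<le> r * m - q j" using that(3) qle[of i] by linarith
    then have "(r * m - q i + 1) * n \<le> (r * m - q j) * n" by (rule mult_le_mono1)
    then have "(r * m - q i) * n + n \<le> (r * m - q j) * n" by (simp add: algebra_simps)
    moreover have "mp z i < n" using zlt that(1) by simp
    ultimately show ?thesis unfolding key_def by linarith
  qed
  have key_iff: "key i < key j \<longleftrightarrow> q j < q i \<or> q i = q j \<and> mp z i < mp z j" if "i < n" "j < n" for i j
  proof -
    consider "q j < q i" | "q i < q j" | "q i = q j" by linarith
    then show ?thesis
    proof cases
      case 1 then show ?thesis using key_less[OF that 1] by simp
    next
      case 2 then show ?thesis using key_less[OF that(2,1) 2] by simp
    next
      case 3 then show ?thesis by (simp add: key_def)
    qed
  qed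
  have "inj_on key V"
  proof (rule inj_onI)
    fix i j assume ij: "i \<in> V" "j \<in> V" "key i = key j"
    then have lt: "i < n" "j < n" by auto
    have "\<not> key i < key j" "\<not> key j < key i" using ij by auto
    then have "q i = q j" "mp z i = mp z j" unfolding key_iff[OF lt] key_iff[OF lt(2,1)] by linarith+
    then show "i = j" using permutes_inj[OF zp] by (simp add: inj_eq)
  qed
  then obtain \<rho> where \<rho>: "\<rho> permutes V" "\<And>i j. i < n \<Longrightarrow> j < n \<Longrightarrow> \<rho> i < \<rho> j \<longleftrightarrow> key i < key j"
    using exists_sorting_permutation by blast
  have \<rho>lt: "\<rho> i < n \<longleftrightarrow> i < n" for i by (rule permutes_lessThan[OF \<rho>(1)])
  \<comment> \<open>The exponent congruent to \<open>- w i\<close> modulo \<open>r\<close>; the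
    outer \<open>mod\<close> turns the value \<open>r\<close> into 0 when \<open>r\<close> divides
    \<open>w i\<close>.\<close>
  define t where "t i = (r - w i mod r) mod r" for i
  have t: "t i < r" "r dvd w i + t i" for i
  proof -
    show "t i < r" using r_pos by (simp add: t_def)
    have "(w i + t i) mod r = (w i mod r + (r - w i mod r)) mod r" by (simp add: t_def mod_simps)
    also have "w i mod r + (r - w i mod r) = r" using mod_less_divisor[OF r_pos, of "w i"] by linarith
    finally show "r dvd w i + t i" by (simp add: dvd_eq_mod_eq_0)
  qed
  define y where "y = gmat n \<rho> (\<lambda>i. \<zeta> ^ t i)"
  have y: "y \<in> G" "mp y = \<rho>" "\<And>i. i < n \<Longrightarrow> me y i = t i"
    unfolding y_def using gmat_data[OF \<rho>(1), of t] t(1) by blast+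
  obtain y' where y': "y' \<in> G" "y' * y = 1\<^sub>m n" using G_inverse[OF y(1)] by metis
  define x where "x = z * y'"
  have x: "x \<in> G" using G_mult[OF z y'(1)] by (simp add: x_def)
  have xy: "x * y = z"
    unfolding x_def using assoc_mult_mat[OF G_carrier[OF z] G_carrier[OF y'(1)] G_carrier[OF y(1)]] y'(2)
      right_mult_one_mat[OF G_carrier[OF z]] by simp
  define v where "v j = (if j < n then q (perm_inv \<rho> j) else 0)" for j
  have v\<rho>: "v (\<rho> i) = q i" if "i < n" for i
    using that \<rho>lt by (simp add: v_def permutes_inverses[OF \<rho>(1)])
  have mpx: "mp x (\<rho> i) = mp z i" for i
    using mult_data(1)[OF x y(1)] xy y(2) by (simp add: fun_eq_iff)
  have W: "w \<in> compat_seqs m' y"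
  proof -
    have "w i = 0" if "i \<ge> n" for i using uD(1)[OF that] by (simp add: w_def)
    moreover have "w i \<le> r * m'" if i: "i < n" for i
    proof -
      have "u i < N * (r * m' + 1)"
        using uD(2)[OF i] by (simp add: N_def algebra_simps)
      then have "w i < r * m' + 1" unfolding w_def by (simp add: less_mult_imp_div_less mult.commute)
      then show ?thesis by simp
    qed
    moreover have "r dvd w i + me y i" if "i < n" for i using t(2) y(3)[OF that] by simp
    moreover have "w j < w i \<or> w i = w j \<and> mp y i < mp y j" if ij: "i < j" "j < n" for i j
    proof -
      have "u j \<le> u i" using uD(4)[OF ij] by auto
      then have "w j \<le> w i" unfolding w_def by (rule div_le_mono)
      moreover have "\<rho> i < \<rho> j" if "w i = w j"
      proof -
        have "q j < q i \<or> q i = q j \<and> mp z i < mp z j"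
          using uD(4)[OF ij] uqw[of i] uqw[of j] that by auto
        then show ?thesis using \<rho>(2)[of i j] key_iff[of i j] ij by simp
      qed
      ultimately show ?thesis unfolding y(2) by linarith
    qed
    ultimately show ?thesis by (simp add: compat_seqs_def)
  qed
  have X: "v \<in> compat_seqs m x"
  proof -
    have inv: "\<exists>i<n. j = \<rho> i" if "j < n" for j
      using that \<rho>lt[of "perm_inv \<rho> j"] by (intro exI[of _ "perm_inv \<rho> j"]) (simp add: permutes_inverses[OF \<rho>(1)])
    have "v j \<le> r * m" for j using qle by (simp add: v_def)
    moreover have "r dvd v j + me x j" if jn: "j < n" for j
    proof -
      obtain i where i: "i < n" "j = \<rho> i" using inv[OF jn] by blast
      have "me z i = (t i + me x (\<rho> i)) mod r"
        using mult_data(2)[OF x y(1) i(1)] y i(1) by (simp add: xy)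
      then have "r dvd u i + (t i + me x (\<rho> i))"
        using uD(3)[OF i(1)] by (simp add: dvd_eq_mod_eq_0 mod_add_right_eq)
      then have "r dvd (r * (m * w i) + (w i + t i)) + (q i + me x (\<rho> i))"
        unfolding uqw by (simp add: N_def algebra_simps)
      moreover have "r dvd r * (m * w i) + (w i + t i)" by (rule dvd_add[OF dvd_triv_left t(2)])
      ultimately have "r dvd q i + me x (\<rho> i)" using dvd_add_right_iff by blast
      then show ?thesis using v\<rho>[OF i(1)] i(2) by simp
    qed
    moreover have "v k < v j \<or> v j = v k \<and> mp x j < mp x k" if jk: "j < k" "k < n" for j k
    proof -
      obtain i i' where i: "i < n" "j = \<rho> i" "i' < n" "k = \<rho> i'" using inv[of j] inv[of k] jk by auto
      then show ?thesis using jk \<rho>(2)[OF i(1,3)] key_iff[OF i(1,3)] v\<rho>[OF i(1)] v\<rho>[OF i(3)] by (simp add: mpx)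
    qed
    moreover have "v j = 0" if "j \<ge> n" for j using that by (simp add: v_def)
    ultimately show ?thesis by (simp add: compat_seqs_def)
  qed
  have "merge_seqs m (mp y) v w = u"
  proof
    fix i show "merge_seqs m (mp y) v w i = u i"
    proof (cases "i < n")
      case True
      then show ?thesis using uqw[of i] v\<rho>[OF True] by (simp add: merge_seqs_def y(2) N_def)
    qed (use uD(1) in \<open>simp add: merge_seqs_def\<close>)
  qed
  then show ?thesis using x y(1) X W xy by blast
qed

text \<open>Both sides count merged sequences: the left one by the factorization they come from, the
  right one as the compatible sequences of \<open>z\<close>.\<close>

lemma sum_factorizations:
  assumes z: "z \<in> G"
  shows "(\<Sum>(x, y) | x \<in> G \<and> y \<in> G \<and> x * y = z.
      ((m + n - des r \<zeta> n x) choose n) * ((m' + n - des r \<zeta> n y) choose n)) =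
    ((r * m * m' + m + m' + n - des r \<zeta> n z) choose n)"
proof -
  let ?P = "{(x, y). x \<in> G \<and> y \<in> G \<and> x * y = z}"
  have fP: "finite ?P" by (rule finite_subset[of _ "G \<times> G"]) (use finite_G in auto)
  have "bij_betw (\<lambda>((x, y), v, w). merge_seqs m (mp y) v w) (factor_seqs m m' z) (compat_seqs (r * m * m' + m + m') z)"
    unfolding bij_betw_def
  proof
    show "(\<lambda>((x, y), v, w). merge_seqs m (mp y) v w) ` factor_seqs m m' z = compat_seqs (r * m * m' + m + m') z"
    proof
      show "(\<lambda>((x, y), v, w). merge_seqs m (mp y) v w) ` factor_seqs m m' z \<subseteq> compat_seqs (r * m * m' + m + m') z"
      proof
        fix u assume "u \<in> (\<lambda>((x, y), v, w). merge_seqs m (mp y) v w) ` factor_seqs m m' z"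
        then obtain x y v w where *: "((x, y), v, w) \<in> factor_seqs m m' z" "u = merge_seqs m (mp y) v w" by auto
        then have "x \<in> G" "y \<in> G" "x * y = z" "v \<in> compat_seqs m x" "w \<in> compat_seqs m' y"
          by (auto simp: factor_seqs_def)
        then show "u \<in> compat_seqs (r * m * m' + m + m') z"
          using merge_in_compat_seqs[of x y v m w m'] *(2) by simp
      qed
      show "compat_seqs (r * m * m' + m + m') z \<subseteq> (\<lambda>((x, y), v, w). merge_seqs m (mp y) v w) ` factor_seqs m m' z"
      proof
        fix u assume "u \<in> compat_seqs (r * m * m' + m + m') z"
        then obtain x y v w where "x \<in> G" "y \<in> G" "v \<in> compat_seqs m x" "w \<in> compat_seqs m' y" "x * y = z" "merge_seqs m (mp y) v w = u"
          using merge_surj[OF z] by blast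
        then show "u \<in> (\<lambda>((x, y), v, w). merge_seqs m (mp y) v w) ` factor_seqs m m' z"
          by (intro image_eqI[of _ _ "((x, y), v, w)"]) (auto simp: factor_seqs_def)
      qed
    qed
  qed (rule inj_on_merge)
  then have "card (factor_seqs m m' z) = (r * m * m' + m + m' + n - des r \<zeta> n z) choose n"
    using bij_betw_same_card card_compat(2)[OF z] by metis
  moreover have "card (factor_seqs m m' z) = (\<Sum>(x, y)\<in>?P. card (compat_seqs m x) * card (compat_seqs m' y))"
    unfolding factor_seqs_def
    by (subst card_SigmaI[OF fP]) (auto simp: card_compat(1) card_cartesian_product intro!: sum.cong)
  moreover have "\<dots> = (\<Sum>(x, y)\<in>?P. ((m + n - des r \<zeta> n x) choose n) * ((m' + n - des r \<zeta> n y) choose n))"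
    by (rule sum.cong) (auto simp: card_compat(2))
  ultimately show ?thesis by simp
qed

section \<open>Structure constants of the Foulkes characters\<close>

lemma class_val_ell:
  assumes "\<And>x. f x = h (ell r \<zeta> n x)" "Cset r \<zeta> n i \<noteq> {}"
  shows "class_val r \<zeta> n f i = h i"
proof -
  have "f ` Cset r \<zeta> n i = {h i}"
    using assms by (auto simp: Cset_def image_iff)
  then show ?thesis by (simp add: class_val_def)
qed

text \<open>On an empty level set \<open>class_val\<close> is unspecified, but then its coefficient
  in the inner product is 0, so it may be replaced by any formula in \<open>ell\<close>.\<close>

lemma mu_empty:
  assumes "Cset r \<zeta> n i = {} \<or> Cset r \<zeta> n j = {}"
  shows "mu r \<zeta> n i j = 0"
proof -
  have "mu_seq r \<zeta> n lams i j = 0" for lams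
    unfolding mu_seq_def using assms by auto
  then show ?thesis by (simp add: mu_def Let_def)
qed

lemma CF_inner_ell:
  assumes "\<And>x. f x = hf (ell r \<zeta> n x)" "\<And>x. g x = hg (ell r \<zeta> n x)" "\<And>l. cnj (hg l) = hg l"
  shows "CF_inner r \<zeta> n f g =
    (\<Sum>i\<le>n. \<Sum>j\<le>n. hf i * hg j * of_real (mu r \<zeta> n i j)) / of_nat (card G)"
proof -
  have "class_val r \<zeta> n f i * cnj (class_val r \<zeta> n g j) * of_real (mu r \<zeta> n i j) = hf i * hg j * of_real (mu r \<zeta> n i j)" for i j
  proof (cases "Cset r \<zeta> n i = {} \<or> Cset r \<zeta> n j = {}")
    case True
    then show ?thesis by (simp add: mu_empty)
  next
    case False
    then show ?thesis
      using class_val_ell[of f hf i] class_val_ell[of g hg j] assms by simp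
  qed
  then show ?thesis unfolding CF_inner_def by (simp only: mult_1 times_divide_eq_left)
qed

definition coef :: "nat \<Rightarrow> nat \<Rightarrow> complex" where
  "coef k m = (-1) ^ (k - m) * of_nat (Suc n choose (k - m))"

lemma foulkes_eq:
  assumes "k \<le> n"
  shows "foulkes r \<zeta> n k x = (\<Sum>m\<le>k. coef k m * of_nat (r * m + 1) ^ ell r \<zeta> n x)"
  unfolding foulkes_def coef_def
  by (rule sum.mono_neutral_cong_right) (use assms in auto)

lemma coef_inversion: "d \<le> n \<Longrightarrow> (\<Sum>m\<le>k. coef k m * of_nat ((m + n - d) choose n)) = (if d = k then 1 else 0)"
  unfolding coef_def by (rule binomial_inversion)

text \<open>By \<open>sum_mu\<close> the pairing of two powers is a sum over \<open>p\<close> of two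
  binomials; the alternating sum over \<open>m\<close> annihilates the second one except for
  \<open>p = k\<close>.\<close>

lemma inner_power_foulkes:
  assumes k: "k \<le> n"
  shows "(\<Sum>i\<le>n. \<Sum>j\<le>n. of_nat (r * M + 1) ^ i * (\<Sum>m\<le>k. coef k m * of_nat (r * m + 1) ^ j) * of_real (mu r \<zeta> n i j)) =
    of_nat (card G) * of_nat ((M + n - k) choose n)"
proof -
  have "(\<Sum>i\<le>n. \<Sum>j\<le>n. of_nat (r * M + 1) ^ i * (\<Sum>m\<le>k. coef k m * of_nat (r * m + 1) ^ j) * of_real (mu r \<zeta> n i j)) =
      (\<Sum>i\<le>n. \<Sum>j\<le>n. \<Sum>m\<le>k. coef k m * (of_nat (r * M + 1) ^ i * of_nat (r * m + 1) ^ j * of_real (mu r \<zeta> n i j)))"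
    by (intro sum.cong refl) (simp only: sum_distrib_left sum_distrib_right mult_ac)
  also have "\<dots> = (\<Sum>i\<le>n. \<Sum>m\<le>k. \<Sum>j\<le>n. coef k m * (of_nat (r * M + 1) ^ i * of_nat (r * m + 1) ^ j * of_real (mu r \<zeta> n i j)))"
    by (intro sum.cong sum.swap refl)
  also have "\<dots> = (\<Sum>m\<le>k. \<Sum>i\<le>n. \<Sum>j\<le>n. coef k m * (of_nat (r * M + 1) ^ i * of_nat (r * m + 1) ^ j * of_real (mu r \<zeta> n i j)))"
    by (rule sum.swap)
  also have "\<dots> = (\<Sum>m\<le>k. coef k m * (of_nat (card G) * (\<Sum>p\<le>n. ff M m p)))"
    by (simp only: sum_distrib_left[symmetric] sum_mu)
  also have "\<dots> = (\<Sum>m\<le>k. \<Sum>p\<le>n. of_nat (card G) * of_nat ((M + n - p) choose n) * (coef k m * of_nat ((m + n - p) choose n)))"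
    by (simp add: ff_def sum_distrib_left mult_ac)
  also have "\<dots> = (\<Sum>p\<le>n. \<Sum>m\<le>k. of_nat (card G) * of_nat ((M + n - p) choose n) * (coef k m * of_nat ((m + n - p) choose n)))"
    by (rule sum.swap)
  also have "\<dots> = (\<Sum>p\<le>n. of_nat (card G) * of_nat ((M + n - p) choose n) * (if p = k then 1 else 0))"
    by (rule sum.cong) (simp_all only: sum_distrib_left[symmetric] coef_inversion atMost_iff)
  also have "\<dots> = (\<Sum>p\<le>n. if p = k then of_nat (card G) * of_nat ((M + n - k) choose n) else 0)"
    by (rule sum.cong) auto
  also have "\<dots> = of_nat (card G) * of_nat ((M + n - k) choose n)" using k by simp
  finally show ?thesis .
qed

text \<open>After expanding the product, pairing with the third character leaves
  \<open>(W m m' + n - k) choose n\<close>. As \<open>z\<close> has \<open>k\<close> descents,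
  \<open>sum_factorizations\<close> turns this into a sum over factorizations of \<open>z\<close>,
  and inverting in \<open>m\<close> and \<open>m'\<close> separately isolates those with
  \<open>i\<close> and \<open>j\<close> descents.\<close>

lemma foulkes_structure_constants:
  assumes i: "i \<le> n" and j: "j \<le> n" and k: "k \<le> n" and z: "z \<in> G" "des r \<zeta> n z = k"
  shows "CF_inner r \<zeta> n (\<lambda>x. foulkes r \<zeta> n i x * foulkes r \<zeta> n j x) (foulkes r \<zeta> n k) =
    of_nat (card {(x, y). x \<in> G \<and> y \<in> G \<and> des r \<zeta> n x = i \<and> des r \<zeta> n y = j \<and> x * y = z})"
proof -
  define W where "W m m' = r * m * m' + m + m'" for m m'
  define g where "g = (of_nat (card G) :: complex)"
  have g: "g \<noteq> 0" using card_G r_pos by (simp add: g_def)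
  define h where "h l = (\<Sum>m\<le>k. coef k m * of_nat (r * m + 1) ^ l)" for l
  have prod: "foulkes r \<zeta> n i x * foulkes r \<zeta> n j x =
      (\<Sum>m\<le>i. \<Sum>m'\<le>j. coef i m * coef j m' * of_nat (r * W m m' + 1) ^ ell r \<zeta> n x)" for x
    unfolding foulkes_eq[OF i] foulkes_eq[OF j] sum_product
  proof (intro sum.cong refl)
    fix m m'
    \<comment> \<open>The index \<open>W\<close> is chosen so that pointwise products of powers of
      \<open>ell\<close> are again such powers, the same rule as for merging.\<close>
    have "of_nat (r * W m m' + 1) = (of_nat (r * m + 1) * of_nat (r * m' + 1) :: complex)"
      unfolding of_nat_mult[symmetric] W_def by (simp add: algebra_simps)
    then show "coef i m * of_nat (r * m + 1) ^ ell r \<zeta> n x * (coef j m' * of_nat (r * m' + 1) ^ ell r \<zeta> n x) =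
        coef i m * coef j m' * of_nat (r * W m m' + 1) ^ ell r \<zeta> n x"
      by (simp only: power_mult_distrib mult_ac)
  qed
  have "CF_inner r \<zeta> n (\<lambda>x. foulkes r \<zeta> n i x * foulkes r \<zeta> n j x) (foulkes r \<zeta> n k) =
      (\<Sum>a\<le>n. \<Sum>b\<le>n. (\<Sum>m\<le>i. \<Sum>m'\<le>j. coef i m * coef j m' * of_nat (r * W m m' + 1) ^ a) * h b * of_real (mu r \<zeta> n a b)) / g"
    unfolding g_def h_def
    by (rule CF_inner_ell) (simp_all add: prod foulkes_eq[OF k] coef_def)
  also have "(\<Sum>a\<le>n. \<Sum>b\<le>n. (\<Sum>m\<le>i. \<Sum>m'\<le>j. coef i m * coef j m' * of_nat (r * W m m' + 1) ^ a) * h b * of_real (mu r \<zeta> n a b)) =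
      (\<Sum>a\<le>n. \<Sum>b\<le>n. \<Sum>(m, m')\<in>{..i} \<times> {..j}. coef i m * coef j m' * (of_nat (r * W m m' + 1) ^ a * h b * of_real (mu r \<zeta> n a b)))"
    by (intro sum.cong refl) (simp add: sum.cartesian_product sum_distrib_right case_prod_unfold mult.assoc)
  also have "\<dots> = (\<Sum>a\<le>n. \<Sum>(m, m')\<in>{..i} \<times> {..j}. \<Sum>b\<le>n. coef i m * coef j m' * (of_nat (r * W m m' + 1) ^ a * h b * of_real (mu r \<zeta> n a b)))"
    unfolding case_prod_unfold by (intro sum.cong sum.swap refl)
  also have "\<dots> = (\<Sum>(m, m')\<in>{..i} \<times> {..j}. \<Sum>a\<le>n. \<Sum>b\<le>n. coef i m * coef j m' * (of_nat (r * W m m' + 1) ^ a * h b * of_real (mu r \<zeta> n a b)))"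
    unfolding case_prod_unfold by (rule sum.swap)
  also have "\<dots> = (\<Sum>(m, m')\<in>{..i} \<times> {..j}. coef i m * coef j m' * (g * of_nat ((W m m' + n - k) choose n)))"
    unfolding case_prod_unfold
    by (rule sum.cong) (simp_all only: sum_distrib_left[symmetric] h_def inner_power_foulkes[OF k] g_def)
  also have "\<dots> / g = (\<Sum>(m, m')\<in>{..i} \<times> {..j}. coef i m * coef j m' * of_nat ((W m m' + n - k) choose n))"
    using g by (simp add: sum_divide_distrib case_prod_unfold mult.assoc)
  also have "\<dots> = (\<Sum>(m, m')\<in>{..i} \<times> {..j}. \<Sum>(x, y) | x \<in> G \<and> y \<in> G \<and> x * y = z.
      (coef i m * of_nat ((m + n - des r \<zeta> n x) choose n)) * (coef j m' * of_nat ((m' + n - des r \<zeta> n y) choose n)))"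
    unfolding case_prod_unfold
  proof (rule sum.cong)
    fix t :: "nat \<times> nat"
    define m m' where "m = fst t" and "m' = snd t"
    have "of_nat ((W m m' + n - k) choose n) = (\<Sum>s | fst s \<in> G \<and> snd s \<in> G \<and> fst s * snd s = z.
        of_nat ((m + n - des r \<zeta> n (fst s)) choose n) * (of_nat ((m' + n - des r \<zeta> n (snd s)) choose n) :: complex))"
      using arg_cong[OF sum_factorizations[OF z(1), of m m'], of "of_nat :: nat \<Rightarrow> complex"] z(2)
      by (simp add: W_def case_prod_unfold)
    then show "coef i (fst t) * coef j (snd t) * of_nat ((W (fst t) (snd t) + n - k) choose n) =
      (\<Sum>s | fst s \<in> G \<and> snd s \<in> G \<and> fst s * snd s = z.
        coef i (fst t) * of_nat ((fst t + n - des r \<zeta> n (fst s)) choose n) * (coef j (snd t) * of_nat ((snd t + n - des r \<zeta> n (snd s)) choose n)))"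
      unfolding m_def m'_def by (simp only: sum_distrib_left mult_ac)
  qed simp
  also have "\<dots> = (\<Sum>(x, y) | x \<in> G \<and> y \<in> G \<and> x * y = z. \<Sum>(m, m')\<in>{..i} \<times> {..j}.
      (coef i m * of_nat ((m + n - des r \<zeta> n x) choose n)) * (coef j m' * of_nat ((m' + n - des r \<zeta> n y) choose n)))"
    unfolding case_prod_unfold by (rule sum.swap)
  also have "\<dots> = (\<Sum>(x, y) | x \<in> G \<and> y \<in> G \<and> x * y = z.
      (if des r \<zeta> n x = i then 1 else 0) * (if des r \<zeta> n y = j then 1 else 0 :: complex))"
    by (rule sum.cong) (auto simp: sum.cartesian_product[symmetric] sum_product[symmetric] coef_inversion[OF des_le])
  also have "\<dots> = (\<Sum>(x, y) | x \<in> G \<and> y \<in> G \<and> des r \<zeta> n x = i \<and> des r \<zeta> n y = j \<and> x * y = z. 1)"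
  proof (rule sum.mono_neutral_cong_right)
    show "finite {(x, y). x \<in> G \<and> y \<in> G \<and> x * y = z}"
      by (rule finite_subset[of _ "G \<times> G"]) (use finite_G in auto)
  qed (auto split: if_splits)
  finally show ?thesis by simp
qed

end

theorem theorem3p16:
  fixes r n i j k :: nat and \<zeta> :: complex and z :: "complex mat"
  assumes "r \<ge> 2" and "n \<ge> 1"
    and "primitive_root_of_unity r \<zeta>"
    and "i \<le> n" and "j \<le> n" and "k \<le> n"
    and "z \<in> Grn \<zeta> n" and "des r \<zeta> n z = k"
  shows "CF_inner r \<zeta> n (\<lambda>x. foulkes r \<zeta> n i x * foulkes r \<zeta> n j x) (foulkes r \<zeta> n k)
         = of_nat (card {(x, y). x \<in> Grn \<zeta> n \<and> y \<in> Grn \<zeta> n \<and>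
                           des r \<zeta> n x = i \<and> des r \<zeta> n y = j \<and> x * y = z})"
proof -
  interpret wreath r n \<zeta> by unfold_locales (use assms in auto)
  show ?thesis by (rule foulkes_structure_constants) (use assms in auto)
qed

end
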